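(* Let $N\to M$ be a ring homomorphism such that the ring extension $M|N$ is left depth two (left D2). Put $R=C_M(N)$, $A=\mathrm{End}({}_NM_N)$, $B=(M\otimes_NM)^N$ and $C=\mathrm{End}({}_N(M\otimes_NM)_M)$, with the bimodule structures ${}_CB_R$ and ${}_RA_C$ given in the context. Then $C$ and $R$ are Morita equivalent rings, with ${}_CB_R$ and ${}_RA_C$ the invertible bimodules of a Morita context. In particular $B_R$ and ${}_RA$ are finitely generated projective generators, and the following maps are isomorphisms: 1. $\mu_R: B\otimes_RA\to C$, $b\otimes\alpha\mapsto(m\otimes m'\mapsto b\,\alpha(m)m')$; 2. $\psi: B_R\to\mathrm{Hom}({}_RA,{}_RR)_R$, $b\mapsto(\alpha\mapsto\alpha(b^1)b^2)$; 3. $\tau: B\otimes_RM\to M\otimes_NM$, $b\otimes m\mapsto bm$; 4. $\iota: M\otimes_NM\to\mathrm{Hom}({}_RA,{}_RM)$, $\iota(m\otimes m')(\alpha)=\alpha(m)m'$; 5. $C\to\mathrm{End}(B_R)$, $c\mapsto(b\mapsto c(b))$; 6. $C\to\mathrm{End}({}_RA)$, $c\mapsto\big(\alpha\mapsto\mu\circ(\alpha\otimes\mathrm{id}_M)\circ c\circ\iota_1\big)$, where $\mu:M\otimes_NM\to M$ is multiplication and $\iota_1:M\to M\otimes_NM$, $\iota_1(m)=m\otimes1$ (endomorphisms of the left module ${}_RA$ being regarded as acting on the right).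
   Context: Rings are unital and ring homomorphisms preserve units. A ring extension $M|N$ is a ring homomorphism $N\to M$, which makes $M$ an $N$-$N$-bimodule. $M|N$ is left D2 if there is a positive integer $n$ such that $M\otimes_NM$ is isomorphic, as an $N$-$M$-bimodule, to a direct summand of $\oplus^n\,{}_NM_M$. $R=C_M(N)$ is the centralizer of (the image of) $N$ in $M$; $A=\mathrm{End}({}_NM_N)$ is the ring of $N$-$N$-bimodule endomorphisms of $M$ under composition; $B=(M\otimes_NM)^N=\{b\in M\otimes_NM: nb=bn\ \forall n\in N\}$, whose elements are written $b=b^1\otimes b^2$ (summation suppressed); $C=\mathrm{End}({}_N(M\otimes_NM)_M)$ is the ring of $N$-$M$-bimodule endomorphisms under composition. Bimodule structures: on ${}_CB_R$, $c\cdot b\cdot r=c(b^1\otimes b^2r)$; on ${}_RA_C$, $(r\cdot\alpha\cdot c)(m)=r\,\mu\big((\alpha\otimes\mathrm{id}_M)(c(m\otimes1))\big)$, where $(\alpha\otimes \mathrm{id}_M)(x\otimes y)=\alpha(x)\otimes y$. $M$ is a left $R$-module by left multiplication. *)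

theory Defs
  imports "HOL-Algebra.Free_Abelian_Groups" "HOL-Algebra.Generated_Groups"
    "HOL-Algebra.Module" "HOL-Algebra.QuotRing"
begin

section \<open>Modules and bimodules over noncommutative rings\<close>

text \<open>
  The locale \<^locale>\<open>module\<close> of HOL-Algebra requires a commutative ring of scalars. As for the
  record \<^typ>\<open>('a, 'b) module\<close>, the multiplication and the unit of the underlying ring record
  carry no meaning here. A one-sided module is a bimodule record whose other action is ignored;
  when such a record is quantified over, the unused scalar type is \<^typ>\<open>unit\<close>.
\<close>

record ('a, 'b, 'c) bimodule = "('a, 'b) module" +
  rsmult :: "['b, 'c] \<Rightarrow> 'b" (infixl \<open>\<bullet>\<index>\<close> 70)

locale left_module = R?: ring R + X?: abelian_group X
  for R (structure) and X :: "('a, 'b, 'm) module_scheme" (structure) +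
  assumes lsmult_closed: "\<lbrakk>r \<in> carrier R; x \<in> carrier X\<rbrakk> \<Longrightarrow> r \<odot>\<^bsub>X\<^esub> x \<in> carrier X"
    and lsmult_l_distr: "\<lbrakk>r \<in> carrier R; r' \<in> carrier R; x \<in> carrier X\<rbrakk> \<Longrightarrow>
      (r \<oplus>\<^bsub>R\<^esub> r') \<odot>\<^bsub>X\<^esub> x = r \<odot>\<^bsub>X\<^esub> x \<oplus>\<^bsub>X\<^esub> r' \<odot>\<^bsub>X\<^esub> x"
    and lsmult_r_distr: "\<lbrakk>r \<in> carrier R; x \<in> carrier X; y \<in> carrier X\<rbrakk> \<Longrightarrow>
      r \<odot>\<^bsub>X\<^esub> (x \<oplus>\<^bsub>X\<^esub> y) = r \<odot>\<^bsub>X\<^esub> x \<oplus>\<^bsub>X\<^esub> r \<odot>\<^bsub>X\<^esub> y"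
    and lsmult_assoc: "\<lbrakk>r \<in> carrier R; r' \<in> carrier R; x \<in> carrier X\<rbrakk> \<Longrightarrow>
      (r \<otimes>\<^bsub>R\<^esub> r') \<odot>\<^bsub>X\<^esub> x = r \<odot>\<^bsub>X\<^esub> (r' \<odot>\<^bsub>X\<^esub> x)"
    and lsmult_one: "x \<in> carrier X \<Longrightarrow> \<one>\<^bsub>R\<^esub> \<odot>\<^bsub>X\<^esub> x = x"

locale right_module = X?: abelian_group X + S?: ring S
  for X :: "('a, 'b, 'c, 'm) bimodule_scheme" (structure) and S (structure) +
  assumes rsmult_closed: "\<lbrakk>x \<in> carrier X; s \<in> carrier S\<rbrakk> \<Longrightarrow> x \<bullet>\<^bsub>X\<^esub> s \<in> carrier X"
    and rsmult_l_distr: "\<lbrakk>x \<in> carrier X; y \<in> carrier X; s \<in> carrier S\<rbrakk> \<Longrightarrow>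
      (x \<oplus>\<^bsub>X\<^esub> y) \<bullet>\<^bsub>X\<^esub> s = x \<bullet>\<^bsub>X\<^esub> s \<oplus>\<^bsub>X\<^esub> y \<bullet>\<^bsub>X\<^esub> s"
    and rsmult_r_distr: "\<lbrakk>x \<in> carrier X; s \<in> carrier S; s' \<in> carrier S\<rbrakk> \<Longrightarrow>
      x \<bullet>\<^bsub>X\<^esub> (s \<oplus>\<^bsub>S\<^esub> s') = x \<bullet>\<^bsub>X\<^esub> s \<oplus>\<^bsub>X\<^esub> x \<bullet>\<^bsub>X\<^esub> s'"
    and rsmult_assoc: "\<lbrakk>x \<in> carrier X; s \<in> carrier S; s' \<in> carrier S\<rbrakk> \<Longrightarrow>
      x \<bullet>\<^bsub>X\<^esub> (s \<otimes>\<^bsub>S\<^esub> s') = (x \<bullet>\<^bsub>X\<^esub> s) \<bullet>\<^bsub>X\<^esub> s'"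
    and rsmult_one: "x \<in> carrier X \<Longrightarrow> x \<bullet>\<^bsub>X\<^esub> \<one>\<^bsub>S\<^esub> = x"

locale bimodule = left_module R X + right_module X S
  for R (structure) and X :: "('a, 'b, 'c, 'm) bimodule_scheme" (structure) and S (structure) +
  assumes smult_rsmult_assoc: "\<lbrakk>r \<in> carrier R; x \<in> carrier X; s \<in> carrier S\<rbrakk> \<Longrightarrow>
      (r \<odot>\<^bsub>X\<^esub> x) \<bullet>\<^bsub>X\<^esub> s = r \<odot>\<^bsub>X\<^esub> (x \<bullet>\<^bsub>X\<^esub> s)"

text \<open>
  Homomorphisms are extensional functions, so that two of them are equal as soon as they agree on
  the carrier and the sets below are the underlying sets of Hom-groups.
\<close>

definition add_hom ::
    "('b, 'm) ring_scheme \<Rightarrow> ('c, 'n) ring_scheme \<Rightarrow> ('b \<Rightarrow> 'c) set" where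
  "add_hom X Y = {f \<in> extensional (carrier X). f \<in> hom (add_monoid X) (add_monoid Y)}"

definition left_hom ::
    "('a, 'k) ring_scheme \<Rightarrow> ('a, 'b, 'm) module_scheme \<Rightarrow> ('a, 'c, 'n) module_scheme
      \<Rightarrow> ('b \<Rightarrow> 'c) set" where
  "left_hom R X Y =
    {f \<in> add_hom X Y. \<forall>r\<in>carrier R. \<forall>x\<in>carrier X. f (r \<odot>\<^bsub>X\<^esub> x) = r \<odot>\<^bsub>Y\<^esub> f x}"

definition right_hom ::
    "('a, 'b, 's, 'm) bimodule_scheme \<Rightarrow> ('d, 'c, 's, 'n) bimodule_scheme \<Rightarrow> ('s, 'k) ring_scheme
      \<Rightarrow> ('b \<Rightarrow> 'c) set" where
  "right_hom X Y S =
    {f \<in> add_hom X Y. \<forall>x\<in>carrier X. \<forall>s\<in>carrier S. f (x \<bullet>\<^bsub>X\<^esub> s) = f x \<bullet>\<^bsub>Y\<^esub> s}"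

definition bimodule_hom ::
    "('a, 'k) ring_scheme \<Rightarrow> ('a, 'b, 's, 'm) bimodule_scheme \<Rightarrow> ('a, 'c, 's, 'n) bimodule_scheme
      \<Rightarrow> ('s, 'l) ring_scheme \<Rightarrow> ('b \<Rightarrow> 'c) set" where
  "bimodule_hom R X Y S = left_hom R X Y \<inter> right_hom X Y S"

definition bimodule_iso ::
    "('a, 'k) ring_scheme \<Rightarrow> ('a, 'b, 's, 'm) bimodule_scheme \<Rightarrow> ('a, 'c, 's, 'n) bimodule_scheme
      \<Rightarrow> ('s, 'l) ring_scheme \<Rightarrow> ('b \<Rightarrow> 'c) set" where
  "bimodule_iso R X Y S = {f \<in> bimodule_hom R X Y S. bij_betw f (carrier X) (carrier Y)}"

text \<open>The ring on a set \<open>H\<close> of additive endomorphisms of \<open>X\<close>, with composition as product.\<close>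

definition end_ring :: "('b, 'm) ring_scheme \<Rightarrow> ('b \<Rightarrow> 'b) set \<Rightarrow> ('b \<Rightarrow> 'b) ring" where
  "end_ring X H =
    \<lparr>carrier = H,
     mult = compose (carrier X),
     one = (\<lambda>x\<in>carrier X. x),
     zero = (\<lambda>x\<in>carrier X. \<zero>\<^bsub>X\<^esub>),
     add = (\<lambda>f g. \<lambda>x\<in>carrier X. f x \<oplus>\<^bsub>X\<^esub> g x)\<rparr>"

definition opposite_ring :: "'a ring \<Rightarrow> 'a ring" where
  "opposite_ring R = R\<lparr>mult := (\<lambda>x y. y \<otimes>\<^bsub>R\<^esub> x)\<rparr>"

text \<open>
  A ring \<open>M\<close> with left scalars restricted along \<open>f\<close> and right scalars restricted along \<open>g\<close>; with
  \<open>f = id\<close> and \<open>g = id\<close> this is the regular bimodule.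
\<close>

definition ring_bimodule ::
    "('b, 'm) ring_scheme \<Rightarrow> ('a \<Rightarrow> 'b) \<Rightarrow> ('c \<Rightarrow> 'b) \<Rightarrow> ('a, 'b, 'c) bimodule" where
  "ring_bimodule M f g =
    \<lparr>carrier = carrier M, mult = mult M, one = \<one>\<^bsub>M\<^esub>, zero = \<zero>\<^bsub>M\<^esub>, add = add M,
     smult = (\<lambda>a x. f a \<otimes>\<^bsub>M\<^esub> x), rsmult = (\<lambda>x c. x \<otimes>\<^bsub>M\<^esub> g c)\<rparr>"

text \<open>\<open>X\<close> as a left module over a ring of endofunctions of \<open>X\<close>, acting by evaluation.\<close>

definition eval_bimodule ::
    "('a, 'b, 'c) bimodule \<Rightarrow> ('b \<Rightarrow> 'b, 'b, 'c) bimodule" where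
  "eval_bimodule X =
    \<lparr>carrier = carrier X, mult = mult X, one = \<one>\<^bsub>X\<^esub>, zero = \<zero>\<^bsub>X\<^esub>, add = add X,
     smult = (\<lambda>f x. f x), rsmult = rsmult X\<rparr>"

text \<open>
  For an \<open>R\<close>-\<open>S\<close>-bimodule \<open>X\<close> and an \<open>R\<close>-\<open>T\<close>-bimodule \<open>Y\<close>, the \<open>S\<close>-\<open>T\<close>-bimodule of left
  \<open>R\<close>-linear maps \<open>X \<rightarrow> Y\<close>, where \<open>(s f t)(x) = f(x s) t\<close>.
\<close>

definition left_hom_bimodule ::
    "('a, 'k) ring_scheme \<Rightarrow> ('a, 'b, 's) bimodule \<Rightarrow> ('a, 'c, 't) bimodule
      \<Rightarrow> ('s, 'b \<Rightarrow> 'c, 't) bimodule" where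
  "left_hom_bimodule R X Y =
    \<lparr>carrier = left_hom R X Y, mult = undefined, one = undefined,
     zero = (\<lambda>x\<in>carrier X. \<zero>\<^bsub>Y\<^esub>),
     add = (\<lambda>f g. \<lambda>x\<in>carrier X. f x \<oplus>\<^bsub>Y\<^esub> g x),
     smult = (\<lambda>s f. \<lambda>x\<in>carrier X. f (x \<bullet>\<^bsub>X\<^esub> s)),
     rsmult = (\<lambda>f t. \<lambda>x\<in>carrier X. f x \<bullet>\<^bsub>Y\<^esub> t)\<rparr>"

definition direct_power :: "nat \<Rightarrow> ('a, 'b, 'c) bimodule \<Rightarrow> ('a, nat \<Rightarrow> 'b, 'c) bimodule" where
  "direct_power n X =
    \<lparr>carrier = {..<n} \<rightarrow>\<^sub>E carrier X, mult = undefined, one = undefined,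
     zero = (\<lambda>i\<in>{..<n}. \<zero>\<^bsub>X\<^esub>),
     add = (\<lambda>x y. \<lambda>i\<in>{..<n}. x i \<oplus>\<^bsub>X\<^esub> y i),
     smult = (\<lambda>r x. \<lambda>i\<in>{..<n}. r \<odot>\<^bsub>X\<^esub> x i),
     rsmult = (\<lambda>x s. \<lambda>i\<in>{..<n}. x i \<bullet>\<^bsub>X\<^esub> s)\<rparr>"

definition subbimodule ::
    "('a, 'k) ring_scheme \<Rightarrow> 'b set \<Rightarrow> ('a, 'b, 's) bimodule \<Rightarrow> ('s, 'l) ring_scheme \<Rightarrow> bool" where
  "subbimodule R U X S \<longleftrightarrow>
     subgroup U (add_monoid X) \<and>
     (\<forall>r\<in>carrier R. \<forall>u\<in>U. r \<odot>\<^bsub>X\<^esub> u \<in> U) \<and>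
     (\<forall>u\<in>U. \<forall>s\<in>carrier S. u \<bullet>\<^bsub>X\<^esub> s \<in> U)"

definition iso_to_direct_summand ::
    "('a, 'k) ring_scheme \<Rightarrow> ('a, 'b, 's) bimodule \<Rightarrow> ('a, 'c, 's) bimodule
      \<Rightarrow> ('s, 'l) ring_scheme \<Rightarrow> bool" where
  "iso_to_direct_summand R X Y S \<longleftrightarrow>
     (\<exists>U V. subbimodule R U Y S \<and> subbimodule R V Y S \<and>
        U <+>\<^bsub>Y\<^esub> V = carrier Y \<and> U \<inter> V = {\<zero>\<^bsub>Y\<^esub>} \<and>
        bimodule_iso R X (Y\<lparr>carrier := U\<rparr>) S \<noteq> {})"


section \<open>Tensor products\<close>

text \<open>
  The tensor product over \<open>S\<close> of a right module \<open>X\<close> and a left module \<open>Y\<close> is the quotient of the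
  free abelian group on the pairs by the subgroup generated by the usual relations; its elements
  are cosets.
\<close>

type_synonym ('x, 'y) tensor = "(('x \<times> 'y) \<Rightarrow>\<^sub>0 int) set"

definition tensor_relations ::
    "('a, 'x, 's) bimodule \<Rightarrow> ('s, 'k) ring_scheme \<Rightarrow> ('s, 'y, 'c) bimodule
      \<Rightarrow> (('x \<times> 'y) \<Rightarrow>\<^sub>0 int) set" where
  "tensor_relations X S Y =
     {frag_of (x \<oplus>\<^bsub>X\<^esub> x', y) - frag_of (x, y) - frag_of (x', y) | x x' y.
        x \<in> carrier X \<and> x' \<in> carrier X \<and> y \<in> carrier Y} \<union>
     {frag_of (x, y \<oplus>\<^bsub>Y\<^esub> y') - frag_of (x, y) - frag_of (x, y') | x y y'.
        x \<in> carrier X \<and> y \<in> carrier Y \<and> y' \<in> carrier Y} \<union>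
     {frag_of (x \<bullet>\<^bsub>X\<^esub> s, y) - frag_of (x, s \<odot>\<^bsub>Y\<^esub> y) | x s y.
        x \<in> carrier X \<and> s \<in> carrier S \<and> y \<in> carrier Y}"

definition tensor_null ::
    "('a, 'x, 's) bimodule \<Rightarrow> ('s, 'k) ring_scheme \<Rightarrow> ('s, 'y, 'c) bimodule \<Rightarrow> ('x, 'y) tensor" where
  "tensor_null X S Y =
     generate (free_Abelian_group (carrier X \<times> carrier Y)) (tensor_relations X S Y)"

definition pure_tensor ::
    "('a, 'x, 's) bimodule \<Rightarrow> ('s, 'k) ring_scheme \<Rightarrow> ('s, 'y, 'c) bimodule
      \<Rightarrow> 'x \<Rightarrow> 'y \<Rightarrow> ('x, 'y) tensor" where
  "pure_tensor X S Y x y =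
     tensor_null X S Y #>\<^bsub>free_Abelian_group (carrier X \<times> carrier Y)\<^esub> frag_of (x, y)"

definition tensor_group ::
    "('a, 'x, 's) bimodule \<Rightarrow> ('s, 'k) ring_scheme \<Rightarrow> ('s, 'y, 'c) bimodule
      \<Rightarrow> ('x, 'y) tensor ring" where
  "tensor_group X S Y =
    (let Q = free_Abelian_group (carrier X \<times> carrier Y) Mod tensor_null X S Y in
     \<lparr>carrier = carrier Q, mult = undefined, one = undefined, zero = \<one>\<^bsub>Q\<^esub>, add = mult Q\<rparr>)"

text \<open>
  The additive map into \<open>Z\<close> with \<open>x \<otimes> y \<mapsto> f x y\<close>, evaluated on a chosen representative of the
  coset. The value does not depend on the choice if \<open>f\<close> is biadditive and balanced; see
  \<open>tensor_lift_pure_tensor\<close> below.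
\<close>

definition tensor_lift ::
    "('z, 'm) ring_scheme \<Rightarrow> ('x \<Rightarrow> 'y \<Rightarrow> 'z) \<Rightarrow> ('x, 'y) tensor \<Rightarrow> 'z" where
  "tensor_lift Z f t =
    (let c = (SOME c. c \<in> t) in
     \<Oplus>\<^bsub>Z\<^esub>p\<in>Poly_Mapping.keys c. [Poly_Mapping.lookup c p] \<cdot>\<^bsub>Z\<^esub> f (fst p) (snd p))"

definition tensor ::
    "('a, 'x, 's) bimodule \<Rightarrow> ('s, 'k) ring_scheme \<Rightarrow> ('s, 'y, 'c) bimodule
      \<Rightarrow> ('a, ('x, 'y) tensor, 'c) bimodule" where
  "tensor X S Y =
    (let T = tensor_group X S Y in
     \<lparr>carrier = carrier T, mult = mult T, one = \<one>\<^bsub>T\<^esub>, zero = \<zero>\<^bsub>T\<^esub>, add = add T,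
      smult = (\<lambda>a. tensor_lift T (\<lambda>x y. pure_tensor X S Y (a \<odot>\<^bsub>X\<^esub> x) y)),
      rsmult = (\<lambda>t c. tensor_lift T (\<lambda>x y. pure_tensor X S Y x (y \<bullet>\<^bsub>Y\<^esub> c)) t)\<rparr>)"

text \<open>The map \<open>f \<otimes> g\<close> from the tensor product of \<open>X\<close>, \<open>Y\<close> to that of \<open>X'\<close>, \<open>Y'\<close>.\<close>

definition tensor_map ::
    "('a, 'x, 's) bimodule \<Rightarrow> ('s, 'k) ring_scheme \<Rightarrow> ('s, 'y, 'c) bimodule
      \<Rightarrow> ('a, 'x2, 's) bimodule \<Rightarrow> ('s, 'y2, 'c) bimodule
      \<Rightarrow> ('x \<Rightarrow> 'x2) \<Rightarrow> ('y \<Rightarrow> 'y2) \<Rightarrow> ('x, 'y) tensor \<Rightarrow> ('x2, 'y2) tensor" where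
  "tensor_map X S Y X' Y' f g =
     (\<lambda>t\<in>carrier (tensor X S Y). tensor_lift (tensor X' S Y') (\<lambda>x y. pure_tensor X' S Y' (f x) (g y)) t)"

lemma tensor_lift_pure_tensor:
  fixes X :: "('a, 'x, 's) bimodule" and Y :: "('s, 'y, 'c) bimodule"
  assumes Z: "abelian_group Z"
    and f: "\<And>x y. x \<in> carrier X \<Longrightarrow> y \<in> carrier Y \<Longrightarrow> f x y \<in> carrier Z"
    and add1: "\<And>x x' y. x \<in> carrier X \<Longrightarrow> x' \<in> carrier X \<Longrightarrow> y \<in> carrier Y \<Longrightarrow>
      x \<oplus>\<^bsub>X\<^esub> x' \<in> carrier X \<and> f (x \<oplus>\<^bsub>X\<^esub> x') y = f x y \<oplus>\<^bsub>Z\<^esub> f x' y"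
    and add2: "\<And>x y y'. x \<in> carrier X \<Longrightarrow> y \<in> carrier Y \<Longrightarrow> y' \<in> carrier Y \<Longrightarrow>
      y \<oplus>\<^bsub>Y\<^esub> y' \<in> carrier Y \<and> f x (y \<oplus>\<^bsub>Y\<^esub> y') = f x y \<oplus>\<^bsub>Z\<^esub> f x y'"
    and bal: "\<And>x s y. x \<in> carrier X \<Longrightarrow> s \<in> carrier S \<Longrightarrow> y \<in> carrier Y \<Longrightarrow>
      x \<bullet>\<^bsub>X\<^esub> s \<in> carrier X \<and> s \<odot>\<^bsub>Y\<^esub> y \<in> carrier Y \<and> f (x \<bullet>\<^bsub>X\<^esub> s) y = f x (s \<odot>\<^bsub>Y\<^esub> y)"
    and xy: "x \<in> carrier X" "y \<in> carrier Y"
  shows "tensor_lift Z f (pure_tensor X S Y x y) = f x y"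
proof -
  interpret Z: abelian_group Z by (rule Z)
  define E where "E = carrier X \<times> carrier Y"
  define F where "F = free_Abelian_group E"
  define f' where "f' p = f (fst p) (snd p)" for p
  have f'_closed: "f' \<in> E \<rightarrow> carrier (add_monoid Z)"
    using f by (auto simp: f'_def E_def)
  have f'_img: "f' ` E \<subseteq> carrier (add_monoid Z)" using f'_closed by auto
  obtain h where h: "h \<in> hom F (add_monoid Z)" "\<And>p. p \<in> E \<Longrightarrow> h (frag_of p) = f' p"
    using comm_group.free_Abelian_group_universal[OF Z.a_comm_group f'_img] unfolding F_def by blast
  interpret H: group_hom F "add_monoid Z" h
    using h(1) by (simp add: F_def group_hom_def group_hom_axioms_def)
  have carrier_F: "c \<in> carrier F \<longleftrightarrow> Poly_Mapping.keys c \<subseteq> E" for c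
    by (simp add: F_def)
  have keys_of: "frag_of p \<in> carrier F" if "p \<in> E" for p
    using that by (simp add: carrier_F)
  have h_add: "h (a + b) = h a \<oplus>\<^bsub>Z\<^esub> h b" if "a \<in> carrier F" "b \<in> carrier F" for a b
    using H.hom_mult[OF that] by (simp add: F_def)
  have h_closed: "h a \<in> carrier Z" if "a \<in> carrier F" for a
    using H.hom_closed[OF that] by simp
  have h_eq_sub: "h (a - b) = \<zero>\<^bsub>Z\<^esub>"
    if "a \<in> carrier F" "b \<in> carrier F" "h a = h b" for a b
  proof -
    have "a - b \<in> carrier F"
      using that keys_diff[of a b] by (auto simp: carrier_F)
    with h_add[of "a - b" b] that h_closed show ?thesis
      by (metis Z.add.r_cancel_one diff_add_cancel)
  qed
  have sum_eq: "h (\<Sum>i\<in>I. frag_cmul (k i) (frag_of i)) = (\<Oplus>\<^bsub>Z\<^esub>i\<in>I. [k i] \<cdot>\<^bsub>Z\<^esub> f' i)"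
    if "finite I" "I \<subseteq> E" for I and k :: "_ \<Rightarrow> int"
    using that
  proof (induction I rule: finite_induct)
    case empty
    show ?case using H.hom_one by (simp add: F_def)
  next
    case (insert i I)
    have c: "frag_cmul (k i) (frag_of i) \<in> carrier F" if "i \<in> E" for i
      using that keys_cmul[of "k i" "frag_of i"] by (auto simp: carrier_F)
    have s: "(\<Sum>i\<in>I. frag_cmul (k i) (frag_of i)) \<in> carrier F"
      unfolding F_def using insert.prems c by (intro sum_closed_free_Abelian_group) (auto simp: F_def)
    have "h (frag_cmul (k i) (frag_of i)) = [k i] \<cdot>\<^bsub>Z\<^esub> f' i"
    proof -
      have "frag_cmul (k i) (frag_of i) = frag_of i [^]\<^bsub>F\<^esub> k i"
        using insert.prems unfolding F_def by (subst int_pow_free_Abelian_group) auto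
      moreover have "h (frag_of i [^]\<^bsub>F\<^esub> k i) = h (frag_of i) [^]\<^bsub>add_monoid Z\<^esub> k i"
        using insert.prems keys_of by (intro H.hom_int_pow) auto
      ultimately show ?thesis
        using insert.prems h(2)[of i] by (simp add: add_pow_def)
    qed
    moreover have "(\<lambda>i. [k i] \<cdot>\<^bsub>Z\<^esub> f' i) \<in> I \<rightarrow> carrier Z" "[k i] \<cdot>\<^bsub>Z\<^esub> f' i \<in> carrier Z"
      using insert.prems f'_closed by (auto intro!: Z.add.int_pow_closed)
    ultimately show ?case
      using insert c s by (simp add: h_add)
  qed
  have h_formula: "h c = (\<Oplus>\<^bsub>Z\<^esub>p\<in>Poly_Mapping.keys c. [Poly_Mapping.lookup c p] \<cdot>\<^bsub>Z\<^esub> f' p)"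
    if "c \<in> carrier F" for c
    using sum_eq[of "Poly_Mapping.keys c" "Poly_Mapping.lookup c"] that frag_expansion[of c]
    by (simp add: carrier_F frag_extend_def)
  have rel: "r \<in> carrier F \<and> h r = \<zero>\<^bsub>Z\<^esub>" if "r \<in> tensor_relations X S Y" for r
  proof -
    have three: "frag_of p - frag_of q - frag_of q' \<in> carrier F \<and>
        h (frag_of p - frag_of q - frag_of q') = \<zero>\<^bsub>Z\<^esub>"
      if "p \<in> E" "q \<in> E" "q' \<in> E" "f' p = f' q \<oplus>\<^bsub>Z\<^esub> f' q'" for p q q'
    proof -
      have e: "frag_of p - frag_of q - frag_of q' = frag_of p - (frag_of q + frag_of q')"
        by simp
      have s: "frag_of q + frag_of q' \<in> carrier F"
        using that keys_add[of "frag_of q" "frag_of q'"] by (auto simp: carrier_F)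
      have "h (frag_of p) = h (frag_of q + frag_of q')"
        using that keys_of by (simp add: h_add h(2))
      then show ?thesis
        unfolding e using h_eq_sub[OF keys_of[OF that(1)] s] keys_of[OF that(1)] s
          keys_diff[of "frag_of p" "frag_of q + frag_of q'"]
        unfolding carrier_F by blast
    qed
    have two: "frag_of p - frag_of q \<in> carrier F \<and> h (frag_of p - frag_of q) = \<zero>\<^bsub>Z\<^esub>"
      if "p \<in> E" "q \<in> E" "f' p = f' q" for p q
      using h_eq_sub[OF keys_of[OF that(1)] keys_of[OF that(2)]] that
        keys_diff[of "frag_of p" "frag_of q"]
      by (auto simp: carrier_F h(2))
    from that consider
      (l) x x' y where "x \<in> carrier X" "x' \<in> carrier X" "y \<in> carrier Y"
        "r = frag_of (x \<oplus>\<^bsub>X\<^esub> x', y) - frag_of (x, y) - frag_of (x', y)"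
    | (r) x y y' where "x \<in> carrier X" "y \<in> carrier Y" "y' \<in> carrier Y"
        "r = frag_of (x, y \<oplus>\<^bsub>Y\<^esub> y') - frag_of (x, y) - frag_of (x, y')"
    | (b) x s y where "x \<in> carrier X" "s \<in> carrier S" "y \<in> carrier Y"
        "r = frag_of (x \<bullet>\<^bsub>X\<^esub> s, y) - frag_of (x, s \<odot>\<^bsub>Y\<^esub> y)"
      unfolding tensor_relations_def by blast
    then show ?thesis
    proof cases
      case l
      then show ?thesis unfolding l(4) by (intro three) (auto simp: E_def f'_def add1)
    next
      case r
      then show ?thesis unfolding r(4) by (intro three) (auto simp: E_def f'_def add2)
    next
      case b
      then show ?thesis unfolding b(4) by (intro two) (auto simp: E_def f'_def bal)
    qed
  qed
  have null: "c \<in> carrier F \<and> h c = \<zero>\<^bsub>Z\<^esub>" if "c \<in> tensor_null X S Y" for c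
    using that unfolding tensor_null_def E_def[symmetric] F_def[symmetric]
  proof (induction rule: generate.induct)
    case one
    then show ?case using H.hom_one by simp
  next
    case (incl r)
    then show ?case by (rule rel)
  next
    case (inv r)
    then show ?case using rel[OF inv] H.hom_inv[of r] monoid.inv_one[OF group.is_monoid[OF Z.a_group]] by simp
  next
    case (eng a b)
    then show ?case using H.hom_mult[of a b] by simp
  qed
  have mem: "c \<in> carrier F \<and> h c = f x y" if "c \<in> pure_tensor X S Y x y" for c
  proof -
    from that obtain k where k: "k \<in> tensor_null X S Y" "c = k + frag_of (x, y)"
      unfolding pure_tensor_def r_coset_def by (auto simp: free_Abelian_group_def)
    have xyE: "(x, y) \<in> E" using xy by (simp add: E_def)
    have "c \<in> carrier F"
      using null[OF k(1)] k(2) keys_add[of k "frag_of (x, y)"] xyE by (auto simp: carrier_F)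
    moreover have "h c = f x y"
      using null[OF k(1)] k(2) keys_of[OF xyE] xyE xy f by (simp add: h_add h(2) f'_def)
    ultimately show ?thesis by simp
  qed
  have "frag_of (x, y) \<in> pure_tensor X S Y x y"
  proof -
    have "0 \<in> tensor_null X S Y"
      unfolding tensor_null_def
      using generate.one[of "free_Abelian_group (carrier X \<times> carrier Y)"] by simp
    then show ?thesis
      unfolding pure_tensor_def r_coset_def by force
  qed
  then have "(SOME c. c \<in> pure_tensor X S Y x y) \<in> pure_tensor X S Y x y"
    by (rule someI)
  then have "(SOME c. c \<in> pure_tensor X S Y x y) \<in> carrier F"
    and "h (SOME c. c \<in> pure_tensor X S Y x y) = f x y"
    using mem by blast+
  then show ?thesis
    using h_formula by (simp add: tensor_lift_def Let_def f'_def)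
qed


section \<open>Finitely generated projective generators\<close>

definition left_fin_gen :: "('a, 'k) ring_scheme \<Rightarrow> ('a, 'p, 'c) bimodule \<Rightarrow> bool" where
  "left_fin_gen R P \<longleftrightarrow>
     (\<exists>F. finite F \<and> F \<subseteq> carrier P \<and>
        (\<forall>p\<in>carrier P. \<exists>a\<in>F \<rightarrow> carrier R. p = (\<Oplus>\<^bsub>P\<^esub>x\<in>F. a x \<odot>\<^bsub>P\<^esub> x)))"

definition right_fin_gen :: "('a, 'p, 's) bimodule \<Rightarrow> ('s, 'k) ring_scheme \<Rightarrow> bool" where
  "right_fin_gen P S \<longleftrightarrow>
     (\<exists>F. finite F \<and> F \<subseteq> carrier P \<and>
        (\<forall>p\<in>carrier P. \<exists>a\<in>F \<rightarrow> carrier S. p = (\<Oplus>\<^bsub>P\<^esub>x\<in>F. x \<bullet>\<^bsub>P\<^esub> a x)))"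

text \<open>
  Projectivity is the lifting property along surjections and a generator separates parallel
  homomorphisms. The test modules range over all modules on the two types named by the last
  argument; a statement with these types left as type variables covers all test modules.
\<close>

definition left_projective ::
    "('a, 'k) ring_scheme \<Rightarrow> ('a, 'p, 'c) bimodule \<Rightarrow> ('x \<times> 'y) itself \<Rightarrow> bool" where
  "left_projective R P T \<longleftrightarrow>
     (\<forall>(X :: ('a, 'x, unit) bimodule) (Y :: ('a, 'y, unit) bimodule) g h.
        left_module R X \<and> left_module R Y \<and>
        g \<in> left_hom R X Y \<and> g ` carrier X = carrier Y \<and> h \<in> left_hom R P Y \<longrightarrow>
        (\<exists>k\<in>left_hom R P X. \<forall>p\<in>carrier P. g (k p) = h p))"

definition right_projective ::
    "('a, 'p, 's) bimodule \<Rightarrow> ('s, 'k) ring_scheme \<Rightarrow> ('x \<times> 'y) itself \<Rightarrow> bool" where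
  "right_projective P S T \<longleftrightarrow>
     (\<forall>(X :: (unit, 'x, 's) bimodule) (Y :: (unit, 'y, 's) bimodule) g h.
        right_module X S \<and> right_module Y S \<and>
        g \<in> right_hom X Y S \<and> g ` carrier X = carrier Y \<and> h \<in> right_hom P Y S \<longrightarrow>
        (\<exists>k\<in>right_hom P X S. \<forall>p\<in>carrier P. g (k p) = h p))"

definition left_generator ::
    "('a, 'k) ring_scheme \<Rightarrow> ('a, 'p, 'c) bimodule \<Rightarrow> ('x \<times> 'y) itself \<Rightarrow> bool" where
  "left_generator R P T \<longleftrightarrow>
     (\<forall>(X :: ('a, 'x, unit) bimodule) (Y :: ('a, 'y, unit) bimodule) f g.
        left_module R X \<and> left_module R Y \<and>
        f \<in> left_hom R X Y \<and> g \<in> left_hom R X Y \<and> f \<noteq> g \<longrightarrow>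
        (\<exists>k\<in>left_hom R P X. \<exists>p\<in>carrier P. f (k p) \<noteq> g (k p)))"

definition right_generator ::
    "('a, 'p, 's) bimodule \<Rightarrow> ('s, 'k) ring_scheme \<Rightarrow> ('x \<times> 'y) itself \<Rightarrow> bool" where
  "right_generator P S T \<longleftrightarrow>
     (\<forall>(X :: (unit, 'x, 's) bimodule) (Y :: (unit, 'y, 's) bimodule) f g.
        right_module X S \<and> right_module Y S \<and>
        f \<in> right_hom X Y S \<and> g \<in> right_hom X Y S \<and> f \<noteq> g \<longrightarrow>
        (\<exists>k\<in>right_hom P X S. \<exists>p\<in>carrier P. f (k p) \<noteq> g (k p)))"

definition left_progenerator ::
    "('a, 'k) ring_scheme \<Rightarrow> ('a, 'p, 'c) bimodule \<Rightarrow> ('x \<times> 'y) itself \<Rightarrow> bool" where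
  "left_progenerator R P T \<longleftrightarrow>
     left_module R P \<and> left_fin_gen R P \<and> left_projective R P T \<and> left_generator R P T"

definition right_progenerator ::
    "('a, 'p, 's) bimodule \<Rightarrow> ('s, 'k) ring_scheme \<Rightarrow> ('x \<times> 'y) itself \<Rightarrow> bool" where
  "right_progenerator P S T \<longleftrightarrow>
     right_module P S \<and> right_fin_gen P S \<and> right_projective P S T \<and> right_generator P S T"


section \<open>Morita contexts and Morita equivalence\<close>

definition morita_context ::
    "('r, 'k) ring_scheme \<Rightarrow> ('s, 'l) ring_scheme \<Rightarrow> ('r, 'p, 's) bimodule \<Rightarrow> ('s, 'q, 'r) bimodule
      \<Rightarrow> (('p, 'q) tensor \<Rightarrow> 'r) \<Rightarrow> (('q, 'p) tensor \<Rightarrow> 's) \<Rightarrow> bool" where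
  "morita_context R S P Q f g \<longleftrightarrow>
     ring R \<and> ring S \<and> bimodule R P S \<and> bimodule S Q R \<and>
     f \<in> bimodule_hom R (tensor P S Q) (ring_bimodule R id id) R \<and>
     g \<in> bimodule_hom S (tensor Q R P) (ring_bimodule S id id) S \<and>
     (\<forall>p\<in>carrier P. \<forall>q\<in>carrier Q. \<forall>p'\<in>carrier P.
        f (pure_tensor P S Q p q) \<odot>\<^bsub>P\<^esub> p' = p \<bullet>\<^bsub>P\<^esub> g (pure_tensor Q R P q p')) \<and>
     (\<forall>q\<in>carrier Q. \<forall>p\<in>carrier P. \<forall>q'\<in>carrier Q.
        g (pure_tensor Q R P q p) \<odot>\<^bsub>Q\<^esub> q' = q \<bullet>\<^bsub>Q\<^esub> f (pure_tensor P S Q p q'))"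

text \<open>\<open>P\<close> and \<open>Q\<close> are invertible, inverse to each other, when both maps are bijective.\<close>

definition invertible_morita_context ::
    "('r, 'k) ring_scheme \<Rightarrow> ('s, 'l) ring_scheme \<Rightarrow> ('r, 'p, 's) bimodule \<Rightarrow> ('s, 'q, 'r) bimodule
      \<Rightarrow> (('p, 'q) tensor \<Rightarrow> 'r) \<Rightarrow> (('q, 'p) tensor \<Rightarrow> 's) \<Rightarrow> bool" where
  "invertible_morita_context R S P Q f g \<longleftrightarrow>
     morita_context R S P Q f g \<and>
     bij_betw f (carrier (tensor P S Q)) (carrier R) \<and>
     bij_betw g (carrier (tensor Q R P)) (carrier S)"

text \<open>
  The endofunctor \<open>X \<mapsto> P \<otimes>\<^sub>S (Q \<otimes>\<^sub>R X)\<close> of the category of left \<open>R\<close>-modules on the type \<open>'x\<close>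
  is naturally isomorphic to the identity.
\<close>

definition tensor_roundtrip_iso ::
    "('r, 'k) ring_scheme \<Rightarrow> ('s, 'l) ring_scheme \<Rightarrow> ('r, 'p, 's) bimodule \<Rightarrow> ('s, 'q, 'r) bimodule
      \<Rightarrow> 'x itself \<Rightarrow> bool" where
  "tensor_roundtrip_iso R S P Q T \<longleftrightarrow>
     (\<exists>\<eta> :: ('r, 'x, unit) bimodule \<Rightarrow> ('p, ('q, 'x) tensor) tensor \<Rightarrow> 'x.
        (\<forall>X. left_module R X \<longrightarrow>
           left_module S (tensor Q R X) \<and> left_module R (tensor P S (tensor Q R X)) \<and>
           \<eta> X \<in> left_hom R (tensor P S (tensor Q R X)) X \<and>
           bij_betw (\<eta> X) (carrier (tensor P S (tensor Q R X))) (carrier X)) \<and>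
        (\<forall>X Y h. left_module R X \<and> left_module R Y \<and> h \<in> left_hom R X Y \<longrightarrow>
           (\<forall>t\<in>carrier (tensor P S (tensor Q R X)).
              \<eta> Y (tensor_map P S (tensor Q R X) P (tensor Q R Y) id
                    (tensor_map Q R X Q Y id h) t) = h (\<eta> X t))))"

text \<open>
  \<open>P \<otimes>\<^sub>S -\<close> and \<open>Q \<otimes>\<^sub>R -\<close> are mutually inverse equivalences between the categories of left
  \<open>R\<close>-modules and left \<open>S\<close>-modules. As above, leaving \<open>'x\<close> as a type variable covers all modules.
\<close>

definition morita_equivalence ::
    "('r, 'k) ring_scheme \<Rightarrow> ('s, 'l) ring_scheme \<Rightarrow> ('r, 'p, 's) bimodule \<Rightarrow> ('s, 'q, 'r) bimodule
      \<Rightarrow> 'x itself \<Rightarrow> bool" where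
  "morita_equivalence R S P Q T \<longleftrightarrow>
     ring R \<and> ring S \<and> bimodule R P S \<and> bimodule S Q R \<and>
     tensor_roundtrip_iso R S P Q T \<and> tensor_roundtrip_iso S R Q P T"


section \<open>Left depth two extensions\<close>

text \<open>
  Below, \<open>\<phi>\<close> is the ring homomorphism \<open>N \<rightarrow> M\<close>. The \<open>N\<close>-\<open>M\<close>-bimodule \<open>M \<otimes>\<^sub>N M\<close> determines the
  right action of \<open>N\<close> on it via \<open>\<phi>\<close>.
\<close>

definition MM :: "'n ring \<Rightarrow> 'm ring \<Rightarrow> ('n \<Rightarrow> 'm) \<Rightarrow> ('n, ('m, 'm) tensor, 'm) bimodule" where
  "MM N M \<phi> = tensor (ring_bimodule M \<phi> \<phi>) N (ring_bimodule M \<phi> id)"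

definition MM_tensor :: "'n ring \<Rightarrow> 'm ring \<Rightarrow> ('n \<Rightarrow> 'm) \<Rightarrow> 'm \<Rightarrow> 'm \<Rightarrow> ('m, 'm) tensor" where
  "MM_tensor N M \<phi> = pure_tensor (ring_bimodule M \<phi> \<phi>) N (ring_bimodule M \<phi> id)"

definition left_D2 :: "'n ring \<Rightarrow> 'm ring \<Rightarrow> ('n \<Rightarrow> 'm) \<Rightarrow> bool" where
  "left_D2 N M \<phi> \<longleftrightarrow>
     (\<exists>n>0. iso_to_direct_summand N (MM N M \<phi>) (direct_power n (ring_bimodule M \<phi> id)) M)"

definition centralizer_ring :: "'n ring \<Rightarrow> 'm ring \<Rightarrow> ('n \<Rightarrow> 'm) \<Rightarrow> 'm ring" where
  "centralizer_ring N M \<phi> =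
     M\<lparr>carrier := {r \<in> carrier M. \<forall>n\<in>carrier N. \<phi> n \<otimes>\<^bsub>M\<^esub> r = r \<otimes>\<^bsub>M\<^esub> \<phi> n}\<rparr>"

definition A_ring :: "'n ring \<Rightarrow> 'm ring \<Rightarrow> ('n \<Rightarrow> 'm) \<Rightarrow> ('m \<Rightarrow> 'm) ring" where
  "A_ring N M \<phi> =
     (let X = ring_bimodule M \<phi> \<phi> in end_ring X (bimodule_hom N X X N))"

definition C_ring ::
    "'n ring \<Rightarrow> 'm ring \<Rightarrow> ('n \<Rightarrow> 'm) \<Rightarrow> (('m, 'm) tensor \<Rightarrow> ('m, 'm) tensor) ring" where
  "C_ring N M \<phi> = end_ring (MM N M \<phi>) (bimodule_hom N (MM N M \<phi>) (MM N M \<phi>) M)"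

definition B_bimodule ::
    "'n ring \<Rightarrow> 'm ring \<Rightarrow> ('n \<Rightarrow> 'm)
      \<Rightarrow> (('m, 'm) tensor \<Rightarrow> ('m, 'm) tensor, ('m, 'm) tensor, 'm) bimodule" where
  "B_bimodule N M \<phi> =
     (eval_bimodule (MM N M \<phi>))
       \<lparr>carrier := {b \<in> carrier (MM N M \<phi>).
                     \<forall>n\<in>carrier N. n \<odot>\<^bsub>MM N M \<phi>\<^esub> b = b \<bullet>\<^bsub>MM N M \<phi>\<^esub> \<phi> n}\<rparr>"

text \<open>The map \<open>\<mu> \<circ> (\<alpha> \<otimes> id\<^sub>M)\<close>, i.e. \<open>m \<otimes> m' \<mapsto> \<alpha>(m) m'\<close>.\<close>

definition mu_alpha ::
    "'n ring \<Rightarrow> 'm ring \<Rightarrow> ('n \<Rightarrow> 'm) \<Rightarrow> ('m \<Rightarrow> 'm) \<Rightarrow> ('m, 'm) tensor \<Rightarrow> 'm" where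
  "mu_alpha N M \<phi> \<alpha> t =
     tensor_lift M (mult M)
       (tensor_map (ring_bimodule M \<phi> \<phi>) N (ring_bimodule M \<phi> id)
          (ring_bimodule M \<phi> \<phi>) (ring_bimodule M \<phi> id) \<alpha> id t)"

definition A_bimodule ::
    "'n ring \<Rightarrow> 'm ring \<Rightarrow> ('n \<Rightarrow> 'm)
      \<Rightarrow> ('m, 'm \<Rightarrow> 'm, ('m, 'm) tensor \<Rightarrow> ('m, 'm) tensor) bimodule" where
  "A_bimodule N M \<phi> =
    \<lparr>carrier = carrier (A_ring N M \<phi>), mult = mult (A_ring N M \<phi>), one = one (A_ring N M \<phi>),
     zero = zero (A_ring N M \<phi>), add = add (A_ring N M \<phi>),
     smult = (\<lambda>r \<alpha>. \<lambda>m\<in>carrier M. r \<otimes>\<^bsub>M\<^esub> \<alpha> m),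
     rsmult = (\<lambda>\<alpha> c. \<lambda>m\<in>carrier M. mu_alpha N M \<phi> \<alpha> (c (MM_tensor N M \<phi> m \<one>\<^bsub>M\<^esub>)))\<rparr>"

end

theory Submission
  imports Defs
begin

text \<open>
  Composing the maps of the direct summand \<open>M \<otimes>\<^sub>N M\<close> of \<open>M\<^sup>n\<close> with the coordinates of \<open>M\<^sup>n\<close> gives \<open>b\<^sub>i \<in> B\<close> and
  \<open>\<alpha>\<^sub>i \<in> A\<close> with \<open>t = \<Sum>\<^sub>i b\<^sub>i \<langle>\<alpha>\<^sub>i, t\<rangle>\<close> for all \<open>t \<in> M \<otimes>\<^sub>N M\<close>, where \<open>\<langle>\<alpha>, m \<otimes> m'\<rangle> = \<alpha>(m) m'\<close>. Hence the
  pairing \<open>B \<times> A \<rightarrow> C\<close>, \<open>(b, \<alpha>) \<mapsto> b \<langle>\<alpha>, -\<rangle>\<close>, hits \<open>1\<close>, and so does the pairing \<open>A \<times> B \<rightarrow> R\<close>,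
  \<open>(\<alpha>, b) \<mapsto> \<langle>\<alpha>, b\<rangle>\<close>, because \<open>\<langle>id, 1 \<otimes> 1\<rangle> = 1\<close>. Everything else is formal: whenever \<open>T\<close> and \<open>Y\<close>
  are linked by maps \<open>A \<times> T \<rightarrow> Y\<close> and \<open>B \<times> Y \<rightarrow> T\<close> compatible with the two pairings, the expansion of
  \<open>1 \<in> C\<close> identifies \<open>T\<close> with \<open>B \<otimes>\<^sub>R Y\<close> and with the left \<open>R\<close>-linear maps \<open>A \<rightarrow> Y\<close>. Taking \<open>(T, Y)\<close> to be
  \<open>(C, A)\<close>, \<open>(B, R)\<close>, \<open>(M \<otimes>\<^sub>N M, M)\<close> or \<open>(X, A \<otimes>\<^sub>C X)\<close> gives the isomorphisms and the equivalence.
\<close>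

section \<open>Additive maps\<close>

text \<open>The context lives in the category of N-M-bimodules. An N-M-map out of \<open>M\<close>
  is determined by its value at 1, and one out of \<open>T\<close>, which stands for the tensor
  square of \<open>M\<close> over \<open>N\<close>, by its values at the tensors of m with 1. This
  identifies \<open>R\<close> with End(M), \<open>B\<close> with Hom(M, T) and \<open>A\<close> with
  Hom(T, M), while \<open>C\<close> is End(T); both pairings and the actions of \<open>C\<close> and
  \<open>R\<close> become compositions. Depth two makes \<open>T\<close> a summand of a power of
  \<open>M\<close>, and multiplication, split by tensoring with 1 on the left, makes
  \<open>M\<close> a summand of \<open>T\<close>. That is why both units are hit.

  Two obstacles shape the rest. \<open>tensor_lift\<close> evaluates at a chosen representative, so
  its additivity has to be proved before anything else; afterwards an identity between additive maps
  need only be checked on pure tensors. And the two pairings play symmetric roles, so the context is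
  kept as two balanced functions of two variables that can be exchanged; tensor products come in
  only where an isomorphism or a functor needs them.\<close>

definition additive :: "('b, 'm) ring_scheme \<Rightarrow> ('c, 'n) ring_scheme \<Rightarrow> ('b \<Rightarrow> 'c) \<Rightarrow> bool" where
  "additive X Y f \<longleftrightarrow> f \<in> carrier X \<rightarrow> carrier Y \<and>
     (\<forall>x\<in>carrier X. \<forall>y\<in>carrier X. f (x \<oplus>\<^bsub>X\<^esub> y) = f x \<oplus>\<^bsub>Y\<^esub> f y)"

lemma additiveI:
  assumes "\<And>x. x \<in> carrier X \<Longrightarrow> f x \<in> carrier Y"
    and "\<And>x y. x \<in> carrier X \<Longrightarrow> y \<in> carrier X \<Longrightarrow> f (x \<oplus>\<^bsub>X\<^esub> y) = f x \<oplus>\<^bsub>Y\<^esub> f y"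
  shows "additive X Y f"
  using assms by (auto simp: additive_def)

lemma additive_closed: "additive X Y f \<Longrightarrow> x \<in> carrier X \<Longrightarrow> f x \<in> carrier Y"
  by (auto simp: additive_def)

lemma additive_add:
  "additive X Y f \<Longrightarrow> x \<in> carrier X \<Longrightarrow> y \<in> carrier X \<Longrightarrow> f (x \<oplus>\<^bsub>X\<^esub> y) = f x \<oplus>\<^bsub>Y\<^esub> f y"
  by (auto simp: additive_def)

text \<open>Bridge to the extensional Hom-sets of the statement. \<open>additive\<close> ignores
  values off the carrier, so composites and lifts can be treated as plain functions, and
  \<open>restrict\<close> is applied at the end.\<close>

lemma add_hom_iff: "f \<in> add_hom X Y \<longleftrightarrow> f \<in> extensional (carrier X) \<and> additive X Y f"
  by (auto simp: add_hom_def additive_def hom_def)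

lemma additive_restrict_iff:
  assumes "abelian_group X"
  shows "additive X Y (restrict f (carrier X)) \<longleftrightarrow> additive X Y f"
proof -
  interpret abelian_group X by fact
  show ?thesis by (auto simp: additive_def Pi_iff)
qed

lemma additive_zero:
  assumes "abelian_group X" "abelian_group Y" "additive X Y f"
  shows "f \<zero>\<^bsub>X\<^esub> = \<zero>\<^bsub>Y\<^esub>"
proof -
  interpret X: abelian_group X by fact
  interpret Y: abelian_group Y by fact
  have "f \<zero>\<^bsub>X\<^esub> = f \<zero>\<^bsub>X\<^esub> \<oplus>\<^bsub>Y\<^esub> f \<zero>\<^bsub>X\<^esub>"
    using additive_add[OF assms(3), of "\<zero>\<^bsub>X\<^esub>" "\<zero>\<^bsub>X\<^esub>"] by simp
  then show ?thesis using additive_closed[OF assms(3), of "\<zero>\<^bsub>X\<^esub>"]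
    by (metis X.zero_closed Y.add.r_cancel_one)
qed

lemma additive_finsum:
  assumes "abelian_group X" "abelian_group Y" "additive X Y f" "finite I" "x \<in> I \<rightarrow> carrier X"
  shows "f (\<Oplus>\<^bsub>X\<^esub>i\<in>I. x i) = (\<Oplus>\<^bsub>Y\<^esub>i\<in>I. f (x i))"
proof -
  interpret X: abelian_group X by fact
  interpret Y: abelian_group Y by fact
  from assms(4,5) show ?thesis
  proof (induction I rule: finite_induct)
    case empty
    show ?case using additive_zero[OF assms(1-3)] by simp
  next
    case (insert i I)
    have "(\<lambda>i. f (x i)) \<in> I \<rightarrow> carrier Y" "f (x i) \<in> carrier Y"
      using insert.prems additive_closed[OF assms(3)] by auto
    then show ?case using insert additive_add[OF assms(3)] by (simp add: Pi_def)
  qed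
qed

lemma additive_comp: "additive X Y f \<Longrightarrow> additive Y Z g \<Longrightarrow> additive X Z (\<lambda>x. g (f x))"
  by (auto simp: additive_def Pi_def)

lemma abelian_group_cong:
  assumes "abelian_group X" "carrier Y = carrier X" "add Y = add X" "\<zero>\<^bsub>Y\<^esub> = \<zero>\<^bsub>X\<^esub>"
  shows "abelian_group Y"
  using abelian_groupE[OF assms(1)] by (intro abelian_groupI) (simp_all add: assms(2-4))

lemma left_module_abelian: "left_module R X \<Longrightarrow> abelian_group X"
  by (simp add: left_module_def)

lemma right_module_abelian: "right_module X S \<Longrightarrow> abelian_group X"
  by (simp add: right_module_def)

section \<open>Tensor products\<close>

text \<open>Phrased through \<open>additive\<close>, closure included, so that each partial map can
  be fed directly into the lemmas on composites and finite sums.\<close>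

definition balanced ::
    "('a, 'x, 's) bimodule \<Rightarrow> ('s, 'k) ring_scheme \<Rightarrow> ('s, 'y, 'c) bimodule \<Rightarrow> ('z, 'm) ring_scheme
      \<Rightarrow> ('x \<Rightarrow> 'y \<Rightarrow> 'z) \<Rightarrow> bool" where
  "balanced X S Y Z f \<longleftrightarrow>
     (\<forall>y\<in>carrier Y. additive X Z (\<lambda>x. f x y)) \<and>
     (\<forall>x\<in>carrier X. additive Y Z (f x)) \<and>
     (\<forall>x\<in>carrier X. \<forall>s\<in>carrier S. \<forall>y\<in>carrier Y. f (x \<bullet>\<^bsub>X\<^esub> s) y = f x (s \<odot>\<^bsub>Y\<^esub> y))"

lemma balancedI:
  assumes "\<And>x y. x \<in> carrier X \<Longrightarrow> y \<in> carrier Y \<Longrightarrow> f x y \<in> carrier Z"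
    and "\<And>x x' y. x \<in> carrier X \<Longrightarrow> x' \<in> carrier X \<Longrightarrow> y \<in> carrier Y \<Longrightarrow>
       f (x \<oplus>\<^bsub>X\<^esub> x') y = f x y \<oplus>\<^bsub>Z\<^esub> f x' y"
    and "\<And>x y y'. x \<in> carrier X \<Longrightarrow> y \<in> carrier Y \<Longrightarrow> y' \<in> carrier Y \<Longrightarrow>
       f x (y \<oplus>\<^bsub>Y\<^esub> y') = f x y \<oplus>\<^bsub>Z\<^esub> f x y'"
    and "\<And>x s y. x \<in> carrier X \<Longrightarrow> s \<in> carrier S \<Longrightarrow> y \<in> carrier Y \<Longrightarrow>
       f (x \<bullet>\<^bsub>X\<^esub> s) y = f x (s \<odot>\<^bsub>Y\<^esub> y)"
  shows "balanced X S Y Z f"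
  using assms by (auto simp: balanced_def additive_def)

lemma balancedD:
  assumes "balanced X S Y Z f"
  shows "x \<in> carrier X \<Longrightarrow> y \<in> carrier Y \<Longrightarrow> f x y \<in> carrier Z"
    and "x \<in> carrier X \<Longrightarrow> x' \<in> carrier X \<Longrightarrow> y \<in> carrier Y \<Longrightarrow>
       f (x \<oplus>\<^bsub>X\<^esub> x') y = f x y \<oplus>\<^bsub>Z\<^esub> f x' y"
    and "x \<in> carrier X \<Longrightarrow> y \<in> carrier Y \<Longrightarrow> y' \<in> carrier Y \<Longrightarrow>
       f x (y \<oplus>\<^bsub>Y\<^esub> y') = f x y \<oplus>\<^bsub>Z\<^esub> f x y'"
    and "x \<in> carrier X \<Longrightarrow> s \<in> carrier S \<Longrightarrow> y \<in> carrier Y \<Longrightarrow>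
       f (x \<bullet>\<^bsub>X\<^esub> s) y = f x (s \<odot>\<^bsub>Y\<^esub> y)"
    and "y \<in> carrier Y \<Longrightarrow> additive X Z (\<lambda>x. f x y)"
    and "x \<in> carrier X \<Longrightarrow> additive Y Z (f x)"
  using assms by (auto simp: balanced_def additive_def)

locale tensor_product = X: right_module X S + Y: left_module S Y
  for X :: "('a, 'x, 's) bimodule" and S :: "('s, 'k) ring_scheme" and Y :: "('s, 'y, 'c) bimodule"
begin

lemmas abelian_groups = right_module_abelian[OF X.right_module_axioms] left_module_abelian[OF Y.left_module_axioms]

abbreviation "F \<equiv> free_Abelian_group (carrier X \<times> carrier Y)"
abbreviation "K \<equiv> tensor_null X S Y"
abbreviation "T \<equiv> tensor X S Y"
abbreviation "pt \<equiv> pure_tensor X S Y"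

lemma relations_subset: "tensor_relations X S Y \<subseteq> carrier F"
proof -
  have diff: "a - b \<in> carrier F" if "a \<in> carrier F" "b \<in> carrier F" for a b
    using that keys_diff[of a b] by auto
  have "frag_of p \<in> carrier F" if "p \<in> carrier X \<times> carrier Y" for p
    using that by simp
  then show ?thesis
    by (auto simp: tensor_relations_def X.rsmult_closed Y.lsmult_closed
        simp del: carrier_free_Abelian_group_iff intro!: diff)
qed

lemma null_subgroup: "subgroup K F"
  unfolding tensor_null_def by (rule group.generate_is_subgroup) (use relations_subset in auto)

sublocale F: comm_group F by (rule abelian_free_Abelian_group)

sublocale K: normal K F
  by (rule F.normal_iff_subgroup[THEN iffD2]) (rule null_subgroup)

lemma tensor_simps:
  "carrier T = carrier (F Mod K)" "\<zero>\<^bsub>T\<^esub> = \<one>\<^bsub>F Mod K\<^esub>" "add T = mult (F Mod K)"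
  by (simp_all add: tensor_def tensor_group_def Let_def)

text \<open>The two actions on \<open>tensor X S Y\<close> are defined by lifts into
  \<open>tensor_group X S Y\<close>, a different record with the same additive structure; facts have
  to be carried across.\<close>

lemma tensor_group_simps:
  "carrier (tensor_group X S Y) = carrier T" "\<zero>\<^bsub>tensor_group X S Y\<^esub> = \<zero>\<^bsub>T\<^esub>"
  "add (tensor_group X S Y) = add T"
  by (simp_all add: tensor_def tensor_group_def Let_def)

lemma abelian_group_tensor: "abelian_group T"
proof -
  interpret Q: comm_group "F Mod K" by (rule F.abelian_FactGroup[OF null_subgroup])
  show ?thesis
    by (rule abelian_groupI; unfold tensor_simps)
      ((rule Q.m_closed Q.one_closed Q.m_assoc Q.m_comm Q.l_one Q.l_inv_ex; assumption)+)
qed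

lemma abelian_group_tensor_group: "abelian_group (tensor_group X S Y)"
  by (rule abelian_group_cong[OF abelian_group_tensor]) (simp_all add: tensor_group_simps)

lemma class_add:
  assumes "a \<in> carrier F" "b \<in> carrier F"
  shows "K #>\<^bsub>F\<^esub> (a + b) = (K #>\<^bsub>F\<^esub> a) \<oplus>\<^bsub>T\<^esub> (K #>\<^bsub>F\<^esub> b)"
  using K.rcos_sum[OF assms] by (simp add: tensor_simps)

lemma class_in: "a \<in> carrier F \<Longrightarrow> K #>\<^bsub>F\<^esub> a \<in> carrier T"
  by (simp add: tensor_simps carrier_FactGroup)

lemma class_null: "a \<in> K \<Longrightarrow> K #>\<^bsub>F\<^esub> a = \<zero>\<^bsub>T\<^esub>"
  using F.coset_join2[OF _ null_subgroup] K.subset by (auto simp: tensor_simps)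

lemma class_eq:
  assumes "a \<in> carrier F" "b \<in> carrier F" "a - b \<in> tensor_relations X S Y"
  shows "K #>\<^bsub>F\<^esub> a = K #>\<^bsub>F\<^esub> b"
proof -
  interpret T: abelian_group T by (rule abelian_group_tensor)
  have k: "a - b \<in> K" using assms(3) by (simp add: tensor_null_def generate.incl)
  then have "a - b \<in> carrier F" using K.subset by blast
  then have "K #>\<^bsub>F\<^esub> (a - b + b) = \<zero>\<^bsub>T\<^esub> \<oplus>\<^bsub>T\<^esub> (K #>\<^bsub>F\<^esub> b)"
    using class_add[of "a - b" b] class_null[OF k] assms by metis
  then show ?thesis using class_in[OF assms(2)] by simp
qed

lemma frag_in: "x \<in> carrier X \<Longrightarrow> y \<in> carrier Y \<Longrightarrow> frag_of (x, y) \<in> carrier F"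
  by simp

lemma pure_closed: "x \<in> carrier X \<Longrightarrow> y \<in> carrier Y \<Longrightarrow> pt x y \<in> carrier T"
  unfolding pure_tensor_def by (intro class_in frag_in)

lemma F_add: "a \<in> carrier F \<Longrightarrow> b \<in> carrier F \<Longrightarrow> a + b \<in> carrier F"
  using F.m_closed by simp

lemma pure_add_left:
  assumes "x \<in> carrier X" "x' \<in> carrier X" "y \<in> carrier Y"
  shows "pt (x \<oplus>\<^bsub>X\<^esub> x') y = pt x y \<oplus>\<^bsub>T\<^esub> pt x' y"
  unfolding pure_tensor_def using assms
  by (subst class_add[symmetric]; (intro frag_in class_eq F_add)?)
    (auto simp: tensor_relations_def simp del: carrier_free_Abelian_group_iff simp: diff_diff_add[symmetric])

lemma pure_add_right:
  assumes "x \<in> carrier X" "y \<in> carrier Y" "y' \<in> carrier Y"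
  shows "pt x (y \<oplus>\<^bsub>Y\<^esub> y') = pt x y \<oplus>\<^bsub>T\<^esub> pt x y'"
  unfolding pure_tensor_def using assms
  by (subst class_add[symmetric]; (intro frag_in class_eq F_add)?)
    (auto simp: tensor_relations_def simp del: carrier_free_Abelian_group_iff simp: diff_diff_add[symmetric])

lemma pure_balanced:
  assumes "x \<in> carrier X" "s \<in> carrier S" "y \<in> carrier Y"
  shows "pt (x \<bullet>\<^bsub>X\<^esub> s) y = pt x (s \<odot>\<^bsub>Y\<^esub> y)"
  unfolding pure_tensor_def using assms
  by (intro class_eq frag_in) (auto simp: tensor_relations_def X.rsmult_closed Y.lsmult_closed)

lemma balanced_pure: "balanced X S Y T pt"
  by (intro balancedI pure_closed pure_add_left pure_add_right pure_balanced)

text \<open>Both sides are inverse to the pure tensor of x and y. Hence negatives of generators are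
  again pure tensors, which spares \<open>tensor_induct\<close> a case for negation.\<close>

lemma pure_minus:
  assumes "x \<in> carrier X" "y \<in> carrier Y"
  shows "pt (\<ominus>\<^bsub>X\<^esub> x) y = K #>\<^bsub>F\<^esub> (- frag_of (x, y))"
proof -
  interpret T: abelian_group T by (rule abelian_group_tensor)
  have m: "- frag_of (x, y) \<in> carrier F" using assms by simp
  have "pt (\<ominus>\<^bsub>X\<^esub> x) y \<oplus>\<^bsub>T\<^esub> pt x y = pt \<zero>\<^bsub>X\<^esub> y"
    using pure_add_left[of "\<ominus>\<^bsub>X\<^esub> x" x y] assms by (simp add: X.X.l_neg)
  also have "\<dots> = \<zero>\<^bsub>T\<^esub>"
    by (rule additive_zero[OF _ _ balancedD(5)[OF balanced_pure]])
      (use assms in \<open>auto simp: abelian_group_tensor abelian_groups\<close>)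
  also have "\<dots> = K #>\<^bsub>F\<^esub> (- frag_of (x, y) + frag_of (x, y))"
    using class_null[of 0] K.one_closed by simp
  also have "\<dots> = (K #>\<^bsub>F\<^esub> (- frag_of (x, y))) \<oplus>\<^bsub>T\<^esub> pt x y"
    unfolding pure_tensor_def by (rule class_add[OF m]) (use assms in simp)
  finally show ?thesis
    using class_in[OF m] assms pure_closed T.add.right_cancel by (metis X.X.a_inv_closed)
qed

text \<open>Zero and the negatives of pure tensors are themselves pure, so sums of pure tensors
  exhaust the quotient.\<close>

lemma tensor_induct [consumes 1, case_names pure add]:
  assumes t: "t \<in> carrier T"
    and pure: "\<And>x y. x \<in> carrier X \<Longrightarrow> y \<in> carrier Y \<Longrightarrow> P (pt x y)"
    and add: "\<And>u v. u \<in> carrier T \<Longrightarrow> v \<in> carrier T \<Longrightarrow> P u \<Longrightarrow> P v \<Longrightarrow> P (u \<oplus>\<^bsub>T\<^esub> v)"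
  shows "P t"
proof -
  interpret T: abelian_group T by (rule abelian_group_tensor)
  have "pt \<zero>\<^bsub>X\<^esub> \<zero>\<^bsub>Y\<^esub> = \<zero>\<^bsub>T\<^esub>"
    by (rule additive_zero[OF _ _ balancedD(5)[OF balanced_pure]])
      (auto simp: abelian_group_tensor abelian_groups)
  then have zero: "P \<zero>\<^bsub>T\<^esub>" using pure[of "\<zero>\<^bsub>X\<^esub>" "\<zero>\<^bsub>Y\<^esub>"] by simp
  \<comment> \<open>\<open>frag_induction\<close> proceeds through differences, whereas
    \<open>add\<close> only treats sums; carrying the coset of \<open>- c\<close> along turns a - b
    into a + (- b).\<close>
  define Q where "Q c \<longleftrightarrow> c \<in> carrier F \<and> - c \<in> carrier F \<and>
    P (K #>\<^bsub>F\<^esub> c) \<and> P (K #>\<^bsub>F\<^esub> (- c))" for c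
  have "Q c" if "Poly_Mapping.keys c \<subseteq> carrier X \<times> carrier Y" for c
    using that
  proof (induction c rule: frag_induction)
    case zero
    then show ?case using \<open>P \<zero>\<^bsub>T\<^esub>\<close> class_null[of 0] K.one_closed by (simp add: Q_def)
  next
    case (one p)
    then obtain x y where p: "p = (x, y)" "x \<in> carrier X" "y \<in> carrier Y" by auto
    then show ?case using pure[of x y] pure[of "\<ominus>\<^bsub>X\<^esub> x" y] X.X.a_inv_closed pure_minus[of x y]
      by (simp add: Q_def) (simp add: pure_tensor_def)
  next
    case (diff a b)
    have "a - b \<in> carrier F" "- (a - b) \<in> carrier F"
      using diff F_add[of a "- b"] F_add[of b "- a"] by (auto simp: Q_def simp del: carrier_free_Abelian_group_iff)
    moreover have "P (K #>\<^bsub>F\<^esub> (a + - b))" "P (K #>\<^bsub>F\<^esub> (b + - a))"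
      using diff by (simp_all only: Q_def class_add class_in add)
    ultimately show ?case by (simp add: Q_def)
  qed
  moreover obtain c where "c \<in> carrier F" "t = K #>\<^bsub>F\<^esub> c"
    using t by (auto simp: tensor_simps carrier_FactGroup)
  ultimately show ?thesis by (auto simp: Q_def)
qed

text \<open>The workhorse for all later identities: module laws, linearity and naturality on tensor
  products are each written as an equation of two additive maps and reduced to pure tensors.\<close>

lemma additive_eqI:
  assumes "additive T Z f" "additive T Z g"
    and "\<And>x y. x \<in> carrier X \<Longrightarrow> y \<in> carrier Y \<Longrightarrow> f (pt x y) = g (pt x y)"
    and "t \<in> carrier T"
  shows "f t = g t"
  using assms(4) by (induction rule: tensor_induct) (simp_all add: assms(3) additive_add[OF assms(1)] additive_add[OF assms(2)])

lemma lift_pure: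
  assumes "abelian_group Z" "balanced X S Y Z f" "x \<in> carrier X" "y \<in> carrier Y"
  shows "tensor_lift Z f (pt x y) = f x y"
  by (rule tensor_lift_pure_tensor)
    (use assms balancedD[OF assms(2)] in \<open>auto simp: X.rsmult_closed Y.lsmult_closed\<close>)

text \<open>The chosen representatives of t, u and t + u are unrelated, so additivity cannot be read
  off the definition. It comes from a homomorphism on the free group that vanishes on
  \<open>K\<close> and agrees with the lift on every coset.\<close>

lemma additive_lift:
  assumes Z: "abelian_group Z" and f: "balanced X S Y Z f"
  shows "additive T Z (tensor_lift Z f)"
proof -
  interpret Z: abelian_group Z by (rule Z)
  define E where "E = carrier X \<times> carrier Y"
  define f' where "f' p = f (fst p) (snd p)" for p
  have f'_closed: "f' ` E \<subseteq> carrier (add_monoid Z)"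
    using balancedD(1)[OF f] by (auto simp: f'_def E_def)
  \<comment> \<open>Universal property of the free abelian group; \<open>h_formula\<close> below
    shows that \<open>h\<close> is given by the same sum as in the definition of
    \<open>tensor_lift\<close>.\<close>
  obtain h where h: "h \<in> hom F (add_monoid Z)" "\<And>p. p \<in> E \<Longrightarrow> h (frag_of p) = f' p"
    using comm_group.free_Abelian_group_universal[OF Z.a_comm_group f'_closed] unfolding E_def by blast
  interpret H: group_hom F "add_monoid Z" h
    using h(1) by (simp add: group_hom_def group_hom_axioms_def Z.a_group F.is_group)
  have frag_in': "frag_of p \<in> carrier F" if "p \<in> E" for p
    using that by (simp add: E_def)
  have sum_eq: "h (\<Sum>i\<in>I. frag_cmul (k i) (frag_of i)) = (\<Oplus>\<^bsub>Z\<^esub>i\<in>I. [k i] \<cdot>\<^bsub>Z\<^esub> f' i)"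
    if "finite I" "I \<subseteq> E" for I and k :: "_ \<Rightarrow> int"
    using that
  proof (induction I rule: finite_induct)
    case empty
    show ?case using H.hom_one by simp
  next
    case (insert i I)
    have e: "frag_cmul (k i) (frag_of i) = frag_of i [^]\<^bsub>F\<^esub> k i" if "i \<in> E" for i
      using that by (simp add: E_def)
    have c: "frag_cmul (k i) (frag_of i) \<in> carrier F" if "i \<in> E" for i
      unfolding e[OF that] by (rule F.int_pow_closed) (rule frag_in'[OF that])
    have s: "(\<Sum>i\<in>I. frag_cmul (k i) (frag_of i)) \<in> carrier F"
      by (rule sum_closed_free_Abelian_group) (use insert.prems c in blast)
    have "h (frag_cmul (k i) (frag_of i)) = [k i] \<cdot>\<^bsub>Z\<^esub> f' i"
      using insert.prems H.hom_int_pow[OF frag_in'[of i], of "k i"] e[of i] h(2)[of i]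
      by (simp add: add_pow_def)
    moreover have "(\<lambda>i. [k i] \<cdot>\<^bsub>Z\<^esub> f' i) \<in> I \<rightarrow> carrier Z" "[k i] \<cdot>\<^bsub>Z\<^esub> f' i \<in> carrier Z"
      using insert.prems f'_closed by (auto intro!: Z.add.int_pow_closed)
    ultimately show ?case
      using insert H.hom_mult[OF c[of i] s] by simp
  qed
  have h_formula: "h c = (\<Oplus>\<^bsub>Z\<^esub>p\<in>Poly_Mapping.keys c. [Poly_Mapping.lookup c p] \<cdot>\<^bsub>Z\<^esub> f' p)"
    if "c \<in> carrier F" for c
    using sum_eq[of "Poly_Mapping.keys c" "Poly_Mapping.lookup c"] that frag_expansion[of c]
    by (simp add: E_def frag_extend_def)
  have diff0: "h (a - b) = \<zero>\<^bsub>Z\<^esub>" if "a \<in> carrier F" "b \<in> carrier F" "h a = h b" for a b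
  proof -
    have "a - b \<in> carrier F" using that keys_diff[of a b] by auto
    then have "h a = h (a - b) \<oplus>\<^bsub>Z\<^esub> h b"
      using H.hom_mult[of "a - b" b] that by simp
    then show ?thesis using that H.hom_closed[OF \<open>a - b \<in> carrier F\<close>] H.hom_closed[OF that(1)]
      by (metis Z.add.r_cancel_one monoid_record_simps(1))
  qed
  have "h r = \<zero>\<^bsub>Z\<^esub>" if "r \<in> tensor_relations X S Y" for r
  proof -
    have add: "h (a + b) = h a \<oplus>\<^bsub>Z\<^esub> h b" if "a \<in> carrier F" "b \<in> carrier F" for a b
      using H.hom_mult[OF that] by simp
    have hf: "h (frag_of (x, y)) = f x y" if "x \<in> carrier X" "y \<in> carrier Y" for x y
      using h(2)[of "(x, y)"] that by (simp add: E_def f'_def)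
    \<comment> \<open>Regrouping x - y - z as x - (y + z) lets all three families of relations be
      handled by \<open>diff0\<close>.\<close>
    have "\<exists>a\<in>carrier F. \<exists>b\<in>carrier F. r = a - b \<and> h a = h b"
      using that unfolding tensor_relations_def
    proof (elim UnE CollectE exE conjE)
      fix x x' y assume *: "x \<in> carrier X" "x' \<in> carrier X" "y \<in> carrier Y"
        and r: "r = frag_of (x \<oplus>\<^bsub>X\<^esub> x', y) - frag_of (x, y) - frag_of (x', y)"
      show ?thesis
        by (rule bexI[where x = "frag_of (x \<oplus>\<^bsub>X\<^esub> x', y)"], rule bexI[where x = "frag_of (x, y) + frag_of (x', y)"])
          (use * in \<open>simp_all only: r F_add frag_in X.X.a_closed add hf balancedD(2)[OF f] diff_diff_add simp_thms\<close>)
    next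
      fix x y y' assume *: "x \<in> carrier X" "y \<in> carrier Y" "y' \<in> carrier Y"
        and r: "r = frag_of (x, y \<oplus>\<^bsub>Y\<^esub> y') - frag_of (x, y) - frag_of (x, y')"
      show ?thesis
        by (rule bexI[where x = "frag_of (x, y \<oplus>\<^bsub>Y\<^esub> y')"], rule bexI[where x = "frag_of (x, y) + frag_of (x, y')"])
          (use * in \<open>simp_all only: r F_add frag_in Y.X.a_closed add hf balancedD(3)[OF f] diff_diff_add simp_thms\<close>)
    next
      fix x s y assume *: "x \<in> carrier X" "s \<in> carrier S" "y \<in> carrier Y"
        and r: "r = frag_of (x \<bullet>\<^bsub>X\<^esub> s, y) - frag_of (x, s \<odot>\<^bsub>Y\<^esub> y)"
      show ?thesis
        by (rule bexI[where x = "frag_of (x \<bullet>\<^bsub>X\<^esub> s, y)"], rule bexI[where x = "frag_of (x, s \<odot>\<^bsub>Y\<^esub> y)"])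
          (use * in \<open>simp_all only: r frag_in X.rsmult_closed Y.lsmult_closed hf balancedD(4)[OF f] simp_thms\<close>)
    qed
    then show ?thesis using diff0 by blast
  qed
  then have "tensor_relations X S Y \<subseteq> kernel F (add_monoid Z) h"
    using relations_subset by (auto simp: kernel_def simp del: carrier_free_Abelian_group_iff)
  then have null: "K \<subseteq> kernel F (add_monoid Z) h"
    unfolding tensor_null_def by (rule F.generate_subgroup_incl[OF _ H.subgroup_kernel])
  \<comment> \<open>The representative picked by the lift is \<open>c\<close> up to an element of
    \<open>K\<close>, where \<open>h\<close> vanishes, so the choice does not matter.\<close>
  have lift: "tensor_lift Z f (K #>\<^bsub>F\<^esub> c) = h c" if c: "c \<in> carrier F" for c
  proof -
    have "c \<in> K #>\<^bsub>F\<^esub> c" by (rule F.rcos_self[OF c null_subgroup])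
    then have "(SOME d. d \<in> K #>\<^bsub>F\<^esub> c) \<in> K #>\<^bsub>F\<^esub> c" by (rule someI)
    then obtain k where k: "k \<in> K" "(SOME d. d \<in> K #>\<^bsub>F\<^esub> c) = k \<otimes>\<^bsub>F\<^esub> c"
      by (auto simp: r_coset_def)
    have kF: "k \<in> carrier F" "h k = \<zero>\<^bsub>Z\<^esub>" using null k by (auto simp: kernel_def)
    have "k \<otimes>\<^bsub>F\<^esub> c \<in> carrier F" "h (k \<otimes>\<^bsub>F\<^esub> c) = h c"
      using F.m_closed[OF kF(1) c] H.hom_mult[OF kF(1) c] H.hom_closed[OF c] kF(2) by auto
    then show ?thesis
      unfolding tensor_lift_def Let_def k(2) using h_formula by (simp add: f'_def)
  qed
  have T_E: "\<exists>c\<in>carrier F. t = K #>\<^bsub>F\<^esub> c" if "t \<in> carrier T" for t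
    using that by (auto simp: tensor_simps carrier_FactGroup)
  show ?thesis
  proof (rule additiveI)
    fix t assume "t \<in> carrier T"
    then show "tensor_lift Z f t \<in> carrier Z" using T_E[of t] lift H.hom_closed by fastforce
  next
    fix t u assume "t \<in> carrier T" "u \<in> carrier T"
    then obtain c d where "c \<in> carrier F" "t = K #>\<^bsub>F\<^esub> c" "d \<in> carrier F" "u = K #>\<^bsub>F\<^esub> d"
      using T_E by metis
    then show "tensor_lift Z f (t \<oplus>\<^bsub>T\<^esub> u) = tensor_lift Z f t \<oplus>\<^bsub>Z\<^esub> tensor_lift Z f u"
      using H.hom_mult[of c d] F_add[of c d] by (simp only: class_add[symmetric] lift) simp
  qed
qed

end

lemma tensor_product_iff: "tensor_product X S Y \<longleftrightarrow> right_module X S \<and> left_module S Y"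
  by (simp add: tensor_product_def)

section \<open>Module laws as additivity in each argument, and module structures on tensor
  products\<close>

lemma left_module_simps:
  assumes "left_module R X"
  shows "ring R" "abelian_group X"
    and "\<And>r x. r \<in> carrier R \<Longrightarrow> x \<in> carrier X \<Longrightarrow> r \<odot>\<^bsub>X\<^esub> x \<in> carrier X"
    and "\<And>r x. r \<in> carrier R \<Longrightarrow> additive X X (smult X r)"
    and "\<And>r x. x \<in> carrier X \<Longrightarrow> additive R X (\<lambda>r. r \<odot>\<^bsub>X\<^esub> x)"
  using left_module.lsmult_closed[OF assms] left_module.lsmult_l_distr[OF assms]
    left_module.lsmult_r_distr[OF assms] assms
  by (auto simp: left_module_def additive_def)

lemma right_module_simps:
  assumes "right_module X S"
  shows "ring S" "abelian_group X"
    and "\<And>s x. s \<in> carrier S \<Longrightarrow> x \<in> carrier X \<Longrightarrow> x \<bullet>\<^bsub>X\<^esub> s \<in> carrier X"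
    and "\<And>s. s \<in> carrier S \<Longrightarrow> additive X X (\<lambda>x. x \<bullet>\<^bsub>X\<^esub> s)"
    and "\<And>x. x \<in> carrier X \<Longrightarrow> additive S X (rsmult X x)"
  using right_module.rsmult_closed[OF assms] right_module.rsmult_l_distr[OF assms]
    right_module.rsmult_r_distr[OF assms] assms
  by (auto simp: right_module_def additive_def)

lemma bimodule_iff:
  "bimodule R X S \<longleftrightarrow> left_module R X \<and> right_module X S \<and>
    (\<forall>r\<in>carrier R. \<forall>x\<in>carrier X. \<forall>s\<in>carrier S. (r \<odot>\<^bsub>X\<^esub> x) \<bullet>\<^bsub>X\<^esub> s = r \<odot>\<^bsub>X\<^esub> (x \<bullet>\<^bsub>X\<^esub> s))"
  by (auto simp: bimodule_def bimodule_axioms_def)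

lemma bimodule_left: "bimodule R X S \<Longrightarrow> left_module R X"
  and bimodule_right: "bimodule R X S \<Longrightarrow> right_module X S"
  by (auto simp: bimodule_iff)

lemma left_moduleI:
  assumes "ring R" "abelian_group X"
    and "\<And>r. r \<in> carrier R \<Longrightarrow> additive X X (smult X r)"
    and "\<And>x. x \<in> carrier X \<Longrightarrow> additive R X (\<lambda>r. r \<odot>\<^bsub>X\<^esub> x)"
    and "\<And>r r' x. r \<in> carrier R \<Longrightarrow> r' \<in> carrier R \<Longrightarrow> x \<in> carrier X \<Longrightarrow>
      (r \<otimes>\<^bsub>R\<^esub> r') \<odot>\<^bsub>X\<^esub> x = r \<odot>\<^bsub>X\<^esub> (r' \<odot>\<^bsub>X\<^esub> x)"
    and "\<And>x. x \<in> carrier X \<Longrightarrow> \<one>\<^bsub>R\<^esub> \<odot>\<^bsub>X\<^esub> x = x"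
  shows "left_module R X"
  using assms by (auto simp: left_module_def left_module_axioms_def additive_def)

lemma right_moduleI:
  assumes "ring S" "abelian_group X"
    and "\<And>s. s \<in> carrier S \<Longrightarrow> additive X X (\<lambda>x. x \<bullet>\<^bsub>X\<^esub> s)"
    and "\<And>x. x \<in> carrier X \<Longrightarrow> additive S X (rsmult X x)"
    and "\<And>s s' x. s \<in> carrier S \<Longrightarrow> s' \<in> carrier S \<Longrightarrow> x \<in> carrier X \<Longrightarrow>
      x \<bullet>\<^bsub>X\<^esub> (s \<otimes>\<^bsub>S\<^esub> s') = (x \<bullet>\<^bsub>X\<^esub> s) \<bullet>\<^bsub>X\<^esub> s'"
    and "\<And>x. x \<in> carrier X \<Longrightarrow> x \<bullet>\<^bsub>X\<^esub> \<one>\<^bsub>S\<^esub> = x"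
  shows "right_module X S"
  using assms by (auto simp: right_module_def right_module_axioms_def additive_def)

lemma additive_plus:
  assumes "abelian_group Y" "additive X Y f" "additive X Y g"
  shows "additive X Y (\<lambda>x. f x \<oplus>\<^bsub>Y\<^esub> g x)"
proof -
  interpret abelian_group Y by fact
  show ?thesis
    using assms(2,3) by (intro additiveI) (simp_all add: additive_closed additive_add a_ac)
qed

lemma additive_id: "additive X X (\<lambda>x. x)"
  by (simp add: additive_def)

text \<open>The action is itself a lift, so it is controlled only once its defining map is balanced.
  This is where the compatibility of the left and right actions on \<open>X\<close> enters: r (x s)
  must equal (r x) s.\<close>

lemma tensor_smult_pure:
  assumes "bimodule R X S" "left_module S Y" "r \<in> carrier R"
  shows "additive (tensor X S Y) (tensor X S Y) (smult (tensor X S Y) r)"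
    and "x \<in> carrier X \<Longrightarrow> y \<in> carrier Y \<Longrightarrow>
      r \<odot>\<^bsub>tensor X S Y\<^esub> pure_tensor X S Y x y = pure_tensor X S Y (r \<odot>\<^bsub>X\<^esub> x) y"
proof -
  interpret tensor_product X S Y using assms by (simp add: tensor_product_iff bimodule_right)
  have eq: "smult T r = tensor_lift (tensor_group X S Y) (\<lambda>x y. pt (r \<odot>\<^bsub>X\<^esub> x) y)"
    by (simp add: tensor_def Let_def)
  note L = left_module_simps[OF bimodule_left[OF assms(1)]]
  have bal: "balanced X S Y (tensor_group X S Y) (\<lambda>x y. pt (r \<odot>\<^bsub>X\<^esub> x) y)"
  proof (rule balancedI; (unfold tensor_group_simps)?)
    fix x s y assume "x \<in> carrier X" "s \<in> carrier S" "y \<in> carrier Y"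
    then show "pt (r \<odot>\<^bsub>X\<^esub> (x \<bullet>\<^bsub>X\<^esub> s)) y = pt (r \<odot>\<^bsub>X\<^esub> x) (s \<odot>\<^bsub>Y\<^esub> y)"
      using assms(1,3) L pure_balanced[of "r \<odot>\<^bsub>X\<^esub> x" s y] by (simp add: bimodule_iff)
  qed (use L assms in \<open>simp_all add: pure_closed pure_add_left pure_add_right additive_add[OF L(4)]\<close>)
  show "additive T T (smult T r)"
    using additive_lift[OF abelian_group_tensor_group bal]
    by (simp add: eq additive_def tensor_group_simps)
  show "r \<odot>\<^bsub>T\<^esub> pt x y = pt (r \<odot>\<^bsub>X\<^esub> x) y" if "x \<in> carrier X" "y \<in> carrier Y"
    using lift_pure[OF abelian_group_tensor_group bal that] by (simp add: eq)
qed

lemma tensor_rsmult_pure: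
  assumes "right_module X S" "bimodule S Y U" "u \<in> carrier U"
  shows "additive (tensor X S Y) (tensor X S Y) (\<lambda>t. t \<bullet>\<^bsub>tensor X S Y\<^esub> u)"
    and "x \<in> carrier X \<Longrightarrow> y \<in> carrier Y \<Longrightarrow>
      pure_tensor X S Y x y \<bullet>\<^bsub>tensor X S Y\<^esub> u = pure_tensor X S Y x (y \<bullet>\<^bsub>Y\<^esub> u)"
proof -
  interpret tensor_product X S Y using assms by (simp add: tensor_product_iff bimodule_left)
  have eq: "(\<lambda>t. t \<bullet>\<^bsub>T\<^esub> u) = tensor_lift (tensor_group X S Y) (\<lambda>x y. pt x (y \<bullet>\<^bsub>Y\<^esub> u))"
    by (simp add: tensor_def Let_def)
  note L = right_module_simps[OF bimodule_right[OF assms(2)]]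
  have bal: "balanced X S Y (tensor_group X S Y) (\<lambda>x y. pt x (y \<bullet>\<^bsub>Y\<^esub> u))"
  proof (rule balancedI; (unfold tensor_group_simps)?)
    fix x s y assume "x \<in> carrier X" "s \<in> carrier S" "y \<in> carrier Y"
    then show "pt (x \<bullet>\<^bsub>X\<^esub> s) (y \<bullet>\<^bsub>Y\<^esub> u) = pt x ((s \<odot>\<^bsub>Y\<^esub> y) \<bullet>\<^bsub>Y\<^esub> u)"
      using assms(2,3) L pure_balanced[of x s "y \<bullet>\<^bsub>Y\<^esub> u"] by (simp add: bimodule_iff)
  qed (use L assms in \<open>simp_all add: pure_closed pure_add_left pure_add_right additive_add[OF L(4)]\<close>)
  show "additive T T (\<lambda>t. t \<bullet>\<^bsub>T\<^esub> u)"
    using additive_lift[OF abelian_group_tensor_group bal]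
    by (simp add: eq additive_def tensor_group_simps)
  show "pt x y \<bullet>\<^bsub>T\<^esub> u = pt x (y \<bullet>\<^bsub>Y\<^esub> u)" if "x \<in> carrier X" "y \<in> carrier Y"
    using lift_pure[OF abelian_group_tensor_group bal that] fun_cong[OF eq] by simp
qed

lemma left_module_tensor:
  assumes "bimodule R X S" "left_module S Y"
  shows "left_module R (tensor X S Y)"
proof -
  interpret tensor_product X S Y using assms by (simp add: tensor_product_iff bimodule_right)
  note sm = tensor_smult_pure[OF assms]
  note L = left_module_simps[OF bimodule_left[OF assms(1)]]
  interpret R: ring R by (rule L(1))
  interpret X: left_module R X by (rule bimodule_left[OF assms(1)])
  show ?thesis
  proof (rule left_moduleI[OF L(1) abelian_group_tensor sm(1)])
    fix t assume t: "t \<in> carrier T"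
    show "additive R T (\<lambda>r. r \<odot>\<^bsub>T\<^esub> t)"
    proof (rule additiveI)
      fix r r' assume r: "r \<in> carrier R" "r' \<in> carrier R"
      show "(r \<oplus>\<^bsub>R\<^esub> r') \<odot>\<^bsub>T\<^esub> t = r \<odot>\<^bsub>T\<^esub> t \<oplus>\<^bsub>T\<^esub> r' \<odot>\<^bsub>T\<^esub> t"
        by (rule additive_eqI[OF sm(1) additive_plus[OF abelian_group_tensor sm(1) sm(1)] _ t])
          (use r in \<open>simp_all add: sm(2) X.lsmult_l_distr pure_add_left L(3)\<close>)
    qed (rule additive_closed[OF sm(1) t])
    show "\<one>\<^bsub>R\<^esub> \<odot>\<^bsub>T\<^esub> t = t"
      by (rule additive_eqI[OF sm(1) additive_id _ t]) (simp_all add: sm(2) X.lsmult_one)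
    fix r r' assume r: "r \<in> carrier R" "r' \<in> carrier R"
    show "(r \<otimes>\<^bsub>R\<^esub> r') \<odot>\<^bsub>T\<^esub> t = r \<odot>\<^bsub>T\<^esub> (r' \<odot>\<^bsub>T\<^esub> t)"
      by (rule additive_eqI[OF sm(1) additive_comp[OF sm(1) sm(1)] _ t])
        (use r in \<open>simp_all add: sm(2) X.lsmult_assoc L(3)\<close>)
  qed
qed

lemma right_module_tensor:
  assumes "right_module X S" "bimodule S Y U"
  shows "right_module (tensor X S Y) U"
proof -
  interpret tensor_product X S Y using assms by (simp add: tensor_product_iff bimodule_left)
  note sm = tensor_rsmult_pure[OF assms]
  note L = right_module_simps[OF bimodule_right[OF assms(2)]]
  interpret U: ring U by (rule L(1))
  interpret Y: right_module Y U by (rule bimodule_right[OF assms(2)])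
  show ?thesis
  proof (rule right_moduleI[OF L(1) abelian_group_tensor sm(1)])
    fix t assume t: "t \<in> carrier T"
    show "additive U T (rsmult T t)"
    proof (rule additiveI)
      fix r r' assume r: "r \<in> carrier U" "r' \<in> carrier U"
      show "t \<bullet>\<^bsub>T\<^esub> (r \<oplus>\<^bsub>U\<^esub> r') = t \<bullet>\<^bsub>T\<^esub> r \<oplus>\<^bsub>T\<^esub> t \<bullet>\<^bsub>T\<^esub> r'"
        by (rule additive_eqI[OF sm(1) additive_plus[OF abelian_group_tensor sm(1) sm(1)] _ t])
          (use r in \<open>simp_all add: sm(2) Y.rsmult_r_distr pure_add_right L(3)\<close>)
    qed (rule additive_closed[OF sm(1) t])
    show "t \<bullet>\<^bsub>T\<^esub> \<one>\<^bsub>U\<^esub> = t"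
      by (rule additive_eqI[OF sm(1) additive_id _ t]) (simp_all add: sm(2) Y.rsmult_one)
    fix r r' assume r: "r \<in> carrier U" "r' \<in> carrier U"
    show "t \<bullet>\<^bsub>T\<^esub> (r \<otimes>\<^bsub>U\<^esub> r') = (t \<bullet>\<^bsub>T\<^esub> r) \<bullet>\<^bsub>T\<^esub> r'"
      by (rule additive_eqI[OF sm(1) additive_comp[OF sm(1) sm(1)] _ t])
        (use r in \<open>simp_all add: sm(2) Y.rsmult_assoc L(3)\<close>)
  qed
qed

lemma bimodule_tensor:
  assumes "bimodule R X S" "bimodule S Y U"
  shows "bimodule R (tensor X S Y) U"
proof -
  interpret tensor_product X S Y using assms by (simp add: tensor_product_iff bimodule_left bimodule_right)
  note l = tensor_smult_pure[OF assms(1) bimodule_left[OF assms(2)]]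
  note r = tensor_rsmult_pure[OF bimodule_right[OF assms(1)] assms(2)]
  have "(a \<odot>\<^bsub>T\<^esub> t) \<bullet>\<^bsub>T\<^esub> u = a \<odot>\<^bsub>T\<^esub> (t \<bullet>\<^bsub>T\<^esub> u)"
    if "a \<in> carrier R" "t \<in> carrier T" "u \<in> carrier U" for a t u
    by (rule additive_eqI[OF additive_comp[OF l(1) r(1)] additive_comp[OF r(1) l(1)] _ that(2)])
      (use that assms in \<open>simp_all add: l(2) r(2) left_module_simps(3)[OF bimodule_left[OF assms(1)]]
        right_module_simps(3)[OF bimodule_right[OF assms(2)]]\<close>)
  then show ?thesis
    using left_module_tensor[OF assms(1) bimodule_left[OF assms(2)]]
      right_module_tensor[OF bimodule_right[OF assms(1)] assms(2)]
    by (simp add: bimodule_iff)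
qed

section \<open>Homomorphisms and regular bimodules\<close>

lemma additive_finsum_map:
  assumes "abelian_group X" "abelian_group Y" "finite I" "\<And>i. i \<in> I \<Longrightarrow> additive X Y (h i)"
  shows "additive X Y (\<lambda>x. \<Oplus>\<^bsub>Y\<^esub>i\<in>I. h i x)"
proof -
  interpret X: abelian_group X by fact
  interpret Y: abelian_group Y by fact
  have cl: "(\<lambda>i. h i x) \<in> I \<rightarrow> carrier Y" if "x \<in> carrier X" for x
    using additive_closed[OF assms(4)] that by auto
  show ?thesis
  proof (rule additiveI)
    fix x y assume xy: "x \<in> carrier X" "y \<in> carrier X"
    have "(\<Oplus>\<^bsub>Y\<^esub>i\<in>I. h i (x \<oplus>\<^bsub>X\<^esub> y)) = (\<Oplus>\<^bsub>Y\<^esub>i\<in>I. h i x \<oplus>\<^bsub>Y\<^esub> h i y)"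
      using additive_add[OF assms(4)] xy cl[of x] cl[of y] by (intro Y.finsum_cong') auto
    then show "(\<Oplus>\<^bsub>Y\<^esub>i\<in>I. h i (x \<oplus>\<^bsub>X\<^esub> y)) = (\<Oplus>\<^bsub>Y\<^esub>i\<in>I. h i x) \<oplus>\<^bsub>Y\<^esub> (\<Oplus>\<^bsub>Y\<^esub>i\<in>I. h i y)"
      using cl xy by (simp add: Y.finsum_addf)
  qed (use cl in simp)
qed

text \<open>\<open>left_fin_gen\<close> and \<open>right_fin_gen\<close> attach one coefficient to
  each element of a finite set, while dual bases are families that may repeat an element.
  Coefficients of equal elements have to be merged.\<close>

lemma finsum_collect:
  assumes "abelian_group S" "abelian_group X" "\<And>x. x \<in> carrier X \<Longrightarrow> additive S X (act x)"
    and "finite I" "e \<in> I \<rightarrow> carrier X" "c \<in> I \<rightarrow> carrier S"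
  shows "\<exists>a\<in>e ` I \<rightarrow> carrier S. (\<Oplus>\<^bsub>X\<^esub>i\<in>I. act (e i) (c i)) = (\<Oplus>\<^bsub>X\<^esub>x\<in>e ` I. act x (a x))"
proof -
  interpret S: abelian_group S by fact
  interpret X: abelian_group X by fact
  note act = additive_closed[OF assms(3)] additive_add[OF assms(3)]
  from assms(4-6) show ?thesis
  proof (induction I rule: finite_induct)
    case (insert i I)
    then obtain a where a: "a \<in> e ` I \<rightarrow> carrier S"
      "(\<Oplus>\<^bsub>X\<^esub>i\<in>I. act (e i) (c i)) = (\<Oplus>\<^bsub>X\<^esub>x\<in>e ` I. act x (a x))" by auto
    have cl: "(\<lambda>i. act (e i) (c i)) \<in> I \<rightarrow> carrier X" "act (e i) (c i) \<in> carrier X"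
      using insert.prems act by (auto simp: Pi_iff)
    have eI: "e ` I \<subseteq> carrier X" "e i \<in> carrier X" "c i \<in> carrier S" using insert.prems by auto
    show ?case
    proof (cases "e i \<in> e ` I")
      case False
      let ?a = "a(e i := c i)"
      have "(\<Oplus>\<^bsub>X\<^esub>x\<in>e ` I. act x (?a x)) = (\<Oplus>\<^bsub>X\<^esub>x\<in>e ` I. act x (a x))"
        using False a(1) eI act by (intro X.finsum_cong') (auto simp: Pi_iff image_iff)
      moreover have "(\<lambda>x. act x (?a x)) \<in> e ` I \<rightarrow> carrier X"
        using False a(1) eI act by (auto simp: Pi_iff)
      ultimately have "(\<Oplus>\<^bsub>X\<^esub>i\<in>insert i I. act (e i) (c i)) = (\<Oplus>\<^bsub>X\<^esub>x\<in>e ` insert i I. act x (?a x))"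
        using False insert.hyps cl a(2) by simp
      moreover have "?a \<in> e ` insert i I \<rightarrow> carrier S" using a(1) eI by auto
      ultimately show ?thesis by blast
    next
      case True
      define J where "J = e ` I - {e i}"
      have J: "e ` I = insert (e i) J" "e i \<notin> J" "finite J" using True insert.hyps by (auto simp: J_def)
      have aJ: "a \<in> J \<rightarrow> carrier S" "a (e i) \<in> carrier S" "J \<subseteq> carrier X"
        using a(1) eI J by auto
      \<comment> \<open>The element \<open>e i\<close> has already occurred, so its new coefficient
        is added to the old one.\<close>
      let ?a = "a(e i := c i \<oplus>\<^bsub>S\<^esub> a (e i))"
      have "(\<Oplus>\<^bsub>X\<^esub>x\<in>J. act x (?a x)) = (\<Oplus>\<^bsub>X\<^esub>x\<in>J. act x (a x))"
        using aJ J(2) act by (intro X.finsum_cong') (auto simp: Pi_iff)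
      moreover have "(\<lambda>x. act x (?a x)) \<in> J \<rightarrow> carrier X" "(\<lambda>x. act x (a x)) \<in> J \<rightarrow> carrier X"
        "act (e i) (a (e i)) \<in> carrier X"
        using aJ J(2) eI act by (auto simp: Pi_iff subset_iff)
      ultimately have "(\<Oplus>\<^bsub>X\<^esub>i\<in>insert i I. act (e i) (c i)) = (\<Oplus>\<^bsub>X\<^esub>x\<in>insert (e i) J. act x (?a x))"
        using insert.hyps cl a(2) J aJ eI act by (simp add: X.a_assoc)
      moreover have "?a \<in> e ` insert i I \<rightarrow> carrier S" "e ` insert i I = insert (e i) J"
        using a(1) eI J True aJ by (auto simp: Pi_iff)
      ultimately show ?thesis by metis
    qed
  qed simp
qed

lemma left_hom_iff:
  "h \<in> left_hom R X Y \<longleftrightarrow> h \<in> extensional (carrier X) \<and> additive X Y h \<and>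
    (\<forall>r\<in>carrier R. \<forall>x\<in>carrier X. h (r \<odot>\<^bsub>X\<^esub> x) = r \<odot>\<^bsub>Y\<^esub> h x)"
  by (auto simp: left_hom_def add_hom_iff)

lemma right_hom_iff:
  "h \<in> right_hom X Y S \<longleftrightarrow> h \<in> extensional (carrier X) \<and> additive X Y h \<and>
    (\<forall>x\<in>carrier X. \<forall>s\<in>carrier S. h (x \<bullet>\<^bsub>X\<^esub> s) = h x \<bullet>\<^bsub>Y\<^esub> s)"
  by (auto simp: right_hom_def add_hom_iff)

lemma bimodule_hom_iff:
  "h \<in> bimodule_hom R X Y S \<longleftrightarrow> h \<in> extensional (carrier X) \<and> additive X Y h \<and>
    (\<forall>r\<in>carrier R. \<forall>x\<in>carrier X. h (r \<odot>\<^bsub>X\<^esub> x) = r \<odot>\<^bsub>Y\<^esub> h x) \<and>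
    (\<forall>x\<in>carrier X. \<forall>s\<in>carrier S. h (x \<bullet>\<^bsub>X\<^esub> s) = h x \<bullet>\<^bsub>Y\<^esub> s)"
  by (auto simp: bimodule_hom_def left_hom_iff right_hom_iff)

lemma restrict_left_hom:
  assumes "left_module R X" "additive X Y h"
    and "\<And>r x. r \<in> carrier R \<Longrightarrow> x \<in> carrier X \<Longrightarrow> h (r \<odot>\<^bsub>X\<^esub> x) = r \<odot>\<^bsub>Y\<^esub> h x"
  shows "restrict h (carrier X) \<in> left_hom R X Y"
  using assms left_module_simps[OF assms(1)] by (simp add: left_hom_iff additive_restrict_iff)

lemma restrict_right_hom:
  assumes "right_module X S" "additive X Y h"
    and "\<And>s x. s \<in> carrier S \<Longrightarrow> x \<in> carrier X \<Longrightarrow> h (x \<bullet>\<^bsub>X\<^esub> s) = h x \<bullet>\<^bsub>Y\<^esub> s"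
  shows "restrict h (carrier X) \<in> right_hom X Y S"
  using assms right_module_simps[OF assms(1)] by (simp add: right_hom_iff additive_restrict_iff)

lemma ring_bimodule_simps:
  "carrier (ring_bimodule M f g) = carrier M" "add (ring_bimodule M f g) = add M"
  "\<zero>\<^bsub>ring_bimodule M f g\<^esub> = \<zero>\<^bsub>M\<^esub>"
  "a \<odot>\<^bsub>ring_bimodule M f g\<^esub> x = f a \<otimes>\<^bsub>M\<^esub> x" "x \<bullet>\<^bsub>ring_bimodule M f g\<^esub> c = x \<otimes>\<^bsub>M\<^esub> g c"
  by (simp_all add: ring_bimodule_def)

lemma additive_ring_bimodule:
  "additive (ring_bimodule M f g) Y h = additive M Y h"
  "additive X (ring_bimodule M f g) h' = additive X M h'"
  by (simp_all add: additive_def ring_bimodule_simps)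

lemma id_ring_hom: "id \<in> ring_hom M M"
  by (simp add: ring_hom_def)

lemma bimodule_ring_bimodule:
  assumes "ring M" "ring N" "ring L" "\<phi> \<in> ring_hom N M" "\<psi> \<in> ring_hom L M"
  shows "bimodule N (ring_bimodule M \<phi> \<psi>) L"
proof -
  interpret M: ring M by fact
  note [simp] = ring_hom_closed[OF assms(4)] ring_hom_closed[OF assms(5)]
    ring_hom_mult[OF assms(4)] ring_hom_mult[OF assms(5)] ring_hom_add[OF assms(4)]
    ring_hom_add[OF assms(5)] ring_hom_one[OF assms(4)] ring_hom_one[OF assms(5)]
  have ab: "abelian_group (ring_bimodule M \<phi> \<psi>)"
    by (rule abelian_group_cong[OF M.is_abelian_group]) (simp_all add: ring_bimodule_simps)
  show ?thesis
    unfolding bimodule_iff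
    by (intro conjI left_moduleI right_moduleI assms ab ballI additiveI)
      (simp_all add: ring_bimodule_simps M.m_assoc M.l_distr M.r_distr)
qed

section \<open>Morita contexts in terms of elements\<close>

text \<open>A Morita context written on elements: the two bimodule maps out of tensor products are
  replaced by the balanced maps that induce them, so that identities between them need no
  lifts.\<close>

locale morita_pairing = P: bimodule K P S + Q: bimodule S Q K
  for K :: "('a, 'k) ring_scheme" and S :: "('s, 'l) ring_scheme"
    and P :: "('a, 'p, 's) bimodule" and Q :: "('s, 'q, 'a) bimodule"
    and f :: "'p \<Rightarrow> 'q \<Rightarrow> 'a" and g :: "'q \<Rightarrow> 'p \<Rightarrow> 's" +
  assumes f_balanced: "balanced P S Q K f"
    and g_balanced: "balanced Q K P S g"
    and f_left: "\<lbrakk>c \<in> carrier K; p \<in> carrier P; q \<in> carrier Q\<rbrakk> \<Longrightarrow> f (c \<odot>\<^bsub>P\<^esub> p) q = c \<otimes>\<^bsub>K\<^esub> f p q"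
    and f_right: "\<lbrakk>c \<in> carrier K; p \<in> carrier P; q \<in> carrier Q\<rbrakk> \<Longrightarrow> f p (q \<bullet>\<^bsub>Q\<^esub> c) = f p q \<otimes>\<^bsub>K\<^esub> c"
    and g_left: "\<lbrakk>s \<in> carrier S; p \<in> carrier P; q \<in> carrier Q\<rbrakk> \<Longrightarrow> g (s \<odot>\<^bsub>Q\<^esub> q) p = s \<otimes>\<^bsub>S\<^esub> g q p"
    and g_right: "\<lbrakk>s \<in> carrier S; p \<in> carrier P; q \<in> carrier Q\<rbrakk> \<Longrightarrow> g q (p \<bullet>\<^bsub>P\<^esub> s) = g q p \<otimes>\<^bsub>S\<^esub> s"
    and f_assoc: "\<lbrakk>p \<in> carrier P; q \<in> carrier Q; p' \<in> carrier P\<rbrakk> \<Longrightarrow> f p q \<odot>\<^bsub>P\<^esub> p' = p \<bullet>\<^bsub>P\<^esub> g q p'"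
    and g_assoc: "\<lbrakk>q \<in> carrier Q; p \<in> carrier P; q' \<in> carrier Q\<rbrakk> \<Longrightarrow> g q p \<odot>\<^bsub>Q\<^esub> q' = q \<bullet>\<^bsub>Q\<^esub> f p q'"
begin

text \<open>The axioms come in pairs that the exchange of (K, P, f) with (S, Q, g) permutes, so
  every result about one pairing also gives its mirror image.\<close>

lemma swap: "morita_pairing S K Q P g f"
  by (intro morita_pairing.intro morita_pairing_axioms.intro Q.bimodule_axioms P.bimodule_axioms
      f_balanced g_balanced f_left f_right g_left g_right f_assoc g_assoc)

lemmas P_left = P.left_module_axioms and P_right = P.right_module_axioms
  and Q_left = Q.left_module_axioms and Q_right = Q.right_module_axioms

lemmas rings = left_module_simps(1)[OF P_left] left_module_simps(1)[OF Q_left]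
lemmas abelian_groups = left_module_simps(2)[OF P_left] left_module_simps(2)[OF Q_left]
  ring.is_abelian_group[OF rings(1)] ring.is_abelian_group[OF rings(2)]
lemmas closed = balancedD(1)[OF f_balanced] balancedD(1)[OF g_balanced]
  left_module_simps(3)[OF P_left] right_module_simps(3)[OF P_right]
  left_module_simps(3)[OF Q_left] right_module_simps(3)[OF Q_right]
  ring.ring_simprules(1,5,6)[OF rings(1)] ring.ring_simprules(1,5,6)[OF rings(2)]

end

text \<open>A pairing onto \<open>K\<close>: the \<open>p i\<close> and \<open>q i\<close> are dual bases of \<open>P\<close> and \<open>Q\<close> over \<open>S\<close>.\<close>

locale dual_bases = morita_pairing +
  fixes I :: "nat set" and p q
  assumes finite_I: "finite I" and p_closed: "p \<in> I \<rightarrow> carrier P" and q_closed: "q \<in> I \<rightarrow> carrier Q"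
    and unit: "(\<Oplus>\<^bsub>K\<^esub>i\<in>I. f (p i) (q i)) = \<one>\<^bsub>K\<^esub>"
begin

lemma pq_closed: "i \<in> I \<Longrightarrow> p i \<in> carrier P" "i \<in> I \<Longrightarrow> q i \<in> carrier Q"
  using p_closed q_closed by auto

lemma additive_unit:
  assumes "abelian_group X" "additive K X h"
  shows "(\<Oplus>\<^bsub>X\<^esub>i\<in>I. h (f (p i) (q i))) = h \<one>\<^bsub>K\<^esub>"
  using additive_finsum[OF abelian_groups(3) assms finite_I, of "\<lambda>i. f (p i) (q i)"]
  by (simp add: unit closed pq_closed)

lemma left_unit:
  assumes "left_module K X" "x \<in> carrier X"
  shows "(\<Oplus>\<^bsub>X\<^esub>i\<in>I. f (p i) (q i) \<odot>\<^bsub>X\<^esub> x) = x"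
  using additive_unit[OF left_module_simps(2,5)[OF assms(1)], of x] assms
  by (simp add: left_module.lsmult_one)

lemma right_unit:
  assumes "right_module X K" "x \<in> carrier X"
  shows "(\<Oplus>\<^bsub>X\<^esub>i\<in>I. x \<bullet>\<^bsub>X\<^esub> f (p i) (q i)) = x"
  using additive_unit[OF right_module_simps(2,5)[OF assms(1)], of x] assms
  by (simp add: right_module.rsmult_one)

text \<open>Apply the expansion of 1 to x and use \<open>f_assoc\<close>: f(p_i, q_i) x = p_i g(q_i,
  x). So the functionals g(q_i, -) are coordinates with respect to the p_i.\<close>

lemma P_expand: "x \<in> carrier P \<Longrightarrow> (\<Oplus>\<^bsub>P\<^esub>i\<in>I. p i \<bullet>\<^bsub>P\<^esub> g (q i) x) = x"
proof -
  assume x: "x \<in> carrier P"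
  have "(\<Oplus>\<^bsub>P\<^esub>i\<in>I. p i \<bullet>\<^bsub>P\<^esub> g (q i) x) = (\<Oplus>\<^bsub>P\<^esub>i\<in>I. f (p i) (q i) \<odot>\<^bsub>P\<^esub> x)"
    using x by (intro P.X.finsum_cong') (auto simp: f_assoc pq_closed closed)
  then show ?thesis using left_unit[OF P_left x] by simp
qed

text \<open>The same expansion acting from the right, with \<open>g_assoc\<close>: here the
  functionals g(-, p_i) are coordinates for the q_i.\<close>

lemma Q_expand: "y \<in> carrier Q \<Longrightarrow> (\<Oplus>\<^bsub>Q\<^esub>i\<in>I. g y (p i) \<odot>\<^bsub>Q\<^esub> q i) = y"
proof -
  assume y: "y \<in> carrier Q"
  have "(\<Oplus>\<^bsub>Q\<^esub>i\<in>I. g y (p i) \<odot>\<^bsub>Q\<^esub> q i) = (\<Oplus>\<^bsub>Q\<^esub>i\<in>I. y \<bullet>\<^bsub>Q\<^esub> f (p i) (q i))"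
    using y by (intro Q.X.finsum_cong') (auto simp: g_assoc pq_closed closed)
  then show ?thesis using right_unit[OF Q_right y] by simp
qed

lemma right_fin_gen: "right_fin_gen P S"
  unfolding right_fin_gen_def
proof (intro exI[of _ "p ` I"] conjI ballI)
  fix x assume x: "x \<in> carrier P"
  have "\<exists>a\<in>p ` I \<rightarrow> carrier S. (\<Oplus>\<^bsub>P\<^esub>i\<in>I. p i \<bullet>\<^bsub>P\<^esub> g (q i) x) = (\<Oplus>\<^bsub>P\<^esub>y\<in>p ` I. y \<bullet>\<^bsub>P\<^esub> a y)"
    using x by (intro finsum_collect abelian_groups right_module_simps(5)[OF P_right] finite_I p_closed)
      (auto simp: pq_closed closed)
  then show "\<exists>a\<in>p ` I \<rightarrow> carrier S. x = (\<Oplus>\<^bsub>P\<^esub>y\<in>p ` I. y \<bullet>\<^bsub>P\<^esub> a y)"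
    by (simp add: P_expand x)
qed (use finite_I p_closed in auto)

lemma left_fin_gen: "left_fin_gen S Q"
  unfolding left_fin_gen_def
proof (intro exI[of _ "q ` I"] conjI ballI)
  fix x assume x: "x \<in> carrier Q"
  have "\<exists>a\<in>q ` I \<rightarrow> carrier S. (\<Oplus>\<^bsub>Q\<^esub>i\<in>I. g x (p i) \<odot>\<^bsub>Q\<^esub> q i) = (\<Oplus>\<^bsub>Q\<^esub>y\<in>q ` I. a y \<odot>\<^bsub>Q\<^esub> y)"
    using x by (intro finsum_collect[where act = "\<lambda>x s. s \<odot>\<^bsub>Q\<^esub> x"]
        abelian_groups left_module_simps(5)[OF Q_left] finite_I q_closed)
      (auto simp: pq_closed closed)
  then show "\<exists>a\<in>q ` I \<rightarrow> carrier S. x = (\<Oplus>\<^bsub>Q\<^esub>y\<in>q ` I. a y \<odot>\<^bsub>Q\<^esub> y)"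
    by (simp add: Q_expand x)
qed (use finite_I q_closed in auto)

text \<open>Dual basis argument: lift only the values h(p_i), to x_i say, and extend by the
  coordinates g(q_i, -).\<close>

lemma right_projective: "right_projective P S T"
  unfolding right_projective_def
proof (intro allI impI, elim conjE)
  fix X Y u h
  assume X: "right_module X S" and Y: "right_module Y S"
    and u: "u \<in> right_hom X Y S" and surj: "u ` carrier X = carrier Y" and h: "h \<in> right_hom P Y S"
  note uh = u[unfolded right_hom_iff] h[unfolded right_hom_iff]
  note cl = right_module_simps(3)[OF X] right_module_simps(3)[OF Y]
  interpret XG: abelian_group X by (rule right_module_simps(2)[OF X])
  interpret YG: abelian_group Y by (rule right_module_simps(2)[OF Y])
  have "\<exists>x. x \<in> carrier X \<and> u x = h (p i)" if "i \<in> I" for i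
  proof -
    have "h (p i) \<in> u ` carrier X"
      unfolding surj using uh pq_closed(1)[OF that] by (simp add: additive_closed[of P Y h])
    then show ?thesis by (auto simp: image_iff)
  qed
  then obtain x where x: "\<And>i. i \<in> I \<Longrightarrow> x i \<in> carrier X" "\<And>i. i \<in> I \<Longrightarrow> u (x i) = h (p i)"
    by metis
  \<comment> \<open>Right linear because each g(q_i, -) is; it lifts \<open>h\<close> because
    applying \<open>u\<close> turns x_i into h(p_i), and \<open>P_expand\<close> then reassembles
    y.\<close>
  define k where "k y = (\<Oplus>\<^bsub>X\<^esub>i\<in>I. x i \<bullet>\<^bsub>X\<^esub> g (q i) y)" for y
  have k: "additive P X k"
    unfolding k_def
    by (intro additive_finsum_map abelian_groups XG.abelian_group_axioms finite_I
        additive_comp[OF balancedD(6)[OF g_balanced] right_module_simps(5)[OF X]] pq_closed x)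
  have "k (y \<bullet>\<^bsub>P\<^esub> s) = k y \<bullet>\<^bsub>X\<^esub> s" if "y \<in> carrier P" "s \<in> carrier S" for y s
  proof -
    have "k y \<bullet>\<^bsub>X\<^esub> s = (\<Oplus>\<^bsub>X\<^esub>i\<in>I. (x i \<bullet>\<^bsub>X\<^esub> g (q i) y) \<bullet>\<^bsub>X\<^esub> s)"
      unfolding k_def
      by (rule additive_finsum[OF _ _ right_module_simps(4)[OF X that(2)] finite_I])
        (use that x in \<open>auto simp: XG.abelian_group_axioms cl pq_closed closed\<close>)
    also have "\<dots> = k (y \<bullet>\<^bsub>P\<^esub> s)"
      unfolding k_def using that x
      by (intro XG.finsum_cong') (auto simp: g_right pq_closed closed cl right_module.rsmult_assoc[OF X])
    finally show ?thesis by simp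
  qed
  then have "restrict k (carrier P) \<in> right_hom P X S"
    by (intro restrict_right_hom P_right k) auto
  moreover have "u (k y) = h y" if y: "y \<in> carrier P" for y
  proof -
    have "u (k y) = (\<Oplus>\<^bsub>Y\<^esub>i\<in>I. u (x i \<bullet>\<^bsub>X\<^esub> g (q i) y))"
      unfolding k_def
      by (rule additive_finsum[OF XG.abelian_group_axioms YG.abelian_group_axioms _ finite_I])
        (use uh y x in \<open>auto simp: cl pq_closed closed\<close>)
    also have "\<dots> = (\<Oplus>\<^bsub>Y\<^esub>i\<in>I. h (p i \<bullet>\<^bsub>P\<^esub> g (q i) y))"
      using uh y x additive_closed[of P Y h]
      by (intro YG.finsum_cong') (auto simp: cl pq_closed closed)
    also have "\<dots> = h (\<Oplus>\<^bsub>P\<^esub>i\<in>I. p i \<bullet>\<^bsub>P\<^esub> g (q i) y)"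
      by (rule additive_finsum[symmetric, OF abelian_groups(1) YG.abelian_group_axioms _ finite_I])
        (use uh y in \<open>auto simp: pq_closed closed\<close>)
    finally show ?thesis by (simp add: P_expand y)
  qed
  ultimately show "\<exists>k\<in>right_hom P X S. \<forall>y\<in>carrier P. u (k y) = h y"
    by (intro bexI[of _ "restrict k (carrier P)"]) auto
qed

text \<open>Mirror image: the values h(q_i) are lifted, and the coordinates of y are now g(y,
  p_i).\<close>

lemma left_projective: "left_projective S Q T"
  unfolding left_projective_def
proof (intro allI impI, elim conjE)
  fix X Y u h
  assume X: "left_module S X" and Y: "left_module S Y"
    and u: "u \<in> left_hom S X Y" and surj: "u ` carrier X = carrier Y" and h: "h \<in> left_hom S Q Y"
  note uh = u[unfolded left_hom_iff] h[unfolded left_hom_iff]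
  note cl = left_module_simps(3)[OF X] left_module_simps(3)[OF Y]
  interpret XG: abelian_group X by (rule left_module_simps(2)[OF X])
  interpret YG: abelian_group Y by (rule left_module_simps(2)[OF Y])
  have "\<exists>x. x \<in> carrier X \<and> u x = h (q i)" if "i \<in> I" for i
  proof -
    have "h (q i) \<in> u ` carrier X"
      unfolding surj using uh pq_closed(2)[OF that] by (simp add: additive_closed[of Q Y h])
    then show ?thesis by (auto simp: image_iff)
  qed
  then obtain x where x: "\<And>i. i \<in> I \<Longrightarrow> x i \<in> carrier X" "\<And>i. i \<in> I \<Longrightarrow> u (x i) = h (q i)"
    by metis
  define k where "k y = (\<Oplus>\<^bsub>X\<^esub>i\<in>I. g y (p i) \<odot>\<^bsub>X\<^esub> x i)" for y
  have k: "additive Q X k"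
    unfolding k_def
    by (intro additive_finsum_map abelian_groups XG.abelian_group_axioms finite_I
        additive_comp[OF balancedD(5)[OF g_balanced] left_module_simps(5)[OF X]] pq_closed x)
  have "k (s \<odot>\<^bsub>Q\<^esub> y) = s \<odot>\<^bsub>X\<^esub> k y" if "y \<in> carrier Q" "s \<in> carrier S" for y s
  proof -
    have "s \<odot>\<^bsub>X\<^esub> k y = (\<Oplus>\<^bsub>X\<^esub>i\<in>I. s \<odot>\<^bsub>X\<^esub> (g y (p i) \<odot>\<^bsub>X\<^esub> x i))"
      unfolding k_def
      by (rule additive_finsum[OF _ _ left_module_simps(4)[OF X that(2)] finite_I])
        (use that x in \<open>auto simp: XG.abelian_group_axioms cl pq_closed closed\<close>)
    also have "\<dots> = k (s \<odot>\<^bsub>Q\<^esub> y)"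
      unfolding k_def using that x
      by (intro XG.finsum_cong') (auto simp: g_left pq_closed closed cl left_module.lsmult_assoc[OF X])
    finally show ?thesis by simp
  qed
  then have "restrict k (carrier Q) \<in> left_hom S Q X"
    by (intro restrict_left_hom Q_left k) auto
  moreover have "u (k y) = h y" if y: "y \<in> carrier Q" for y
  proof -
    have "u (k y) = (\<Oplus>\<^bsub>Y\<^esub>i\<in>I. u (g y (p i) \<odot>\<^bsub>X\<^esub> x i))"
      unfolding k_def
      by (rule additive_finsum[OF XG.abelian_group_axioms YG.abelian_group_axioms _ finite_I])
        (use uh y x in \<open>auto simp: cl pq_closed closed\<close>)
    also have "\<dots> = (\<Oplus>\<^bsub>Y\<^esub>i\<in>I. h (g y (p i) \<odot>\<^bsub>Q\<^esub> q i))"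
      using uh y x additive_closed[of Q Y h]
      by (intro YG.finsum_cong') (auto simp: cl pq_closed closed)
    also have "\<dots> = h (\<Oplus>\<^bsub>Q\<^esub>i\<in>I. g y (p i) \<odot>\<^bsub>Q\<^esub> q i)"
      by (rule additive_finsum[symmetric, OF abelian_groups(2) YG.abelian_group_axioms _ finite_I])
        (use uh y in \<open>auto simp: pq_closed closed\<close>)
    finally show ?thesis by (simp add: Q_expand y)
  qed
  ultimately show "\<exists>k\<in>left_hom S Q X. \<forall>y\<in>carrier Q. u (k y) = h y"
    by (intro bexI[of _ "restrict k (carrier Q)"]) auto
qed

text \<open>Every x in \<open>X\<close> is a sum of values of homomorphisms from \<open>P\<close>: y
  |-> f(y, q_i) x is left \<open>K\<close>-linear and its values at the p_i add up to x. Note the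
  change of side: projectivity of \<open>P\<close> is over \<open>S\<close>, its generator property
  over \<open>K\<close>.\<close>

lemma left_generator: "left_generator K P T"
  unfolding left_generator_def
proof (intro allI impI, elim conjE, rule ccontr)
  fix X Y u v
  assume X: "left_module K X" and Y: "left_module K Y"
    and u: "u \<in> left_hom K X Y" and v: "v \<in> left_hom K X Y" and "u \<noteq> v"
    and neg: "\<not> (\<exists>k\<in>left_hom K P X. \<exists>y\<in>carrier P. u (k y) \<noteq> v (k y))"
  note uv = u[unfolded left_hom_iff] v[unfolded left_hom_iff]
  interpret XG: abelian_group X by (rule left_module_simps(2)[OF X])
  interpret YG: abelian_group Y by (rule left_module_simps(2)[OF Y])
  have "u x = v x" if x: "x \<in> carrier X" for x
  proof -
    have cl: "f (p i) (q i) \<odot>\<^bsub>X\<^esub> x \<in> carrier X" if "i \<in> I" for i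
      using that x by (simp add: left_module_simps(3)[OF X] closed pq_closed)
    have "u (f (p i) (q i) \<odot>\<^bsub>X\<^esub> x) = v (f (p i) (q i) \<odot>\<^bsub>X\<^esub> x)" if i: "i \<in> I" for i
    proof -
      have "(\<lambda>y\<in>carrier P. f y (q i) \<odot>\<^bsub>X\<^esub> x) \<in> left_hom K P X"
        by (rule restrict_left_hom[OF P_left
              additive_comp[OF balancedD(5)[OF f_balanced] left_module_simps(5)[OF X]]])
          (use i x in \<open>simp_all add: pq_closed f_left closed left_module.lsmult_assoc[OF X]\<close>)
      then show ?thesis using neg pq_closed(1)[OF i] by fastforce
    qed
    then have "(\<Oplus>\<^bsub>Y\<^esub>i\<in>I. u (f (p i) (q i) \<odot>\<^bsub>X\<^esub> x)) = (\<Oplus>\<^bsub>Y\<^esub>i\<in>I. v (f (p i) (q i) \<odot>\<^bsub>X\<^esub> x))"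
      using cl additive_closed[of X Y v] uv by (intro YG.finsum_cong') auto
    moreover have "h (\<Oplus>\<^bsub>X\<^esub>i\<in>I. f (p i) (q i) \<odot>\<^bsub>X\<^esub> x) = (\<Oplus>\<^bsub>Y\<^esub>i\<in>I. h (f (p i) (q i) \<odot>\<^bsub>X\<^esub> x))"
      if "additive X Y h" for h
      by (rule additive_finsum[OF XG.abelian_group_axioms YG.abelian_group_axioms that finite_I])
        (use cl in auto)
    ultimately have "u (\<Oplus>\<^bsub>X\<^esub>i\<in>I. f (p i) (q i) \<odot>\<^bsub>X\<^esub> x) = v (\<Oplus>\<^bsub>X\<^esub>i\<in>I. f (p i) (q i) \<odot>\<^bsub>X\<^esub> x)"
      using uv by simp
    then show ?thesis by (simp add: left_unit[OF X x])
  qed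
  then have "u = v" using uv by (intro extensionalityI[of u "carrier X" v]) auto
  then show False using \<open>u \<noteq> v\<close> by simp
qed

text \<open>As for \<open>left_generator\<close>, now with the right linear maps y |-> x f(p_i, y)
  from \<open>Q\<close> and their values at the q_i.\<close>

lemma right_generator: "right_generator Q K T"
  unfolding right_generator_def
proof (intro allI impI, elim conjE, rule ccontr)
  fix X Y u v
  assume X: "right_module X K" and Y: "right_module Y K"
    and u: "u \<in> right_hom X Y K" and v: "v \<in> right_hom X Y K" and "u \<noteq> v"
    and neg: "\<not> (\<exists>k\<in>right_hom Q X K. \<exists>y\<in>carrier Q. u (k y) \<noteq> v (k y))"
  note uv = u[unfolded right_hom_iff] v[unfolded right_hom_iff]
  interpret XG: abelian_group X by (rule right_module_simps(2)[OF X])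
  interpret YG: abelian_group Y by (rule right_module_simps(2)[OF Y])
  have "u x = v x" if x: "x \<in> carrier X" for x
  proof -
    have cl: "x \<bullet>\<^bsub>X\<^esub> f (p i) (q i) \<in> carrier X" if "i \<in> I" for i
      using that x by (simp add: right_module_simps(3)[OF X] closed pq_closed)
    have "u (x \<bullet>\<^bsub>X\<^esub> f (p i) (q i)) = v (x \<bullet>\<^bsub>X\<^esub> f (p i) (q i))" if i: "i \<in> I" for i
    proof -
      have "(\<lambda>y\<in>carrier Q. x \<bullet>\<^bsub>X\<^esub> f (p i) y) \<in> right_hom Q X K"
        by (rule restrict_right_hom[OF Q_right
              additive_comp[OF balancedD(6)[OF f_balanced] right_module_simps(5)[OF X]]])
          (use i x in \<open>simp_all add: pq_closed f_right closed right_module.rsmult_assoc[OF X]\<close>)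
      then show ?thesis using neg pq_closed(2)[OF i] by fastforce
    qed
    then have "(\<Oplus>\<^bsub>Y\<^esub>i\<in>I. u (x \<bullet>\<^bsub>X\<^esub> f (p i) (q i))) = (\<Oplus>\<^bsub>Y\<^esub>i\<in>I. v (x \<bullet>\<^bsub>X\<^esub> f (p i) (q i)))"
      using cl additive_closed[of X Y v] uv by (intro YG.finsum_cong') auto
    moreover have "h (\<Oplus>\<^bsub>X\<^esub>i\<in>I. x \<bullet>\<^bsub>X\<^esub> f (p i) (q i)) = (\<Oplus>\<^bsub>Y\<^esub>i\<in>I. h (x \<bullet>\<^bsub>X\<^esub> f (p i) (q i)))"
      if "additive X Y h" for h
      by (rule additive_finsum[OF XG.abelian_group_axioms YG.abelian_group_axioms that finite_I])
        (use cl in auto)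
    ultimately have "u (\<Oplus>\<^bsub>X\<^esub>i\<in>I. x \<bullet>\<^bsub>X\<^esub> f (p i) (q i)) = v (\<Oplus>\<^bsub>X\<^esub>i\<in>I. x \<bullet>\<^bsub>X\<^esub> f (p i) (q i))"
      using uv by simp
    then show ?thesis by (simp add: right_unit[OF X x])
  qed
  then have "u = v" using uv by (intro extensionalityI[of u "carrier X" v]) auto
  then show False using \<open>u \<noteq> v\<close> by simp
qed

end

lemmas abelian_group_finsum_cong = abelian_monoid.finsum_cong'[OF abelian_group.axioms(1)]
lemmas abelian_group_finsum_closed = abelian_monoid.finsum_closed[OF abelian_group.axioms(1)]

section \<open>Reconstruction from dual bases\<close>

text \<open>
  \<open>T\<close> is recovered both as \<open>P \<otimes>\<^sub>S Y\<close> and as the left \<open>S\<close>-linear maps \<open>Q \<rightarrow> Y\<close>: every \<open>t\<close> equals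
  the sum of the \<open>b (p i) (k (q i) t)\<close>.
\<close>

locale reconstruction = dual_bases K S P Q f g I p q
  for K :: "('a, 'k) ring_scheme" and S :: "('s, 'l) ring_scheme"
    and P :: "('a, 'p, 's) bimodule" and Q :: "('s, 'q, 'a) bimodule"
    and f :: "'p \<Rightarrow> 'q \<Rightarrow> 'a" and g :: "'q \<Rightarrow> 'p \<Rightarrow> 's" and I p q +
  fixes T :: "('a, 't, 'd) bimodule" and Y :: "('s, 'y, 'd) bimodule"
    and k :: "'q \<Rightarrow> 't \<Rightarrow> 'y" and b :: "'p \<Rightarrow> 'y \<Rightarrow> 't"
  assumes T: "left_module K T" and Y: "left_module S Y"
    and b_balanced: "balanced P S Y T b" and k_balanced: "balanced Q K T Y k"
    and b_left: "\<lbrakk>c \<in> carrier K; x \<in> carrier P; y \<in> carrier Y\<rbrakk> \<Longrightarrow> b (c \<odot>\<^bsub>P\<^esub> x) y = c \<odot>\<^bsub>T\<^esub> b x y"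
    and k_left: "\<lbrakk>s \<in> carrier S; z \<in> carrier Q; t \<in> carrier T\<rbrakk> \<Longrightarrow> k (s \<odot>\<^bsub>Q\<^esub> z) t = s \<odot>\<^bsub>Y\<^esub> k z t"
    and b_k: "\<lbrakk>x \<in> carrier P; z \<in> carrier Q; t \<in> carrier T\<rbrakk> \<Longrightarrow> b x (k z t) = f x z \<odot>\<^bsub>T\<^esub> t"
    and k_b: "\<lbrakk>z \<in> carrier Q; x \<in> carrier P; y \<in> carrier Y\<rbrakk> \<Longrightarrow> k z (b x y) = g z x \<odot>\<^bsub>Y\<^esub> y"
begin

sublocale P_Y: tensor_product P S Y
  by (simp add: tensor_product_iff P_right Y)

lemmas T_simps = left_module_simps[OF T] and Y_simps = left_module_simps[OF Y]

lemmas closed' = closed pq_closed balancedD(1)[OF b_balanced] balancedD(1)[OF k_balanced]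
  T_simps(3) Y_simps(3)

lemma expand:
  assumes "t \<in> carrier T"
  shows "(\<Oplus>\<^bsub>T\<^esub>i\<in>I. b (p i) (k (q i) t)) = t"
proof -
  interpret TG: abelian_group T by (rule T_simps(2))
  have "(\<Oplus>\<^bsub>T\<^esub>i\<in>I. b (p i) (k (q i) t)) = (\<Oplus>\<^bsub>T\<^esub>i\<in>I. f (p i) (q i) \<odot>\<^bsub>T\<^esub> t)"
    using assms by (intro TG.finsum_cong') (auto simp: b_k closed')
  then show ?thesis by (simp add: left_unit[OF T assms])
qed

text \<open>The inverse is t |-> sum of p_i (x) k(q_i, t). Only additivity and the values on pure
  tensors are assumed of \<open>\<tau>\<close>, so the result serves both a bare
  \<open>tensor_lift\<close> and its restriction to the carrier.\<close>

lemma tensor_bij: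
  assumes \<tau>: "additive (tensor P S Y) T \<tau>"
    and \<tau>_pure: "\<And>x y. x \<in> carrier P \<Longrightarrow> y \<in> carrier Y \<Longrightarrow> \<tau> (pure_tensor P S Y x y) = b x y"
  shows "bij_betw \<tau> (carrier (tensor P S Y)) (carrier T)"
proof -
  let ?Z = "tensor P S Y" and ?pt = "pure_tensor P S Y"
  interpret ZG: abelian_group ?Z by (rule P_Y.abelian_group_tensor)
  define \<sigma> where "\<sigma> t = (\<Oplus>\<^bsub>?Z\<^esub>i\<in>I. ?pt (p i) (k (q i) t))" for t
  have "additive T ?Z \<sigma>"
    unfolding \<sigma>_def
    by (intro additive_finsum_map T_simps P_Y.abelian_group_tensor finite_I
        additive_comp[OF balancedD(6)[OF k_balanced] balancedD(6)[OF P_Y.balanced_pure]] pq_closed)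
  then have \<sigma>\<tau>: "additive ?Z ?Z (\<lambda>u. \<sigma> (\<tau> u))" by (rule additive_comp[OF \<tau>])
  have "\<sigma> (\<tau> u) = u" if u: "u \<in> carrier ?Z" for u
  proof (rule P_Y.additive_eqI[OF \<sigma>\<tau> additive_id _ u])
    fix x y assume xy: "x \<in> carrier P" "y \<in> carrier Y"
    \<comment> \<open>The scalar in k(q_i, b(x, y)) = g(q_i, x) y crosses the tensor sign to p_i,
      where \<open>f_assoc\<close> turns it into f(p_i, q_i) acting on x. Summation over i then
      leaves x alone.\<close>
    have e: "?pt (p i) (k (q i) (b x y)) = ?pt (f (p i) (q i) \<odot>\<^bsub>P\<^esub> x) y" if "i \<in> I" for i
      using that xy by (simp add: k_b f_assoc closed' P_Y.pure_balanced)
    have "\<sigma> (\<tau> (?pt x y)) = (\<Oplus>\<^bsub>?Z\<^esub>i\<in>I. ?pt (f (p i) (q i) \<odot>\<^bsub>P\<^esub> x) y)"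
      unfolding \<sigma>_def \<tau>_pure[OF xy]
      by (rule ZG.finsum_cong') (use xy e in \<open>auto simp: closed' P_Y.pure_closed\<close>)
    also have "\<dots> = ?pt (\<Oplus>\<^bsub>P\<^esub>i\<in>I. f (p i) (q i) \<odot>\<^bsub>P\<^esub> x) y"
      by (rule additive_finsum[symmetric, OF abelian_groups(1) P_Y.abelian_group_tensor
            balancedD(5)[OF P_Y.balanced_pure] finite_I])
        (use xy in \<open>auto simp: closed'\<close>)
    finally show "\<sigma> (\<tau> (?pt x y)) = ?pt x y" using left_unit[OF P_left] xy by simp
  qed
  moreover have "\<tau> (\<sigma> t) = t" if t: "t \<in> carrier T" for t
  proof -
    have "\<tau> (\<sigma> t) = (\<Oplus>\<^bsub>T\<^esub>i\<in>I. \<tau> (?pt (p i) (k (q i) t)))"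
      unfolding \<sigma>_def
      by (rule additive_finsum[OF P_Y.abelian_group_tensor T_simps(2) \<tau> finite_I])
        (use t in \<open>auto simp: closed' P_Y.pure_closed\<close>)
    also have "\<dots> = (\<Oplus>\<^bsub>T\<^esub>i\<in>I. b (p i) (k (q i) t))"
      using t by (intro abelian_monoid.finsum_cong' abelian_group.axioms(1) T_simps(2))
        (auto simp: closed' \<tau>_pure)
    finally show ?thesis by (simp add: expand t)
  qed
  ultimately show ?thesis
    using additive_closed[OF \<tau>] additive_closed[OF \<open>additive T ?Z \<sigma>\<close>]
    by (intro bij_betwI[where g = \<sigma>]) auto
qed

lemma tensor_left:
  assumes \<tau>: "additive (tensor P S Y) T \<tau>"
    and \<tau>_pure: "\<And>x y. x \<in> carrier P \<Longrightarrow> y \<in> carrier Y \<Longrightarrow> \<tau> (pure_tensor P S Y x y) = b x y"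
    and "c \<in> carrier K" "u \<in> carrier (tensor P S Y)"
  shows "\<tau> (c \<odot>\<^bsub>tensor P S Y\<^esub> u) = c \<odot>\<^bsub>T\<^esub> \<tau> u"
proof -
  note sm = tensor_smult_pure[OF P.bimodule_axioms Y assms(3)]
  show ?thesis
    by (rule P_Y.additive_eqI[OF additive_comp[OF sm(1) \<tau>] additive_comp[OF \<tau> T_simps(4)[OF assms(3)]]
          _ assms(4)])
      (use assms(3) in \<open>simp add: sm(2) \<tau>_pure b_left closed\<close>)
qed

lemma tensor_bimodule_iso:
  assumes \<tau>: "additive (tensor P S Y) T \<tau>"
    and \<tau>_pure: "\<And>x y. x \<in> carrier P \<Longrightarrow> y \<in> carrier Y \<Longrightarrow> \<tau> (pure_tensor P S Y x y) = b x y"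
    and T_D: "bimodule K T D" and Y_D: "bimodule S Y D"
    and b_right: "\<And>x y d. x \<in> carrier P \<Longrightarrow> y \<in> carrier Y \<Longrightarrow> d \<in> carrier D \<Longrightarrow>
      b x (y \<bullet>\<^bsub>Y\<^esub> d) = b x y \<bullet>\<^bsub>T\<^esub> d"
  shows "restrict \<tau> (carrier (tensor P S Y)) \<in> bimodule_iso K (tensor P S Y) T D"
proof -
  let ?Z = "tensor P S Y"
  note Z = bimodule_tensor[OF P.bimodule_axioms Y_D]
  have r: "\<tau> (u \<bullet>\<^bsub>?Z\<^esub> d) = \<tau> u \<bullet>\<^bsub>T\<^esub> d" if "d \<in> carrier D" "u \<in> carrier ?Z" for u d
  proof -
    note sm = tensor_rsmult_pure[OF P_right Y_D that(1)]
    note Td = right_module_simps[OF bimodule_right[OF T_D]]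
    show ?thesis
      by (rule P_Y.additive_eqI[OF additive_comp[OF sm(1) \<tau>] additive_comp[OF \<tau> Td(4)[OF that(1)]] _ that(2)])
        (use that in \<open>simp add: sm(2) \<tau>_pure b_right right_module_simps(3)[OF bimodule_right[OF Y_D]]\<close>)
  qed
  have "bij_betw (restrict \<tau> (carrier ?Z)) (carrier ?Z) (carrier T)"
    using tensor_bij[OF \<tau> \<tau>_pure] by (simp cong: bij_betw_cong)
  then show ?thesis
    unfolding bimodule_iso_def bimodule_hom_iff
    using left_module_simps(2,3)[OF bimodule_left[OF Z]] right_module_simps(3)[OF bimodule_right[OF Z]]
    by (simp add: r tensor_left[OF \<tau> \<tau>_pure] additive_restrict_iff \<tau>)
qed

lemma hom_closed: "t \<in> carrier T \<Longrightarrow> (\<lambda>z\<in>carrier Q. k z t) \<in> left_hom S Q Y"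
  by (rule restrict_left_hom[OF Q_left balancedD(5)[OF k_balanced]]) (auto simp: k_left)

text \<open>By \<open>Q_expand\<close> a left linear h on \<open>Q\<close> is determined by its
  values at the q_i; the inverse sends h to the sum of the b(p_i, h(q_i)).\<close>

lemma hom_bij: "bij_betw (\<lambda>t. \<lambda>z\<in>carrier Q. k z t) (carrier T) (left_hom S Q Y)"
proof (rule bij_betwI[where g = "\<lambda>h. \<Oplus>\<^bsub>T\<^esub>i\<in>I. b (p i) (h (q i))"])
  interpret TG: abelian_group T by (rule T_simps(2))
  show "(\<lambda>t. \<lambda>z\<in>carrier Q. k z t) \<in> carrier T \<rightarrow> left_hom S Q Y" using hom_closed by auto
  have hq: "h z \<in> carrier Y" if "h \<in> left_hom S Q Y" "z \<in> carrier Q" for h z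
    using that additive_closed[of Q Y h] by (simp add: left_hom_iff)
  show "(\<lambda>h. \<Oplus>\<^bsub>T\<^esub>i\<in>I. b (p i) (h (q i))) \<in> left_hom S Q Y \<rightarrow> carrier T"
    by (intro funcsetI TG.finsum_closed) (auto simp: closed' hq)
  show "(\<Oplus>\<^bsub>T\<^esub>i\<in>I. b (p i) ((\<lambda>z\<in>carrier Q. k z t) (q i))) = t" if t: "t \<in> carrier T" for t
  proof -
    have "(\<Oplus>\<^bsub>T\<^esub>i\<in>I. b (p i) ((\<lambda>z\<in>carrier Q. k z t) (q i))) = (\<Oplus>\<^bsub>T\<^esub>i\<in>I. b (p i) (k (q i) t))"
      using t by (intro TG.finsum_cong') (auto simp: closed')
    then show ?thesis by (simp add: expand t)
  qed
  fix h assume h: "h \<in> left_hom S Q Y"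
  then have h': "additive Q Y h" "\<And>s z. s \<in> carrier S \<Longrightarrow> z \<in> carrier Q \<Longrightarrow> h (s \<odot>\<^bsub>Q\<^esub> z) = s \<odot>\<^bsub>Y\<^esub> h z"
    "h \<in> extensional (carrier Q)"
    by (auto simp: left_hom_iff)
  have "k z (\<Oplus>\<^bsub>T\<^esub>i\<in>I. b (p i) (h (q i))) = h z" if z: "z \<in> carrier Q" for z
  proof -
    have "k z (\<Oplus>\<^bsub>T\<^esub>i\<in>I. b (p i) (h (q i))) = (\<Oplus>\<^bsub>Y\<^esub>i\<in>I. k z (b (p i) (h (q i))))"
      by (rule additive_finsum[OF T_simps(2) Y_simps(2) balancedD(6)[OF k_balanced z] finite_I])
        (auto simp: closed' hq h)
    \<comment> \<open>\<open>k_b\<close> produces g(z, p_i) h(q_i), and linearity of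
      \<open>h\<close> moves the scalar inside, ready for \<open>Q_expand\<close>.\<close>
    also have "\<dots> = (\<Oplus>\<^bsub>Y\<^esub>i\<in>I. h (g z (p i) \<odot>\<^bsub>Q\<^esub> q i))"
      using z h by (intro abelian_group_finsum_cong Y_simps(2)) (auto simp: closed' hq k_b h')
    also have "\<dots> = h (\<Oplus>\<^bsub>Q\<^esub>i\<in>I. g z (p i) \<odot>\<^bsub>Q\<^esub> q i)"
      by (rule additive_finsum[symmetric, OF abelian_groups(2) Y_simps(2) h'(1) finite_I])
        (use z in \<open>auto simp: closed'\<close>)
    finally show ?thesis by (simp add: Q_expand z)
  qed
  then show "(\<lambda>z\<in>carrier Q. k z (\<Oplus>\<^bsub>T\<^esub>i\<in>I. b (p i) (h (q i)))) = h"
    using h' by (intro extensionalityI[of _ "carrier Q"]) auto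
qed

text \<open>\<open>K\<close> acts on maps out of \<open>Q\<close> through the right action on
  \<open>Q\<close>, so left \<open>K\<close>-linearity of t |-> k(-, t) is exactly the balancedness
  of \<open>k\<close>.\<close>

lemma hom_bimodule_iso:
  assumes T_D: "bimodule K T D"
    and k_right: "\<And>z t d. z \<in> carrier Q \<Longrightarrow> t \<in> carrier T \<Longrightarrow> d \<in> carrier D \<Longrightarrow>
      k z (t \<bullet>\<^bsub>T\<^esub> d) = k z t \<bullet>\<^bsub>Y\<^esub> d"
  shows "(\<lambda>t\<in>carrier T. \<lambda>z\<in>carrier Q. k z t) \<in> bimodule_iso K T (left_hom_bimodule S Q Y) D"
proof -
  let ?h = "\<lambda>t. \<lambda>z\<in>carrier Q. k z t"
  have "bij_betw (restrict ?h (carrier T)) (carrier T) (left_hom S Q Y)"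
    using hom_bij by (simp cong: bij_betw_cong)
  moreover have "additive T (left_hom_bimodule S Q Y) ?h"
    by (rule additiveI)
      (auto simp: left_hom_bimodule_def hom_closed balancedD[OF k_balanced] intro!: restrict_ext)
  ultimately show ?thesis
    unfolding bimodule_iso_def bimodule_hom_iff
    by (auto simp: additive_restrict_iff T_simps right_module_simps(3)[OF bimodule_right[OF T_D]]
        left_hom_bimodule_def k_right closed balancedD(4)[OF k_balanced] intro!: restrict_ext)
qed

end

section \<open>Consequences of a surjective pairing\<close>

lemma tensor_map_pure:
  assumes "right_module X S" "left_module S Y" "right_module X' S" "left_module S Y'"
    and u: "additive X X' u" "\<And>x s. x \<in> carrier X \<Longrightarrow> s \<in> carrier S \<Longrightarrow> u (x \<bullet>\<^bsub>X\<^esub> s) = u x \<bullet>\<^bsub>X'\<^esub> s"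
    and v: "additive Y Y' v" "\<And>s y. s \<in> carrier S \<Longrightarrow> y \<in> carrier Y \<Longrightarrow> v (s \<odot>\<^bsub>Y\<^esub> y) = s \<odot>\<^bsub>Y'\<^esub> v y"
  shows "additive (tensor X S Y) (tensor X' S Y') (tensor_map X S Y X' Y' u v)"
    and "x \<in> carrier X \<Longrightarrow> y \<in> carrier Y \<Longrightarrow>
      tensor_map X S Y X' Y' u v (pure_tensor X S Y x y) = pure_tensor X' S Y' (u x) (v y)"
proof -
  interpret t: tensor_product X S Y using assms by (simp add: tensor_product_iff)
  interpret t': tensor_product X' S Y' using assms by (simp add: tensor_product_iff)
  note cl = additive_closed[OF u(1)] additive_closed[OF v(1)]
  have bal: "balanced X S Y (tensor X' S Y') (\<lambda>x y. pure_tensor X' S Y' (u x) (v y))"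
    by (rule balancedI)
      (simp_all add: cl additive_add[OF u(1)] additive_add[OF v(1)] u(2) v(2)
        t'.pure_closed t'.pure_add_left t'.pure_add_right t'.pure_balanced)
  show "additive (tensor X S Y) (tensor X' S Y') (tensor_map X S Y X' Y' u v)"
    unfolding tensor_map_def
    using t.additive_lift[OF t'.abelian_group_tensor bal]
    by (simp add: additive_restrict_iff t.abelian_group_tensor)
  show "tensor_map X S Y X' Y' u v (pure_tensor X S Y x y) = pure_tensor X' S Y' (u x) (v y)"
    if "x \<in> carrier X" "y \<in> carrier Y"
    using t.lift_pure[OF t'.abelian_group_tensor bal that] that
    by (simp add: tensor_map_def t.pure_closed)
qed

context dual_bases
begin

lemma regular_K: "bimodule K (ring_bimodule K id id) K"
  by (rule bimodule_ring_bimodule[OF rings(1) rings(1) rings(1) id_ring_hom id_ring_hom])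

lemma regular_S: "bimodule S (ring_bimodule S id id) S"
  by (rule bimodule_ring_bimodule[OF rings(2) rings(2) rings(2) id_ring_hom id_ring_hom])

text \<open>Instance T = K, Y = Q, where \<open>k\<close> is the right action on \<open>Q\<close>
  and \<open>b\<close> is \<open>f\<close>. It yields both the surjective pairing as an isomorphism
  onto \<open>K\<close> and the identification of \<open>K\<close> with the left
  \<open>S\<close>-endomorphisms of \<open>Q\<close>.\<close>

lemma reconstruct_K:
  "reconstruction K S P Q f g I p q (ring_bimodule K id id) Q (rsmult Q) f"
proof (intro reconstruction.intro reconstruction_axioms.intro dual_bases_axioms)
  show "balanced P S Q (ring_bimodule K id id) f"
    using f_balanced by (simp add: balanced_def additive_ring_bimodule)
  show "balanced Q K (ring_bimodule K id id) Q (rsmult Q)"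
    using right_module_simps(4,5)[OF Q_right] right_module.rsmult_assoc[OF Q_right]
    by (simp add: balanced_def additive_ring_bimodule ring_bimodule_simps)
qed (auto simp: bimodule_left[OF regular_K] Q_left ring_bimodule_simps f_left f_right g_assoc
    Q.smult_rsmult_assoc)

text \<open>Instance T = P, Y = S, where \<open>k\<close> is \<open>g\<close> and \<open>b\<close>
  is the right action on \<open>P\<close>; its Hom part makes \<open>P\<close> the
  \<open>S\<close>-dual of \<open>Q\<close>.\<close>

lemma reconstruct_P:
  "reconstruction K S P Q f g I p q P (ring_bimodule S id id) g (rsmult P)"
proof (intro reconstruction.intro reconstruction_axioms.intro dual_bases_axioms)
  show "balanced Q K P (ring_bimodule S id id) g"
    using g_balanced by (simp add: balanced_def additive_ring_bimodule)
  show "balanced P S (ring_bimodule S id id) P (rsmult P)"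
    using right_module_simps(4,5)[OF P_right] right_module.rsmult_assoc[OF P_right]
    by (simp add: balanced_def additive_ring_bimodule ring_bimodule_simps)
qed (auto simp: bimodule_left[OF regular_S] P_left ring_bimodule_simps f_assoc g_left g_right
    P.smult_rsmult_assoc)

lemma pairing_iso:
  "restrict (tensor_lift K f) (carrier (tensor P S Q)) \<in> bimodule_iso K (tensor P S Q) (ring_bimodule K id id) K"
proof -
  interpret r: reconstruction K S P Q f g I p q "ring_bimodule K id id" Q "rsmult Q" f
    by (rule reconstruct_K)
  show ?thesis
    by (rule r.tensor_bimodule_iso)
      (auto simp: additive_ring_bimodule ring_bimodule_simps f_right regular_K Q.bimodule_axioms
        intro: r.P_Y.additive_lift r.P_Y.lift_pure abelian_groups f_balanced)
qed

lemma P_hom_iso: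
  "(\<lambda>x\<in>carrier P. \<lambda>z\<in>carrier Q. g z x)
    \<in> bimodule_iso K P (left_hom_bimodule S Q (ring_bimodule S id id)) S"
proof -
  interpret r: reconstruction K S P Q f g I p q P "ring_bimodule S id id" g "rsmult P"
    by (rule reconstruct_P)
  show ?thesis
    by (rule r.hom_bimodule_iso) (auto simp: P.bimodule_axioms ring_bimodule_simps g_right)
qed

text \<open>Acting by c and then by c' on the right is acting by the product c c', while composition
  of functions reverses this order; hence \<open>opposite_ring\<close>.\<close>

lemma left_End_iso:
  "(\<lambda>c. \<lambda>z\<in>carrier Q. z \<bullet>\<^bsub>Q\<^esub> c) \<in> ring_iso K (opposite_ring (end_ring Q (left_hom S Q Q)))"
proof -
  interpret r: reconstruction K S P Q f g I p q "ring_bimodule K id id" Q "rsmult Q" f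
    by (rule reconstruct_K)
  have "bij_betw (\<lambda>c. \<lambda>z\<in>carrier Q. z \<bullet>\<^bsub>Q\<^esub> c) (carrier K) (left_hom S Q Q)"
    using r.hom_bij by (simp add: ring_bimodule_simps)
  then show ?thesis
    unfolding ring_iso_def ring_hom_def
    using r.hom_closed
    by (auto simp: opposite_ring_def end_ring_def ring_bimodule_simps compose_def closed
        Q.rsmult_assoc Q.rsmult_r_distr Q.rsmult_one intro!: restrict_ext)
qed

text \<open>These are right linear maps on \<open>P\<close>, which \<open>hom_bij\<close> does not
  cover. An endomorphism h is recovered from its values at the p_i as left multiplication by the sum
  of the f(h(p_i), q_i).\<close>

lemma right_End_iso:
  "(\<lambda>c. \<lambda>x\<in>carrier P. c \<odot>\<^bsub>P\<^esub> x) \<in> ring_iso K (end_ring P (right_hom P P S))"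
proof -
  let ?r = "\<lambda>c. \<lambda>x\<in>carrier P. c \<odot>\<^bsub>P\<^esub> x"
  have cl: "?r c \<in> right_hom P P S" if "c \<in> carrier K" for c
    by (rule restrict_right_hom[OF P_right left_module_simps(4)[OF P_left that]])
      (simp add: that P.smult_rsmult_assoc)
  have hc: "h x \<in> carrier P" if "h \<in> right_hom P P S" "x \<in> carrier P" for h x
    using that additive_closed[of P P h] by (simp add: right_hom_iff)
  have bij: "bij_betw ?r (carrier K) (right_hom P P S)"
  proof (rule bij_betwI[where g = "\<lambda>h. \<Oplus>\<^bsub>K\<^esub>i\<in>I. f (h (p i)) (q i)"])
    show "?r \<in> carrier K \<rightarrow> right_hom P P S" using cl by auto
    show "(\<lambda>h. \<Oplus>\<^bsub>K\<^esub>i\<in>I. f (h (p i)) (q i)) \<in> right_hom P P S \<rightarrow> carrier K"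
      by (intro funcsetI abelian_group_finsum_closed abelian_groups) (auto simp: closed pq_closed hc)
    fix c assume c: "c \<in> carrier K"
    have "(\<Oplus>\<^bsub>K\<^esub>i\<in>I. f (?r c (p i)) (q i)) = (\<Oplus>\<^bsub>K\<^esub>i\<in>I. c \<otimes>\<^bsub>K\<^esub> f (p i) (q i))"
      using c by (intro abelian_group_finsum_cong abelian_groups) (auto simp: closed pq_closed f_left)
    also have "\<dots> = c \<otimes>\<^bsub>K\<^esub> \<one>\<^bsub>K\<^esub>"
      using left_module_simps(4)[OF bimodule_left[OF regular_K] c]
      by (intro additive_unit abelian_groups) (simp add: additive_def ring_bimodule_simps Pi_iff)
    finally show "(\<Oplus>\<^bsub>K\<^esub>i\<in>I. f (?r c (p i)) (q i)) = c"
      using c by (simp add: monoid.r_one[OF ring.is_monoid[OF rings(1)]])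
  next
    fix h assume h: "h \<in> right_hom P P S"
    have "(\<Oplus>\<^bsub>K\<^esub>i\<in>I. f (h (p i)) (q i)) \<odot>\<^bsub>P\<^esub> x = h x" if x: "x \<in> carrier P" for x
    proof -
      have "(\<Oplus>\<^bsub>K\<^esub>i\<in>I. f (h (p i)) (q i)) \<odot>\<^bsub>P\<^esub> x = (\<Oplus>\<^bsub>P\<^esub>i\<in>I. f (h (p i)) (q i) \<odot>\<^bsub>P\<^esub> x)"
        by (rule additive_finsum[OF abelian_groups(3,1) left_module_simps(5)[OF P_left x] finite_I])
          (auto simp: closed pq_closed hc h)
      also have "\<dots> = (\<Oplus>\<^bsub>P\<^esub>i\<in>I. h (p i \<bullet>\<^bsub>P\<^esub> g (q i) x))"
        using x h by (intro P.X.finsum_cong') (auto simp: closed pq_closed hc f_assoc right_hom_iff)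
      also have "\<dots> = h (\<Oplus>\<^bsub>P\<^esub>i\<in>I. p i \<bullet>\<^bsub>P\<^esub> g (q i) x)"
        by (rule additive_finsum[symmetric, OF abelian_groups(1,1) _ finite_I])
          (use x h in \<open>auto simp: closed pq_closed right_hom_iff\<close>)
      finally show ?thesis by (simp add: P_expand x)
    qed
    then show "?r (\<Oplus>\<^bsub>K\<^esub>i\<in>I. f (h (p i)) (q i)) = h"
      using h by (intro extensionalityI[of _ "carrier P"]) (auto simp: right_hom_iff)
  qed
  then show ?thesis
    unfolding ring_iso_def ring_hom_def using cl
    by (auto simp: end_ring_def compose_def closed
        P.lsmult_assoc P.lsmult_l_distr P.lsmult_one intro!: restrict_ext)
qed

text \<open>The reconstruction with T = X an arbitrary left module and Y its tensor product with
  \<open>Q\<close>: \<open>k\<close> is the pure tensor map and \<open>b\<close> is y, z (x) x |->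
  f(y, z) x. Naturality holds because this formula involves X only through its module
  operations.\<close>

lemma roundtrip: "tensor_roundtrip_iso K S P Q TYPE('x)"
proof -
  define \<beta> where "\<beta> X y = tensor_lift X (\<lambda>z x. f y z \<odot>\<^bsub>X\<^esub> x)"
    for X :: "('a, 'x, unit) bimodule" and y
  \<comment> \<open>The restriction supplies the extensionality that membership in
    \<open>left_hom\<close> demands.\<close>
  define \<eta> where "\<eta> X = restrict (tensor_lift X (\<beta> X)) (carrier (tensor P S (tensor Q K X)))"
    for X :: "('a, 'x, unit) bimodule"
  have bal: "balanced Q K X X (\<lambda>z x. f y z \<odot>\<^bsub>X\<^esub> x)" if "left_module K X" "y \<in> carrier P"
    for X :: "('a, 'x, unit) bimodule" and y
  proof -
    note X = left_module_simps[OF that(1)]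
    show ?thesis
      by (rule balancedI)
        (use that in \<open>simp_all add: X(3) closed balancedD(3)[OF f_balanced] additive_add[OF X(4)]
          additive_add[OF X(5)] f_right left_module.lsmult_assoc[OF that(1)]\<close>)
  qed
  have \<beta>: "additive (tensor Q K X) X (\<beta> X y)"
    "\<And>z x. z \<in> carrier Q \<Longrightarrow> x \<in> carrier X \<Longrightarrow> \<beta> X y (pure_tensor Q K X z x) = f y z \<odot>\<^bsub>X\<^esub> x"
    if "left_module K X" "y \<in> carrier P" for X :: "('a, 'x, unit) bimodule" and y
  proof -
    interpret t: tensor_product Q K X using that by (simp add: tensor_product_iff Q_right)
    show "additive (tensor Q K X) X (\<beta> X y)"
      unfolding \<beta>_def by (rule t.additive_lift[OF left_module_simps(2)[OF that(1)] bal[OF that]])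
    show "\<beta> X y (pure_tensor Q K X z x) = f y z \<odot>\<^bsub>X\<^esub> x" if "z \<in> carrier Q" "x \<in> carrier X" for z x
      unfolding \<beta>_def
      by (rule t.lift_pure[OF left_module_simps(2)[OF \<open>left_module K X\<close>] bal that]) fact+
  qed
  have rec: "reconstruction K S P Q f g I p q X (tensor Q K X) (pure_tensor Q K X) (\<beta> X)"
    if X: "left_module K X" for X :: "('a, 'x, unit) bimodule"
  proof -
    interpret t: tensor_product Q K X using that by (simp add: tensor_product_iff Q_right)
    note X' = left_module_simps[OF X]
    note sm = tensor_smult_pure[OF Q.bimodule_axioms X]
    have \<beta>_left: "\<beta> X (c \<odot>\<^bsub>P\<^esub> y) u = c \<odot>\<^bsub>X\<^esub> \<beta> X y u"
      if "c \<in> carrier K" "y \<in> carrier P" "u \<in> carrier (tensor Q K X)" for c y u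
      by (rule t.additive_eqI[OF \<beta>(1)[OF X] additive_comp[OF \<beta>(1)[OF X] X'(4)] _ that(3)])
        (use that in \<open>simp_all add: \<beta>(2)[OF X] closed f_left left_module.lsmult_assoc[OF X]\<close>)
    have \<beta>_add: "\<beta> X (y \<oplus>\<^bsub>P\<^esub> y') u = \<beta> X y u \<oplus>\<^bsub>X\<^esub> \<beta> X y' u"
      if "y \<in> carrier P" "y' \<in> carrier P" "u \<in> carrier (tensor Q K X)" for y y' u
      by (rule t.additive_eqI[OF \<beta>(1)[OF X] additive_plus[OF X'(2) \<beta>(1)[OF X] \<beta>(1)[OF X]] _ that(3)])
        (use that in \<open>simp_all add: \<beta>(2)[OF X] closed balancedD(2)[OF f_balanced] additive_add[OF X'(5)]\<close>)
    have \<beta>_bal: "\<beta> X (y \<bullet>\<^bsub>P\<^esub> s) u = \<beta> X y (s \<odot>\<^bsub>tensor Q K X\<^esub> u)"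
      if "s \<in> carrier S" "y \<in> carrier P" "u \<in> carrier (tensor Q K X)" for s y u
      by (rule t.additive_eqI[OF \<beta>(1)[OF X] additive_comp[OF sm(1) \<beta>(1)[OF X]] _ that(3)])
        (use that in \<open>simp_all add: \<beta>(2)[OF X] sm(2) closed balancedD(4)[OF f_balanced]\<close>)
    show ?thesis
    proof (intro reconstruction.intro reconstruction_axioms.intro dual_bases_axioms X
        left_module_tensor Q.bimodule_axioms t.balanced_pure \<beta>_left)
      show "balanced P S (tensor Q K X) X (\<beta> X)"
        by (rule balancedI) (simp_all add: \<beta>_add \<beta>_bal additive_closed[OF \<beta>(1)[OF X]] additive_add[OF \<beta>(1)[OF X]])
      \<comment> \<open>On a pure tensor z' (x) x' this reads z (x) f(x, z') x' = z f(x, z') (x) x'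
        = g(z, x) z' (x) x', by balancing and \<open>g_assoc\<close>.\<close>
      show "pure_tensor Q K X z (\<beta> X x u) = g z x \<odot>\<^bsub>tensor Q K X\<^esub> u"
        if "z \<in> carrier Q" "x \<in> carrier P" "u \<in> carrier (tensor Q K X)" for z x u
        by (rule t.additive_eqI[OF additive_comp[OF \<beta>(1)[OF X] balancedD(6)[OF t.balanced_pure]] sm(1) _ that(3)])
          (use that in \<open>simp_all add: \<beta>(2)[OF X] sm(2) closed g_assoc t.pure_balanced\<close>)
    qed (simp_all add: sm(2) \<beta>(2)[OF X])
  qed
  have \<eta>: "additive (tensor P S (tensor Q K X)) X (\<eta> X)"
    "\<And>y u. y \<in> carrier P \<Longrightarrow> u \<in> carrier (tensor Q K X) \<Longrightarrow>
      \<eta> X (pure_tensor P S (tensor Q K X) y u) = \<beta> X y u"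
    if "left_module K X" for X :: "('a, 'x, unit) bimodule"
  proof -
    interpret r: reconstruction K S P Q f g I p q X "tensor Q K X" "pure_tensor Q K X" "\<beta> X"
      by (rule rec[OF that])
    show "additive (tensor P S (tensor Q K X)) X (\<eta> X)"
      unfolding \<eta>_def using r.P_Y.additive_lift[OF r.T_simps(2) r.b_balanced]
      by (simp add: additive_restrict_iff r.P_Y.abelian_group_tensor)
    show "\<eta> X (pure_tensor P S (tensor Q K X) y u) = \<beta> X y u"
      if "y \<in> carrier P" "u \<in> carrier (tensor Q K X)" for y u
      unfolding \<eta>_def using r.P_Y.lift_pure[OF r.T_simps(2) r.b_balanced that] r.P_Y.pure_closed[OF that]
      by simp
  qed
  show ?thesis
    unfolding tensor_roundtrip_iso_def
  proof (intro exI[of _ \<eta>] conjI allI impI ballI)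
    fix X :: "('a, 'x, unit) bimodule" assume X: "left_module K X"
    interpret r: reconstruction K S P Q f g I p q X "tensor Q K X" "pure_tensor Q K X" "\<beta> X"
      by (rule rec[OF X])
    show "left_module S (tensor Q K X)" by (rule r.Y)
    show "left_module K (tensor P S (tensor Q K X))" by (rule left_module_tensor[OF P.bimodule_axioms r.Y])
    show "bij_betw (\<eta> X) (carrier (tensor P S (tensor Q K X))) (carrier X)"
      by (rule r.tensor_bij[OF \<eta>[OF X]])
    show "\<eta> X \<in> left_hom K (tensor P S (tensor Q K X)) X"
      by (simp add: left_hom_iff \<eta>[OF X] r.tensor_left[OF \<eta>[OF X]]) (simp add: \<eta>_def)
  next
    fix X Y :: "('a, 'x, unit) bimodule" and h t
    assume "left_module K X \<and> left_module K Y \<and> h \<in> left_hom K X Y"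
      and t: "t \<in> carrier (tensor P S (tensor Q K X))"
    then have X: "left_module K X" and Y: "left_module K Y" and h: "additive X Y h"
      "\<And>c x. c \<in> carrier K \<Longrightarrow> x \<in> carrier X \<Longrightarrow> h (c \<odot>\<^bsub>X\<^esub> x) = c \<odot>\<^bsub>Y\<^esub> h x"
      by (auto simp: left_hom_iff)
    interpret r: reconstruction K S P Q f g I p q X "tensor Q K X" "pure_tensor Q K X" "\<beta> X"
      by (rule rec[OF X])
    interpret tX: tensor_product Q K X using X by (simp add: tensor_product_iff Q_right)
    have idQ: "additive Q Q id" "additive P P id" by (simp_all add: additive_def)
    note SX = left_module_tensor[OF Q.bimodule_axioms X] and SY = left_module_tensor[OF Q.bimodule_axioms Y]
    note smX = tensor_smult_pure[OF Q.bimodule_axioms X] and smY = tensor_smult_pure[OF Q.bimodule_axioms Y]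
    \<comment> \<open>The functor image of \<open>h\<close> under tensoring with \<open>Q\<close>.
      Its \<open>S\<close>-linearity must be known before tensoring again, since
      \<open>tensor_map_pure\<close> needs it for the map \<open>W\<close> below.\<close>
    define w where "w = tensor_map Q K X Q Y id h"
    have w: "additive (tensor Q K X) (tensor Q K Y) w"
      "\<And>z x. z \<in> carrier Q \<Longrightarrow> x \<in> carrier X \<Longrightarrow> w (pure_tensor Q K X z x) = pure_tensor Q K Y z (h x)"
      using tensor_map_pure[OF Q_right X Q_right Y idQ(1) _ h] by (simp_all add: w_def)
    have w_left: "w (s \<odot>\<^bsub>tensor Q K X\<^esub> u) = s \<odot>\<^bsub>tensor Q K Y\<^esub> w u"
      if "s \<in> carrier S" "u \<in> carrier (tensor Q K X)" for s u
      by (rule tX.additive_eqI[OF additive_comp[OF smX(1) w(1)] additive_comp[OF w(1) smY(1)] _ that(2)])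
        (use that in \<open>simp_all add: smX(2) smY(2) w(2) closed additive_closed[OF h(1)]\<close>)
    define W where "W = tensor_map P S (tensor Q K X) P (tensor Q K Y) id w"
    have W: "additive (tensor P S (tensor Q K X)) (tensor P S (tensor Q K Y)) W"
      "\<And>y u. y \<in> carrier P \<Longrightarrow> u \<in> carrier (tensor Q K X) \<Longrightarrow>
        W (pure_tensor P S (tensor Q K X) y u) = pure_tensor P S (tensor Q K Y) y (w u)"
      using tensor_map_pure[OF P_right SX P_right SY idQ(2) _ w(1) w_left] by (simp_all add: W_def)
    \<comment> \<open>Naturality one level down; it leaves only pure tensors of the outer product to
      be checked.\<close>
    have \<beta>_h: "\<beta> Y y (w u) = h (\<beta> X y u)" if "y \<in> carrier P" "u \<in> carrier (tensor Q K X)" for y u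
      by (rule tX.additive_eqI[OF additive_comp[OF w(1) \<beta>(1)[OF Y]] additive_comp[OF \<beta>(1)[OF X] h(1)] _ that(2)])
        (use that in \<open>simp_all add: w(2) \<beta>(2)[OF X] \<beta>(2)[OF Y] h(2) closed additive_closed[OF h(1)]\<close>)
    show "\<eta> Y (W t) = h (\<eta> X t)"
      by (rule r.P_Y.additive_eqI[OF additive_comp[OF W(1) \<eta>(1)[OF Y]] additive_comp[OF \<eta>(1)[OF X] h(1)] _ t])
        (simp_all add: W(2) \<eta>(2)[OF X] \<eta>(2)[OF Y] \<beta>_h additive_closed[OF w(1)])
  qed
qed

end

text \<open>Both units are hit. The first family makes \<open>P\<close> and \<open>Q\<close>
  finitely generated projective over \<open>S\<close>; the second, with the roles exchanged, makes
  them generators over \<open>S\<close> and provides the other roundtrip.\<close>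

locale morita_dual_bases = dual_bases K S P Q f g I p q + op: dual_bases S K Q P g f J q' p'
  for K :: "('a, 'k) ring_scheme" and S :: "('s, 'l) ring_scheme"
    and P :: "('a, 'p, 's) bimodule" and Q :: "('s, 'q, 'a) bimodule"
    and f :: "'p \<Rightarrow> 'q \<Rightarrow> 'a" and g :: "'q \<Rightarrow> 'p \<Rightarrow> 's" and I p q J q' p'
begin

lemma morita_equivalence: "morita_equivalence K S P Q TYPE('x)"
  unfolding morita_equivalence_def
  by (simp add: rings P.bimodule_axioms Q.bimodule_axioms roundtrip op.roundtrip)

lemma right_progenerator: "right_progenerator P S TYPE('x \<times> 'y)"
  unfolding right_progenerator_def
  by (simp add: P_right right_fin_gen right_projective op.right_generator)

lemma left_progenerator: "left_progenerator S Q TYPE('x \<times> 'y)"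
  unfolding left_progenerator_def
  by (simp add: Q_left left_fin_gen left_projective op.left_generator)

lemma invertible_morita_context:
  "invertible_morita_context K S P Q (restrict (tensor_lift K f) (carrier (tensor P S Q)))
    (restrict (tensor_lift S g) (carrier (tensor Q K P)))"
proof -
  interpret PQ: tensor_product P S Q by (simp add: tensor_product_iff P_right Q_left)
  interpret QP: tensor_product Q K P by (simp add: tensor_product_iff Q_right P_left)
  show ?thesis
    using pairing_iso op.pairing_iso
    by (simp add: invertible_morita_context_def morita_context_def rings P.bimodule_axioms
        Q.bimodule_axioms bimodule_iso_def PQ.pure_closed QP.pure_closed
        PQ.lift_pure[OF abelian_groups(3) f_balanced] QP.lift_pure[OF abelian_groups(4) g_balanced]
        ring_bimodule_simps f_assoc g_assoc)
qed

end

section \<open>Endomorphism rings and direct summands\<close>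

lemma additive_minus:
  assumes "abelian_group X" "abelian_group Y" "additive X Y f" "x \<in> carrier X"
  shows "f (\<ominus>\<^bsub>X\<^esub> x) = \<ominus>\<^bsub>Y\<^esub> f x"
proof -
  interpret X: abelian_group X by fact
  interpret Y: abelian_group Y by fact
  have "f (\<ominus>\<^bsub>X\<^esub> x) \<oplus>\<^bsub>Y\<^esub> f x = \<zero>\<^bsub>Y\<^esub>"
    using additive_add[OF assms(3), of "\<ominus>\<^bsub>X\<^esub> x" x] assms(4) additive_zero[OF assms(1-3)]
    by (simp add: X.l_neg)
  then show ?thesis
    using assms(4) additive_closed[OF assms(3)] by (simp add: Y.minus_equality)
qed

text \<open>Gives the ring \<open>C\<close>, and also the additive group underlying \<open>A\<close>
  when \<open>M\<close> is taken as an N-N-bimodule.\<close>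

lemma ring_end_ring:
  assumes "bimodule R X S"
  shows "ring (end_ring X (bimodule_hom R X X S))" (is "ring ?E")
proof -
  note l = left_module_simps[OF bimodule_left[OF assms]]
    and r = right_module_simps[OF bimodule_right[OF assms]]
  interpret X: abelian_group X by (rule l(2))
  let ?H = "bimodule_hom R X X S"
  have sm: "\<zero>\<^bsub>X\<^esub> = a \<odot>\<^bsub>X\<^esub> \<zero>\<^bsub>X\<^esub>" "a \<odot>\<^bsub>X\<^esub> (\<ominus>\<^bsub>X\<^esub> x) = \<ominus>\<^bsub>X\<^esub> (a \<odot>\<^bsub>X\<^esub> x)"
    "a \<odot>\<^bsub>X\<^esub> (x \<oplus>\<^bsub>X\<^esub> y) = a \<odot>\<^bsub>X\<^esub> x \<oplus>\<^bsub>X\<^esub> a \<odot>\<^bsub>X\<^esub> y"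
    if "a \<in> carrier R" "x \<in> carrier X" "y \<in> carrier X" for a x y
    using additive_zero[OF l(2) l(2) l(4)] additive_minus[OF l(2) l(2) l(4)] additive_add[OF l(4)] that
    by auto
  have rm: "\<zero>\<^bsub>X\<^esub> = \<zero>\<^bsub>X\<^esub> \<bullet>\<^bsub>X\<^esub> a" "(\<ominus>\<^bsub>X\<^esub> x) \<bullet>\<^bsub>X\<^esub> a = \<ominus>\<^bsub>X\<^esub> (x \<bullet>\<^bsub>X\<^esub> a)"
    "(x \<oplus>\<^bsub>X\<^esub> y) \<bullet>\<^bsub>X\<^esub> a = x \<bullet>\<^bsub>X\<^esub> a \<oplus>\<^bsub>X\<^esub> y \<bullet>\<^bsub>X\<^esub> a"
    if "a \<in> carrier S" "x \<in> carrier X" "y \<in> carrier X" for a x y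
    using additive_zero[OF l(2) l(2) r(4)] additive_minus[OF l(2) l(2) r(4)] additive_add[OF r(4)] that
    by auto
  have H: "h x \<in> carrier X" "h (x \<oplus>\<^bsub>X\<^esub> y) = h x \<oplus>\<^bsub>X\<^esub> h y" "h \<in> extensional (carrier X)"
    "a \<in> carrier R \<Longrightarrow> h (a \<odot>\<^bsub>X\<^esub> x) = a \<odot>\<^bsub>X\<^esub> h x" "b \<in> carrier S \<Longrightarrow> h (x \<bullet>\<^bsub>X\<^esub> b) = h x \<bullet>\<^bsub>X\<^esub> b"
    if "h \<in> ?H" "x \<in> carrier X" "y \<in> carrier X" for h x y a b
    using that additive_closed[of X X h] additive_add[of X X h] by (auto simp: bimodule_hom_iff)
  have HI: "restrict h (carrier X) \<in> ?H"
    if "\<And>x. x \<in> carrier X \<Longrightarrow> h x \<in> carrier X"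
      "\<And>x y. x \<in> carrier X \<Longrightarrow> y \<in> carrier X \<Longrightarrow> h (x \<oplus>\<^bsub>X\<^esub> y) = h x \<oplus>\<^bsub>X\<^esub> h y"
      "\<And>a x. a \<in> carrier R \<Longrightarrow> x \<in> carrier X \<Longrightarrow> h (a \<odot>\<^bsub>X\<^esub> x) = a \<odot>\<^bsub>X\<^esub> h x"
      "\<And>b x. b \<in> carrier S \<Longrightarrow> x \<in> carrier X \<Longrightarrow> h (x \<bullet>\<^bsub>X\<^esub> b) = h x \<bullet>\<^bsub>X\<^esub> b" for h
    using that l(3) r(3) by (simp add: bimodule_hom_iff additive_def)
  have ext: "h = h'" if "h \<in> extensional (carrier X)" "h' \<in> extensional (carrier X)"
    "\<And>x. x \<in> carrier X \<Longrightarrow> h x = h' x" for h h'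
    using that by (rule extensionalityI)
  have H_ext: "h \<in> extensional (carrier X)" if "h \<in> ?H" for h
    using that by (simp add: bimodule_hom_iff)
  have add: "h \<oplus>\<^bsub>?E\<^esub> h' \<in> ?H" if "h \<in> ?H" "h' \<in> ?H" for h h'
    unfolding end_ring_def ring.simps
    by (rule HI) (simp_all add: H that sm rm l(3) r(3) X.a_ac)
  have mult: "h \<otimes>\<^bsub>?E\<^esub> h' \<in> ?H" if "h \<in> ?H" "h' \<in> ?H" for h h'
    unfolding end_ring_def monoid.simps compose_def
    by (rule HI) (simp_all add: H that)
  have one: "\<one>\<^bsub>?E\<^esub> \<in> ?H" and zero: "\<zero>\<^bsub>?E\<^esub> \<in> ?H"
    unfolding end_ring_def monoid.simps ring.simps
    by (rule HI; simp add: sm(1)[symmetric] rm(1)[symmetric])+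
  have neg: "(\<lambda>x\<in>carrier X. \<ominus>\<^bsub>X\<^esub> h x) \<in> ?H" if "h \<in> ?H" for h
    by (rule HI) (simp_all add: H that sm rm X.minus_add)
  have car: "carrier ?E = ?H" by (simp add: end_ring_def)
  have "abelian_group ?E"
  proof (rule abelian_groupI; unfold car)
    fix h assume h: "h \<in> ?H"
    show "\<exists>y\<in>?H. y \<oplus>\<^bsub>?E\<^esub> h = \<zero>\<^bsub>?E\<^esub>"
      by (rule bexI[OF _ neg[OF h]]) (auto simp: end_ring_def H h X.l_neg intro!: restrict_ext)
  qed (auto simp: add zero, auto simp: end_ring_def H H_ext X.a_ac intro!: ext)
  moreover have "monoid ?E"
    by (rule monoidI; unfold car)
      (auto simp: mult one, auto simp: end_ring_def H H_ext compose_def intro!: ext)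
  ultimately show ?thesis
    by (intro ringI; (unfold car)?)
      (auto simp: end_ring_def H compose_def intro!: restrict_ext)
qed

text \<open>\<open>\<rho>\<close> is the projection onto U along V followed by the inverse of
  \<open>\<theta>\<close>. It respects all operations because both U and V are subbimodules.\<close>

lemma direct_summand_retraction:
  assumes X: "bimodule R X S" and Y: "bimodule R Y S" and "iso_to_direct_summand R X Y S"
  obtains \<theta> \<rho> where "\<theta> \<in> bimodule_hom R X Y S" "\<rho> \<in> bimodule_hom R Y X S"
    "\<And>x. x \<in> carrier X \<Longrightarrow> \<rho> (\<theta> x) = x"
proof -
  obtain U V \<theta> where U: "subbimodule R U Y S" and V: "subbimodule R V Y S"
    and UV: "U <+>\<^bsub>Y\<^esub> V = carrier Y" "U \<inter> V = {\<zero>\<^bsub>Y\<^esub>}"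
    and \<theta>: "\<theta> \<in> bimodule_iso R X (Y\<lparr>carrier := U\<rparr>) S"
    using assms(3) by (auto simp: iso_to_direct_summand_def)
  note Xl = left_module_simps[OF bimodule_left[OF X]] and Xr = right_module_simps[OF bimodule_right[OF X]]
  note Yl = left_module_simps[OF bimodule_left[OF Y]] and Yr = right_module_simps[OF bimodule_right[OF Y]]
  interpret XG: abelian_group X by (rule Xl(2))
  interpret YG: abelian_group Y by (rule Yl(2))
  have sub: "W \<subseteq> carrier Y" "\<And>x y. x \<in> W \<Longrightarrow> y \<in> W \<Longrightarrow> x \<oplus>\<^bsub>Y\<^esub> y \<in> W"
    "\<And>x. x \<in> W \<Longrightarrow> \<ominus>\<^bsub>Y\<^esub> x \<in> W"
    "\<And>a x. a \<in> carrier R \<Longrightarrow> x \<in> W \<Longrightarrow> a \<odot>\<^bsub>Y\<^esub> x \<in> W"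
    "\<And>a x. a \<in> carrier S \<Longrightarrow> x \<in> W \<Longrightarrow> x \<bullet>\<^bsub>Y\<^esub> a \<in> W" if "subbimodule R W Y S" for W
    using that subgroup.subset[of W "add_monoid Y"] subgroup.m_closed[of W "add_monoid Y"]
      subgroup.m_inv_closed[of W "add_monoid Y"]
    by (auto simp: subbimodule_def a_inv_def)
  have \<theta>': "additive X Y \<theta>" "\<theta> \<in> extensional (carrier X)" "bij_betw \<theta> (carrier X) U"
    "\<And>a x. a \<in> carrier R \<Longrightarrow> x \<in> carrier X \<Longrightarrow> \<theta> (a \<odot>\<^bsub>X\<^esub> x) = a \<odot>\<^bsub>Y\<^esub> \<theta> x"
    "\<And>a x. a \<in> carrier S \<Longrightarrow> x \<in> carrier X \<Longrightarrow> \<theta> (x \<bullet>\<^bsub>X\<^esub> a) = \<theta> x \<bullet>\<^bsub>Y\<^esub> a"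
    using \<theta> sub(1)[OF U] by (auto simp: bimodule_iso_def bimodule_hom_iff additive_def)
  have ex: "\<exists>x v. x \<in> carrier X \<and> v \<in> V \<and> y = \<theta> x \<oplus>\<^bsub>Y\<^esub> v" if "y \<in> carrier Y" for y
  proof -
    have "y \<in> U <+>\<^bsub>Y\<^esub> V" using that UV(1) by simp
    then show ?thesis using \<theta>'(3) by (auto simp: set_add_def set_mult_def bij_betw_def)
  qed
  \<comment> \<open>Two decompositions of one element differ by something in both U and V, hence by
    zero.\<close>
  have uniq: "x = x'" if "x \<in> carrier X" "x' \<in> carrier X" "v \<in> V" "v' \<in> V"
    "\<theta> x \<oplus>\<^bsub>Y\<^esub> v = \<theta> x' \<oplus>\<^bsub>Y\<^esub> v'" for x x' v v'
  proof -
    have cl: "\<theta> x \<in> U" "\<theta> x' \<in> U" "\<theta> x \<in> carrier Y" "\<theta> x' \<in> carrier Y" "v \<in> carrier Y" "v' \<in> carrier Y"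
      using that \<theta>'(3) sub(1)[OF U] sub(1)[OF V] by (auto simp: bij_betw_def)
    have "\<theta> x \<ominus>\<^bsub>Y\<^esub> \<theta> x' = (\<theta> x \<oplus>\<^bsub>Y\<^esub> v) \<oplus>\<^bsub>Y\<^esub> (\<ominus>\<^bsub>Y\<^esub> v \<ominus>\<^bsub>Y\<^esub> \<theta> x')"
      using cl by (simp add: a_minus_def YG.a_assoc YG.r_neg1 YG.r_neg2)
    also have "\<dots> = v' \<ominus>\<^bsub>Y\<^esub> v"
      unfolding that(5) a_minus_def using cl
      by (simp add: YG.a_assoc YG.a_lcomm[of "\<theta> x'"] YG.r_neg)
    finally have "\<theta> x \<ominus>\<^bsub>Y\<^esub> \<theta> x' = v' \<ominus>\<^bsub>Y\<^esub> v" .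
    moreover have "\<theta> x \<ominus>\<^bsub>Y\<^esub> \<theta> x' \<in> U" "v' \<ominus>\<^bsub>Y\<^esub> v \<in> V"
      using cl that sub(2,3)[OF U] sub(2,3)[OF V] by (simp_all add: a_minus_def)
    ultimately have "\<theta> x \<ominus>\<^bsub>Y\<^esub> \<theta> x' = \<zero>\<^bsub>Y\<^esub>" using UV(2) by auto
    then have "\<theta> x = \<theta> x'" using cl YG.add.inv_solve_right'[of "\<zero>\<^bsub>Y\<^esub>" "\<theta> x" "\<theta> x'"] by (simp add: a_minus_def)
    then show ?thesis using that \<theta>'(3) by (auto simp: bij_betw_def inj_on_def)
  qed
  define r where "r y = (SOME x. x \<in> carrier X \<and> (\<exists>v\<in>V. y = \<theta> x \<oplus>\<^bsub>Y\<^esub> v))" for y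
  have r: "r y \<in> carrier X \<and> (\<exists>v\<in>V. y = \<theta> (r y) \<oplus>\<^bsub>Y\<^esub> v)" if "y \<in> carrier Y" for y
    unfolding r_def by (rule someI_ex) (use ex[OF that] in blast)
  \<comment> \<open>\<open>r\<close> can be read off from any decomposition, not just the chosen
    one; each law for \<open>r\<close> below is proved by exhibiting a decomposition of the new
    element.\<close>
  have r_eq: "r (\<theta> x \<oplus>\<^bsub>Y\<^esub> v) = x" if "x \<in> carrier X" "v \<in> V" for x v
  proof -
    have "\<theta> x \<oplus>\<^bsub>Y\<^esub> v \<in> carrier Y" using that sub(1)[OF V] additive_closed[OF \<theta>'(1)] by (simp add: subset_iff)
    then show ?thesis using r[of "\<theta> x \<oplus>\<^bsub>Y\<^esub> v"] uniq that by metis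
  qed
  have \<theta>_cl: "\<theta> x \<in> carrier Y" if "x \<in> carrier X" for x using that by (rule additive_closed[OF \<theta>'(1)])
  have r\<theta>: "r (\<theta> x) = x" if "x \<in> carrier X" for x
  proof -
    have "\<zero>\<^bsub>Y\<^esub> \<in> V" using UV(2) by auto
    then show ?thesis using r_eq[OF that, of "\<zero>\<^bsub>Y\<^esub>"] \<theta>_cl[OF that] by simp
  qed
  have "restrict r (carrier Y) \<in> bimodule_hom R Y X S"
  proof -
    have add: "r (y \<oplus>\<^bsub>Y\<^esub> y') = r y \<oplus>\<^bsub>X\<^esub> r y'" if "y \<in> carrier Y" "y' \<in> carrier Y" for y y'
    proof -
      obtain v v' where v: "v \<in> V" "v' \<in> V" "y = \<theta> (r y) \<oplus>\<^bsub>Y\<^esub> v" "y' = \<theta> (r y') \<oplus>\<^bsub>Y\<^esub> v'"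
        and x: "r y \<in> carrier X" "r y' \<in> carrier X" using r[OF \<open>y \<in> carrier Y\<close>] r[OF \<open>y' \<in> carrier Y\<close>] by blast
      have "y \<oplus>\<^bsub>Y\<^esub> y' = (\<theta> (r y) \<oplus>\<^bsub>Y\<^esub> v) \<oplus>\<^bsub>Y\<^esub> (\<theta> (r y') \<oplus>\<^bsub>Y\<^esub> v')" by (rule arg_cong2[OF v(3,4)])
      also have "\<dots> = \<theta> (r y \<oplus>\<^bsub>X\<^esub> r y') \<oplus>\<^bsub>Y\<^esub> (v \<oplus>\<^bsub>Y\<^esub> v')"
        using v(1,2) x sub(1)[OF V] by (simp add: additive_add[OF \<theta>'(1)] \<theta>_cl YG.a_ac subset_iff)
      finally show ?thesis using r_eq[of "r y \<oplus>\<^bsub>X\<^esub> r y'" "v \<oplus>\<^bsub>Y\<^esub> v'"] x v(1,2) sub(2)[OF V] by simp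
    qed
    have left: "r (a \<odot>\<^bsub>Y\<^esub> y) = a \<odot>\<^bsub>X\<^esub> r y" if "a \<in> carrier R" "y \<in> carrier Y" for a y
    proof -
      obtain v where v: "v \<in> V" "y = \<theta> (r y) \<oplus>\<^bsub>Y\<^esub> v" and x: "r y \<in> carrier X" using r[OF \<open>y \<in> carrier Y\<close>] by blast
      have "a \<odot>\<^bsub>Y\<^esub> y = a \<odot>\<^bsub>Y\<^esub> (\<theta> (r y) \<oplus>\<^bsub>Y\<^esub> v)" by (rule arg_cong[OF v(2)])
      also have "\<dots> = \<theta> (a \<odot>\<^bsub>X\<^esub> r y) \<oplus>\<^bsub>Y\<^esub> a \<odot>\<^bsub>Y\<^esub> v"
        using v(1) x that sub(1)[OF V] by (simp add: additive_add[OF Yl(4)] \<theta>_cl \<theta>'(4) subset_iff)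
      finally show ?thesis using r_eq[of "a \<odot>\<^bsub>X\<^esub> r y" "a \<odot>\<^bsub>Y\<^esub> v"] x v(1) sub(4)[OF V] that Xl(3) by simp
    qed
    have right: "r (y \<bullet>\<^bsub>Y\<^esub> a) = r y \<bullet>\<^bsub>X\<^esub> a" if "a \<in> carrier S" "y \<in> carrier Y" for a y
    proof -
      obtain v where v: "v \<in> V" "y = \<theta> (r y) \<oplus>\<^bsub>Y\<^esub> v" and x: "r y \<in> carrier X" using r[OF \<open>y \<in> carrier Y\<close>] by blast
      have "y \<bullet>\<^bsub>Y\<^esub> a = (\<theta> (r y) \<oplus>\<^bsub>Y\<^esub> v) \<bullet>\<^bsub>Y\<^esub> a" by (rule arg_cong[where f = "\<lambda>y. y \<bullet>\<^bsub>Y\<^esub> a", OF v(2)])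
      also have "\<dots> = \<theta> (r y \<bullet>\<^bsub>X\<^esub> a) \<oplus>\<^bsub>Y\<^esub> v \<bullet>\<^bsub>Y\<^esub> a"
        using v(1) x that sub(1)[OF V] by (simp add: additive_add[OF Yr(4)] \<theta>_cl \<theta>'(5) subset_iff)
      finally show ?thesis using r_eq[of "r y \<bullet>\<^bsub>X\<^esub> a" "v \<bullet>\<^bsub>Y\<^esub> a"] x v(1) sub(5)[OF V] that Xr(3) by simp
    qed
    show ?thesis using r by (simp add: bimodule_hom_iff additive_def add left right Yl(3) Yr(3))
  qed
  moreover have "\<theta> \<in> bimodule_hom R X Y S" using \<theta>' by (simp add: bimodule_hom_iff)
  ultimately show ?thesis using that r\<theta> \<theta>_cl by (metis restrict_apply')
qed

text \<open>For i >= n this is the zero family, so membership in the direct power needs no bound on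
  i.\<close>

definition power_inj :: "nat \<Rightarrow> ('b, 'm) ring_scheme \<Rightarrow> nat \<Rightarrow> 'b \<Rightarrow> nat \<Rightarrow> 'b" where
  "power_inj n X i x = (\<lambda>j\<in>{..<n}. if j = i then x else \<zero>\<^bsub>X\<^esub>)"

lemma bimodule_direct_power:
  assumes "bimodule R X S"
  shows "bimodule R (direct_power n X) S"
proof -
  note l = left_module_simps[OF bimodule_left[OF assms]]
    and r = right_module_simps[OF bimodule_right[OF assms]]
  interpret X: abelian_group X by (rule l(2))
  interpret bimodule R X S by fact
  have ab: "abelian_group (direct_power n X)"
  proof (rule abelian_groupI)
    fix x assume x: "x \<in> carrier (direct_power n X)"
    show "\<exists>y\<in>carrier (direct_power n X). y \<oplus>\<^bsub>direct_power n X\<^esub> x = \<zero>\<^bsub>direct_power n X\<^esub>"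
      by (rule bexI[of _ "\<lambda>i\<in>{..<n}. \<ominus>\<^bsub>X\<^esub> x i"])
        (use x in \<open>simp_all add: direct_power_def PiE_iff X.l_neg cong: restrict_cong\<close>)
  qed (simp_all add: direct_power_def PiE_iff X.a_ac extensional_restrict cong: restrict_cong)
  show ?thesis
    unfolding bimodule_iff
    by (intro conjI left_moduleI right_moduleI l(1) r(1) ab ballI additiveI)
      (simp_all add: direct_power_def PiE_iff extensional_restrict l(3) r(3) lsmult_l_distr lsmult_r_distr lsmult_assoc
        lsmult_one rsmult_l_distr rsmult_r_distr rsmult_assoc rsmult_one smult_rsmult_assoc
        cong: restrict_cong)
qed

text \<open>Taking a coordinate is additive, so the sum is evaluated coordinatewise, where a single
  term survives.\<close>

lemma direct_power_expand:
  assumes "abelian_group X" "abelian_group (direct_power n X)" "x \<in> carrier (direct_power n X)"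
  shows "(\<Oplus>\<^bsub>direct_power n X\<^esub>i\<in>{..<n}. power_inj n X i (x i)) = x" (is "?s = x")
proof -
  let ?D = "direct_power n X"
  interpret X: abelian_group X by fact
  interpret D: abelian_group ?D by fact
  have x: "x i \<in> carrier X" if "i < n" for i using assms(3) that by (auto simp: direct_power_def)
  have cl: "(\<lambda>i. power_inj n X i (x i)) \<in> {..<n} \<rightarrow> carrier ?D"
    using x by (auto simp: direct_power_def power_inj_def)
  have "?s j = x j" if j: "j < n" for j
  proof -
    have "?s j = (\<Oplus>\<^bsub>X\<^esub>i\<in>{..<n}. power_inj n X i (x i) j)"
      by (rule additive_finsum[OF assms(2,1) _ _ cl, where f = "\<lambda>x. x j"])
        (use j in \<open>auto simp: additive_def direct_power_def\<close>)
    also have "\<dots> = (\<Oplus>\<^bsub>X\<^esub>i\<in>{..<n}. if j = i then x i else \<zero>\<^bsub>X\<^esub>)"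
      using j x by (intro X.finsum_cong') (auto simp: power_inj_def)
    also have "\<dots> = x j" using j x by (intro X.finsum_singleton) auto
    finally show ?thesis .
  qed
  moreover have "?s \<in> carrier ?D" using cl by (rule D.finsum_closed)
  ultimately show ?thesis using assms(3)
    by (intro extensionalityI[of _ "{..<n}"]) (auto simp: direct_power_def PiE_def)
qed

section \<open>The bimodules of a ring extension\<close>

text \<open>\<open>R\<close>, \<open>A\<close>, \<open>B\<close>, \<open>C\<close> and
  \<open>T\<close> are parameters tied to their definitions by equations, so that the definitions
  stay folded and enter through the \<open>_simps\<close> lemmas only.\<close>

locale ring_extension =
  fixes N :: "'n ring" and M :: "'m ring" and \<phi> :: "'n \<Rightarrow> 'm" and R A B C T
  assumes ring_N: "ring N" and ring_M: "ring M" and \<phi>: "\<phi> \<in> ring_hom N M"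
    and R_eq: "R = centralizer_ring N M \<phi>"
    and A_eq: "A = A_bimodule N M \<phi>"
    and B_eq: "B = B_bimodule N M \<phi>"
    and C_eq: "C = C_ring N M \<phi>"
    and T_eq: "T = MM N M \<phi>"
begin

abbreviation "X \<equiv> ring_bimodule M \<phi> \<phi>"
abbreviation "Y \<equiv> ring_bimodule M \<phi> id"
abbreviation "mt \<equiv> MM_tensor N M \<phi>"
abbreviation "ev \<alpha> \<equiv> tensor_lift M (\<lambda>m m'. \<alpha> m \<otimes>\<^bsub>M\<^esub> m')"

sublocale M: ring M by (rule ring_M)

lemma bimodule_X: "bimodule N X N"
  by (rule bimodule_ring_bimodule[OF ring_M ring_N ring_N \<phi> \<phi>])

lemma bimodule_Y: "bimodule N Y M"
  by (rule bimodule_ring_bimodule[OF ring_M ring_N ring_M \<phi> id_ring_hom])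

lemma T_tensor: "T = tensor X N Y"
  by (simp add: T_eq MM_def)

lemma mt_pure: "mt = pure_tensor X N Y"
  by (simp add: MM_tensor_def fun_eq_iff)

lemma tensor_X_Y: "tensor_product X N Y"
  by (simp add: tensor_product_iff bimodule_right[OF bimodule_X] bimodule_left[OF bimodule_Y])

lemma \<phi>_closed: "n \<in> carrier N \<Longrightarrow> \<phi> n \<in> carrier M"
  by (rule ring_hom_closed[OF \<phi>])

lemma bimodule_T: "bimodule N T M"
  unfolding T_tensor by (rule bimodule_tensor[OF bimodule_X bimodule_Y])

lemmas T_left = left_module_simps[OF bimodule_left[OF bimodule_T]]
  and T_right = right_module_simps[OF bimodule_right[OF bimodule_T]]

lemma T_assoc:
  "t \<in> carrier T \<Longrightarrow> m \<in> carrier M \<Longrightarrow> m' \<in> carrier M \<Longrightarrow>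
    (t \<bullet>\<^bsub>T\<^esub> m) \<bullet>\<^bsub>T\<^esub> m' = t \<bullet>\<^bsub>T\<^esub> (m \<otimes>\<^bsub>M\<^esub> m')"
  "n \<in> carrier N \<Longrightarrow> t \<in> carrier T \<Longrightarrow> m \<in> carrier M \<Longrightarrow>
    n \<odot>\<^bsub>T\<^esub> (t \<bullet>\<^bsub>T\<^esub> m) = (n \<odot>\<^bsub>T\<^esub> t) \<bullet>\<^bsub>T\<^esub> m"
  "t \<in> carrier T \<Longrightarrow> t \<bullet>\<^bsub>T\<^esub> \<one>\<^bsub>M\<^esub> = t"
  using bimodule_T right_module.rsmult_assoc[OF bimodule_right[OF bimodule_T]]
    right_module.rsmult_one[OF bimodule_right[OF bimodule_T]]
  by (simp_all add: bimodule_iff)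

text \<open>The last clause combines balancing with the right action: both sides are x (x)
  \<phi>(n). It makes m |-> h(m (x) 1) right \<open>N\<close>-linear for every right
  \<open>M\<close>-linear h on \<open>T\<close>.\<close>

lemma mt_simps:
  "x \<in> carrier M \<Longrightarrow> y \<in> carrier M \<Longrightarrow> mt x y \<in> carrier T"
  "x \<in> carrier M \<Longrightarrow> x' \<in> carrier M \<Longrightarrow> y \<in> carrier M \<Longrightarrow> mt (x \<oplus>\<^bsub>M\<^esub> x') y = mt x y \<oplus>\<^bsub>T\<^esub> mt x' y"
  "x \<in> carrier M \<Longrightarrow> y \<in> carrier M \<Longrightarrow> m \<in> carrier M \<Longrightarrow> mt x y \<bullet>\<^bsub>T\<^esub> m = mt x (y \<otimes>\<^bsub>M\<^esub> m)"
  "x \<in> carrier M \<Longrightarrow> y \<in> carrier M \<Longrightarrow> n \<in> carrier N \<Longrightarrow> n \<odot>\<^bsub>T\<^esub> mt x y = mt (\<phi> n \<otimes>\<^bsub>M\<^esub> x) y"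
  "x \<in> carrier M \<Longrightarrow> n \<in> carrier N \<Longrightarrow> mt (x \<otimes>\<^bsub>M\<^esub> \<phi> n) \<one>\<^bsub>M\<^esub> = mt x \<one>\<^bsub>M\<^esub> \<bullet>\<^bsub>T\<^esub> \<phi> n"
proof -
  interpret tensor_product X N Y by (rule tensor_X_Y)
  show "x \<in> carrier M \<Longrightarrow> y \<in> carrier M \<Longrightarrow> mt x y \<in> carrier T"
    using pure_closed[of x y] by (simp add: mt_pure T_tensor ring_bimodule_simps)
  show "x \<in> carrier M \<Longrightarrow> x' \<in> carrier M \<Longrightarrow> y \<in> carrier M \<Longrightarrow> mt (x \<oplus>\<^bsub>M\<^esub> x') y = mt x y \<oplus>\<^bsub>T\<^esub> mt x' y"
    using pure_add_left[of x x' y] by (simp add: mt_pure T_tensor ring_bimodule_simps)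
  show r: "mt x y \<bullet>\<^bsub>T\<^esub> m = mt x (y \<otimes>\<^bsub>M\<^esub> m)"
    if "x \<in> carrier M" "y \<in> carrier M" "m \<in> carrier M" for x y m
    using tensor_rsmult_pure(2)[OF bimodule_right[OF bimodule_X] bimodule_Y, of m x y] that
    by (simp add: mt_pure T_tensor ring_bimodule_simps)
  show "x \<in> carrier M \<Longrightarrow> y \<in> carrier M \<Longrightarrow> n \<in> carrier N \<Longrightarrow> n \<odot>\<^bsub>T\<^esub> mt x y = mt (\<phi> n \<otimes>\<^bsub>M\<^esub> x) y"
    using tensor_smult_pure(2)[OF bimodule_X bimodule_left[OF bimodule_Y], of n x y]
    by (simp add: mt_pure T_tensor ring_bimodule_simps)
  show "x \<in> carrier M \<Longrightarrow> n \<in> carrier N \<Longrightarrow> mt (x \<otimes>\<^bsub>M\<^esub> \<phi> n) \<one>\<^bsub>M\<^esub> = mt x \<one>\<^bsub>M\<^esub> \<bullet>\<^bsub>T\<^esub> \<phi> n"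
    using pure_balanced[of x n "\<one>\<^bsub>M\<^esub>"] r[of x "\<one>\<^bsub>M\<^esub>" "\<phi> n"] \<phi>_closed[of n]
    by (simp add: mt_pure ring_bimodule_simps)
qed

lemma T_eqI:
  assumes "additive T Z f" "additive T Z g"
    and "\<And>x y. x \<in> carrier M \<Longrightarrow> y \<in> carrier M \<Longrightarrow> f (mt x y) = g (mt x y)" "t \<in> carrier T"
  shows "f t = g t"
  using assms unfolding T_tensor mt_pure
  by (intro tensor_product.additive_eqI[OF tensor_X_Y, of Z f g t]) (simp_all add: ring_bimodule_simps)

section \<open>Membership and operations of the centralizer, the endomorphisms and the invariants
  made explicit\<close>

lemma R_simps:
  "r \<in> carrier R \<longleftrightarrow> r \<in> carrier M \<and> (\<forall>n\<in>carrier N. \<phi> n \<otimes>\<^bsub>M\<^esub> r = r \<otimes>\<^bsub>M\<^esub> \<phi> n)"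
  "mult R = mult M" "\<one>\<^bsub>R\<^esub> = \<one>\<^bsub>M\<^esub>" "add R = add M" "\<zero>\<^bsub>R\<^esub> = \<zero>\<^bsub>M\<^esub>"
  by (simp_all add: R_eq centralizer_ring_def)

lemma A_simps:
  "\<alpha> \<in> carrier A \<longleftrightarrow> \<alpha> \<in> extensional (carrier M) \<and> additive M M \<alpha> \<and>
    (\<forall>n\<in>carrier N. \<forall>x\<in>carrier M. \<alpha> (\<phi> n \<otimes>\<^bsub>M\<^esub> x) = \<phi> n \<otimes>\<^bsub>M\<^esub> \<alpha> x) \<and>
    (\<forall>x\<in>carrier M. \<forall>n\<in>carrier N. \<alpha> (x \<otimes>\<^bsub>M\<^esub> \<phi> n) = \<alpha> x \<otimes>\<^bsub>M\<^esub> \<phi> n)"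
  "\<alpha> \<oplus>\<^bsub>A\<^esub> \<alpha>' = (\<lambda>m\<in>carrier M. \<alpha> m \<oplus>\<^bsub>M\<^esub> \<alpha>' m)"
  "r \<odot>\<^bsub>A\<^esub> \<alpha> = (\<lambda>m\<in>carrier M. r \<otimes>\<^bsub>M\<^esub> \<alpha> m)"
  "\<alpha> \<bullet>\<^bsub>A\<^esub> c = (\<lambda>m\<in>carrier M. mu_alpha N M \<phi> \<alpha> (c (mt m \<one>\<^bsub>M\<^esub>)))"
  by (simp_all add: A_eq A_bimodule_def A_ring_def Let_def end_ring_def bimodule_hom_iff
      ring_bimodule_simps additive_ring_bimodule)

lemma B_simps:
  "b \<in> carrier B \<longleftrightarrow> b \<in> carrier T \<and> (\<forall>n\<in>carrier N. n \<odot>\<^bsub>T\<^esub> b = b \<bullet>\<^bsub>T\<^esub> \<phi> n)"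
  "add B = add T" "\<zero>\<^bsub>B\<^esub> = \<zero>\<^bsub>T\<^esub>" "smult B = (\<lambda>f x. f x)" "rsmult B = rsmult T"
  by (simp_all add: B_eq B_bimodule_def T_eq eval_bimodule_def)

lemma eval_simps:
  "carrier (eval_bimodule T) = carrier T" "add (eval_bimodule T) = add T"
  "\<zero>\<^bsub>eval_bimodule T\<^esub> = \<zero>\<^bsub>T\<^esub>" "smult (eval_bimodule T) = (\<lambda>f x. f x)"
  "rsmult (eval_bimodule T) = rsmult T"
  by (simp_all add: eval_bimodule_def)

lemma C_simps:
  "c \<in> carrier C \<longleftrightarrow> c \<in> extensional (carrier T) \<and> additive T T c \<and>
    (\<forall>n\<in>carrier N. \<forall>t\<in>carrier T. c (n \<odot>\<^bsub>T\<^esub> t) = n \<odot>\<^bsub>T\<^esub> c t) \<and>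
    (\<forall>t\<in>carrier T. \<forall>m\<in>carrier M. c (t \<bullet>\<^bsub>T\<^esub> m) = c t \<bullet>\<^bsub>T\<^esub> m)"
  "mult C = compose (carrier T)" "\<one>\<^bsub>C\<^esub> = (\<lambda>t\<in>carrier T. t)"
  "c \<oplus>\<^bsub>C\<^esub> c' = (\<lambda>t\<in>carrier T. c t \<oplus>\<^bsub>T\<^esub> c' t)"
  by (simp_all add: C_eq C_ring_def T_eq end_ring_def bimodule_hom_iff)

lemma C_D:
  assumes "c \<in> carrier C"
  shows "additive T T c" "t \<in> carrier T \<Longrightarrow> c t \<in> carrier T"
    "t \<in> carrier T \<Longrightarrow> u \<in> carrier T \<Longrightarrow> c (t \<oplus>\<^bsub>T\<^esub> u) = c t \<oplus>\<^bsub>T\<^esub> c u"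
    "n \<in> carrier N \<Longrightarrow> t \<in> carrier T \<Longrightarrow> c (n \<odot>\<^bsub>T\<^esub> t) = n \<odot>\<^bsub>T\<^esub> c t"
    "m \<in> carrier M \<Longrightarrow> t \<in> carrier T \<Longrightarrow> c (t \<bullet>\<^bsub>T\<^esub> m) = c t \<bullet>\<^bsub>T\<^esub> m"
  using assms additive_closed[of T T c] additive_add[of T T c] by (simp_all add: C_simps)

lemma A_D:
  assumes "\<alpha> \<in> carrier A"
  shows "additive M M \<alpha>" "x \<in> carrier M \<Longrightarrow> \<alpha> x \<in> carrier M"
    "x \<in> carrier M \<Longrightarrow> y \<in> carrier M \<Longrightarrow> \<alpha> (x \<oplus>\<^bsub>M\<^esub> y) = \<alpha> x \<oplus>\<^bsub>M\<^esub> \<alpha> y"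
    "n \<in> carrier N \<Longrightarrow> x \<in> carrier M \<Longrightarrow> \<alpha> (\<phi> n \<otimes>\<^bsub>M\<^esub> x) = \<phi> n \<otimes>\<^bsub>M\<^esub> \<alpha> x"
    "n \<in> carrier N \<Longrightarrow> x \<in> carrier M \<Longrightarrow> \<alpha> (x \<otimes>\<^bsub>M\<^esub> \<phi> n) = \<alpha> x \<otimes>\<^bsub>M\<^esub> \<phi> n"
  using assms additive_closed[of M M \<alpha>] additive_add[of M M \<alpha>] by (simp_all add: A_simps)

lemma R_closed: "r \<in> carrier R \<Longrightarrow> r \<in> carrier M"
  by (simp add: R_simps)

lemma B_closed: "b \<in> carrier B \<Longrightarrow> b \<in> carrier T"
  by (simp add: B_simps)

lemma ring_R: "ring R"
proof -
  have mult: "r \<otimes>\<^bsub>M\<^esub> s \<in> carrier R" if "r \<in> carrier R" "s \<in> carrier R" for r s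
  proof -
    have "\<phi> n \<otimes>\<^bsub>M\<^esub> (r \<otimes>\<^bsub>M\<^esub> s) = (r \<otimes>\<^bsub>M\<^esub> s) \<otimes>\<^bsub>M\<^esub> \<phi> n" if "n \<in> carrier N" for n
      using \<open>r \<in> carrier R\<close> \<open>s \<in> carrier R\<close> that by (metis M.m_assoc R_simps(1) \<phi>_closed)
    then show ?thesis using that by (simp add: R_simps)
  qed
  have neg: "\<ominus>\<^bsub>M\<^esub> r \<in> carrier R" if "r \<in> carrier R" for r
    using that by (simp add: R_simps M.r_minus M.l_minus \<phi>_closed)
  have "abelian_group R"
  proof (rule abelian_groupI; (unfold R_simps(2-5))?)
    fix r assume r: "r \<in> carrier R"
    then show "\<exists>s\<in>carrier R. s \<oplus>\<^bsub>M\<^esub> r = \<zero>\<^bsub>M\<^esub>"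
      by (intro bexI[OF _ neg[OF r]]) (simp add: R_closed M.l_neg)
  qed (auto simp: R_closed M.a_ac, auto simp: R_simps M.l_distr M.r_distr \<phi>_closed)
  moreover have "monoid R"
    by (rule monoidI; (unfold R_simps(2-5))?)
      (auto simp: mult R_closed M.m_assoc, auto simp: R_simps \<phi>_closed)
  ultimately show ?thesis
    by (intro ringI; (unfold R_simps(2-5))?) (auto simp: R_closed M.l_distr M.r_distr)
qed

lemma ring_C: "ring C"
  unfolding C_eq C_ring_def T_eq[symmetric] by (rule ring_end_ring[OF bimodule_T])

lemma abelian_group_A: "abelian_group A"
proof -
  have "ring (A_ring N M \<phi>)"
    unfolding A_ring_def Let_def by (rule ring_end_ring[OF bimodule_X])
  then show ?thesis
    by (rule abelian_group_cong[OF ring.is_abelian_group]) (simp_all add: A_eq A_bimodule_def)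
qed

section \<open>The maps \<open>ev \<alpha>\<close> on the tensor square and the right action of the
  endomorphism ring\<close>

lemma balanced_ev: "\<alpha> \<in> carrier A \<Longrightarrow> balanced X N Y M (\<lambda>m m'. \<alpha> m \<otimes>\<^bsub>M\<^esub> m')"
  by (rule balancedI)
    (simp_all add: ring_bimodule_simps A_D M.l_distr M.r_distr M.m_assoc \<phi>_closed)

lemma additive_ev: "\<alpha> \<in> carrier A \<Longrightarrow> additive T M (ev \<alpha>)"
  unfolding T_tensor
  by (rule tensor_product.additive_lift[OF tensor_X_Y M.is_abelian_group balanced_ev])

lemma ev_mt: "\<alpha> \<in> carrier A \<Longrightarrow> x \<in> carrier M \<Longrightarrow> y \<in> carrier M \<Longrightarrow> ev \<alpha> (mt x y) = \<alpha> x \<otimes>\<^bsub>M\<^esub> y"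
  unfolding mt_pure
  by (rule tensor_product.lift_pure[OF tensor_X_Y M.is_abelian_group balanced_ev])
    (simp_all add: ring_bimodule_simps)

lemma ev_closed: "\<alpha> \<in> carrier A \<Longrightarrow> t \<in> carrier T \<Longrightarrow> ev \<alpha> t \<in> carrier M"
  by (rule additive_closed[OF additive_ev])

lemma additive_M_mult: "r \<in> carrier M \<Longrightarrow> additive M M (\<lambda>m. r \<otimes>\<^bsub>M\<^esub> m)"
  "r \<in> carrier M \<Longrightarrow> additive M M (\<lambda>m. m \<otimes>\<^bsub>M\<^esub> r)"
  by (simp_all add: additive_def M.l_distr M.r_distr)

lemma ev_right:
  assumes "\<alpha> \<in> carrier A" "t \<in> carrier T" "m \<in> carrier M"
  shows "ev \<alpha> (t \<bullet>\<^bsub>T\<^esub> m) = ev \<alpha> t \<otimes>\<^bsub>M\<^esub> m"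
  by (rule T_eqI[OF additive_comp[OF T_right(4) additive_ev]
        additive_comp[OF additive_ev additive_M_mult(2)] _ assms(2)])
    (use assms in \<open>simp_all add: ev_mt mt_simps M.m_assoc A_D\<close>)

lemma ev_left:
  assumes "\<alpha> \<in> carrier A" "t \<in> carrier T" "n \<in> carrier N"
  shows "ev \<alpha> (n \<odot>\<^bsub>T\<^esub> t) = \<phi> n \<otimes>\<^bsub>M\<^esub> ev \<alpha> t"
  by (rule T_eqI[OF additive_comp[OF T_left(4) additive_ev]
        additive_comp[OF additive_ev additive_M_mult(1)] _ assms(2)])
    (use assms in \<open>simp_all add: ev_mt mt_simps M.m_assoc A_D \<phi>_closed\<close>)

text \<open>\<open>mu_alpha\<close> applies two lifts in succession, \<open>ev\<close> only one;
  both are additive and send x (x) y to \<alpha>(x) y.\<close>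

lemma mu_alpha_ev:
  assumes "\<alpha> \<in> carrier A" "t \<in> carrier T"
  shows "mu_alpha N M \<phi> \<alpha> t = ev \<alpha> t"
proof -
  interpret tensor_product X N Y by (rule tensor_X_Y)
  have bal: "balanced X N Y M (mult M)"
    by (rule balancedI)
      (simp_all add: ring_bimodule_simps M.l_distr M.r_distr M.m_assoc \<phi>_closed)
  have \<alpha>: "additive X X \<alpha>" "\<And>x s. x \<in> carrier X \<Longrightarrow> s \<in> carrier N \<Longrightarrow> \<alpha> (x \<bullet>\<^bsub>X\<^esub> s) = \<alpha> x \<bullet>\<^bsub>X\<^esub> s"
    using A_D[OF assms(1)] by (simp_all add: additive_ring_bimodule ring_bimodule_simps)
  have tm: "additive T T (tensor_map X N Y X Y \<alpha> id)"
    "\<And>x y. x \<in> carrier M \<Longrightarrow> y \<in> carrier M \<Longrightarrow> tensor_map X N Y X Y \<alpha> id (mt x y) = mt (\<alpha> x) y"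
    using tensor_map_pure[OF bimodule_right[OF bimodule_X] bimodule_left[OF bimodule_Y]
        bimodule_right[OF bimodule_X] bimodule_left[OF bimodule_Y] \<alpha>, of id]
    by (simp_all add: T_tensor mt_pure ring_bimodule_simps additive_def)
  have lift: "additive T M (tensor_lift M (mult M))"
    unfolding T_tensor by (rule additive_lift[OF M.is_abelian_group bal])
  have lift_mt: "tensor_lift M (mult M) (mt x y) = x \<otimes>\<^bsub>M\<^esub> y" if "x \<in> carrier M" "y \<in> carrier M" for x y
    unfolding mt_pure
    by (rule lift_pure[OF M.is_abelian_group bal]) (use that in \<open>simp_all add: ring_bimodule_simps\<close>)
  show ?thesis
    unfolding mu_alpha_def
    by (rule T_eqI[OF additive_comp[OF tm(1) lift] additive_ev[OF assms(1)] _ assms(2)])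
      (simp_all add: tm(2) lift_mt ev_mt assms A_D)
qed

lemma A_I:
  assumes "\<And>x. x \<in> carrier M \<Longrightarrow> h x \<in> carrier M"
    and "\<And>x y. x \<in> carrier M \<Longrightarrow> y \<in> carrier M \<Longrightarrow> h (x \<oplus>\<^bsub>M\<^esub> y) = h x \<oplus>\<^bsub>M\<^esub> h y"
    and "\<And>n x. n \<in> carrier N \<Longrightarrow> x \<in> carrier M \<Longrightarrow> h (\<phi> n \<otimes>\<^bsub>M\<^esub> x) = \<phi> n \<otimes>\<^bsub>M\<^esub> h x"
    and "\<And>n x. n \<in> carrier N \<Longrightarrow> x \<in> carrier M \<Longrightarrow> h (x \<otimes>\<^bsub>M\<^esub> \<phi> n) = h x \<otimes>\<^bsub>M\<^esub> \<phi> n"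
  shows "restrict h (carrier M) \<in> carrier A"
  using assms by (simp add: A_simps additive_def \<phi>_closed)

lemma C_I:
  assumes "additive T T c"
    and "\<And>n t. n \<in> carrier N \<Longrightarrow> t \<in> carrier T \<Longrightarrow> c (n \<odot>\<^bsub>T\<^esub> t) = n \<odot>\<^bsub>T\<^esub> c t"
    and "\<And>m t. m \<in> carrier M \<Longrightarrow> t \<in> carrier T \<Longrightarrow> c (t \<bullet>\<^bsub>T\<^esub> m) = c t \<bullet>\<^bsub>T\<^esub> m"
  shows "restrict c (carrier T) \<in> carrier C"
  using assms by (simp add: C_simps additive_restrict_iff T_left T_right)

lemma A_eqI:
  assumes "\<alpha> \<in> carrier A" "\<beta> \<in> carrier A" "\<And>x. x \<in> carrier M \<Longrightarrow> \<alpha> x = \<beta> x"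
  shows "\<alpha> = \<beta>"
  using assms by (intro extensionalityI[of \<alpha> "carrier M" \<beta>]) (simp_all add: A_simps)

lemma C_eqI:
  assumes "c \<in> carrier C" "d \<in> carrier C" "\<And>t. t \<in> carrier T \<Longrightarrow> c t = d t"
  shows "c = d"
  using assms by (intro extensionalityI[of c "carrier T" d]) (simp_all add: C_simps)

lemma A_closed:
  "\<alpha> \<in> carrier A \<Longrightarrow> \<beta> \<in> carrier A \<Longrightarrow> \<alpha> \<oplus>\<^bsub>A\<^esub> \<beta> \<in> carrier A"
  "r \<in> carrier R \<Longrightarrow> \<alpha> \<in> carrier A \<Longrightarrow> r \<odot>\<^bsub>A\<^esub> \<alpha> \<in> carrier A"
  "c \<in> carrier C \<Longrightarrow> \<alpha> \<in> carrier A \<Longrightarrow> \<alpha> \<bullet>\<^bsub>A\<^esub> c \<in> carrier A"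
proof -
  show "\<alpha> \<oplus>\<^bsub>A\<^esub> \<beta> \<in> carrier A" if "\<alpha> \<in> carrier A" "\<beta> \<in> carrier A"
    by (rule abelian_groupE(1)[OF abelian_group_A that])
  show "r \<odot>\<^bsub>A\<^esub> \<alpha> \<in> carrier A" if "r \<in> carrier R" "\<alpha> \<in> carrier A"
    unfolding A_simps(3)
  proof (rule A_I)
    fix n x assume "n \<in> carrier N" "x \<in> carrier M"
    then have "\<phi> n \<otimes>\<^bsub>M\<^esub> r \<otimes>\<^bsub>M\<^esub> \<alpha> x = r \<otimes>\<^bsub>M\<^esub> \<phi> n \<otimes>\<^bsub>M\<^esub> \<alpha> x" using that by (simp add: R_simps)
    then show "r \<otimes>\<^bsub>M\<^esub> \<alpha> (\<phi> n \<otimes>\<^bsub>M\<^esub> x) = \<phi> n \<otimes>\<^bsub>M\<^esub> (r \<otimes>\<^bsub>M\<^esub> \<alpha> x)"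
      using that \<open>n \<in> carrier N\<close> \<open>x \<in> carrier M\<close> by (simp add: A_D R_closed M.m_assoc \<phi>_closed)
  qed (use that in \<open>simp_all add: A_D R_closed M.r_distr M.m_assoc \<phi>_closed\<close>)
  show "\<alpha> \<bullet>\<^bsub>A\<^esub> c \<in> carrier A" if "c \<in> carrier C" "\<alpha> \<in> carrier A"
    unfolding A_simps(4)
    by (rule A_I)
      (use that in \<open>simp_all add: mu_alpha_ev ev_closed C_D mt_simps(1,2,5) abelian_groupE(1)[OF T_left(2)] T_left(3) T_right(3)
        additive_add[OF additive_ev]
        ev_left ev_right \<phi>_closed mt_simps(4)[symmetric]\<close>)
qed

text \<open>With \<alpha> read as the map \<open>ev \<alpha>\<close> from \<open>T\<close> to
  \<open>M\<close>, the action of \<open>C\<close> is plain precomposition. This explains the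
  formula for the action and gives its associativity.\<close>

lemma ev_act:
  assumes "c \<in> carrier C" "\<alpha> \<in> carrier A" "t \<in> carrier T"
  shows "ev (\<alpha> \<bullet>\<^bsub>A\<^esub> c) t = ev \<alpha> (c t)"
proof (rule T_eqI[OF additive_ev additive_comp[OF C_D(1) additive_ev] _ assms(3)])
  fix x y assume xy: "x \<in> carrier M" "y \<in> carrier M"
  \<comment> \<open>Since x (x) y = (x (x) 1) y, right \<open>M\<close>-linearity of
    \<open>c\<close> and of \<open>ev \<alpha>\<close> reduces everything to the tensors x (x) 1
    that define the action.\<close>
  have "ev \<alpha> (c (mt x y)) = ev \<alpha> (c (mt x \<one>\<^bsub>M\<^esub>)) \<otimes>\<^bsub>M\<^esub> y"
    using C_D(5)[OF assms(1) xy(2), of "mt x \<one>\<^bsub>M\<^esub>"] xy assms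
    by (simp add: mt_simps C_D ev_right[symmetric])
  then show "ev (\<alpha> \<bullet>\<^bsub>A\<^esub> c) (mt x y) = ev \<alpha> (c (mt x y))"
    using xy assms by (simp add: ev_mt A_closed) (simp add: A_simps mu_alpha_ev C_D mt_simps)
qed (use assms A_closed in auto)

lemma A_add_apply: "m \<in> carrier M \<Longrightarrow> (\<alpha> \<oplus>\<^bsub>A\<^esub> \<beta>) m = \<alpha> m \<oplus>\<^bsub>M\<^esub> \<beta> m"
  and A_smult_apply: "m \<in> carrier M \<Longrightarrow> (r \<odot>\<^bsub>A\<^esub> \<alpha>) m = r \<otimes>\<^bsub>M\<^esub> \<alpha> m"
  by (simp_all add: A_simps)

lemma ev_add:
  assumes "\<alpha> \<in> carrier A" "\<beta> \<in> carrier A" "t \<in> carrier T"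
  shows "ev (\<alpha> \<oplus>\<^bsub>A\<^esub> \<beta>) t = ev \<alpha> t \<oplus>\<^bsub>M\<^esub> ev \<beta> t"
  by (rule T_eqI[OF additive_ev additive_plus[OF M.is_abelian_group additive_ev additive_ev] _ assms(3)])
    (use assms A_closed(1) in \<open>simp_all add: ev_mt A_add_apply A_D M.l_distr\<close>)

lemma ev_smult:
  assumes "r \<in> carrier R" "\<alpha> \<in> carrier A" "t \<in> carrier T"
  shows "ev (r \<odot>\<^bsub>A\<^esub> \<alpha>) t = r \<otimes>\<^bsub>M\<^esub> ev \<alpha> t"
  by (rule T_eqI[OF additive_ev additive_comp[OF additive_ev additive_M_mult(1)] _ assms(3)])
    (use assms A_closed(2) in \<open>simp_all add: ev_mt A_smult_apply A_D M.m_assoc R_closed\<close>)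

lemma act_apply:
  "c \<in> carrier C \<Longrightarrow> \<alpha> \<in> carrier A \<Longrightarrow> m \<in> carrier M \<Longrightarrow> (\<alpha> \<bullet>\<^bsub>A\<^esub> c) m = ev \<alpha> (c (mt m \<one>\<^bsub>M\<^esub>))"
  by (simp add: A_simps(4) mu_alpha_ev C_D mt_simps)

lemma C_add_apply: "t \<in> carrier T \<Longrightarrow> (c \<oplus>\<^bsub>C\<^esub> d) t = c t \<oplus>\<^bsub>T\<^esub> d t"
  and C_mult_apply: "t \<in> carrier T \<Longrightarrow> (c \<otimes>\<^bsub>C\<^esub> d) t = c (d t)"
  and C_one_apply: "t \<in> carrier T \<Longrightarrow> \<one>\<^bsub>C\<^esub> t = t"
  by (simp_all add: C_simps compose_def)

lemmas C_ring = ring.ring_simprules(1,5,6)[OF ring_C]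
lemmas R_ring = ring.ring_simprules(1,5,6)[OF ring_R, unfolded R_simps(2-5)]

lemma bimodule_A: "bimodule R A C"
  unfolding bimodule_iff
proof (intro conjI left_moduleI right_moduleI ring_R ring_C abelian_group_A ballI additiveI; (rule A_eqI)?)
qed (simp_all add: A_closed C_ring R_ring act_apply A_add_apply A_smult_apply C_add_apply C_mult_apply C_one_apply
    mt_simps additive_add[OF additive_ev] C_D R_simps(2-5) A_D R_closed M.l_distr M.r_distr M.m_assoc
    ev_act ev_add ev_smult ev_mt ev_closed)

lemma B_act_closed: "c \<in> carrier C \<Longrightarrow> b \<in> carrier B \<Longrightarrow> c b \<in> carrier B"
  by (simp add: B_simps C_D \<phi>_closed flip: C_D(4,5))

lemma B_R_closed:
  assumes "b \<in> carrier B" "r \<in> carrier R"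
  shows "b \<bullet>\<^bsub>T\<^esub> r \<in> carrier B"
  using assms by (simp add: B_simps R_simps T_right(3) T_assoc \<phi>_closed)

lemma abelian_group_B: "abelian_group B"
proof -
  interpret T: abelian_group T by (rule T_left(2))
  have neg: "\<ominus>\<^bsub>T\<^esub> b \<in> carrier B" if "b \<in> carrier B" for b
    using that additive_minus[OF T_left(2) T_left(2) T_left(4)] additive_minus[OF T_left(2) T_left(2) T_right(4)]
    by (simp add: B_simps \<phi>_closed)
  have add: "b \<oplus>\<^bsub>T\<^esub> b' \<in> carrier B" if "b \<in> carrier B" "b' \<in> carrier B" for b b'
    using that by (simp add: B_simps \<phi>_closed additive_add[OF T_left(4)] additive_add[OF T_right(4)])
  have zero: "\<zero>\<^bsub>T\<^esub> \<in> carrier B"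
    using additive_zero[OF T_left(2) T_left(2) T_left(4)] additive_zero[OF T_left(2) T_left(2) T_right(4)]
    by (simp add: B_simps \<phi>_closed)
  show ?thesis
  proof (rule abelian_groupI; (unfold B_simps(2,3))?)
    fix b assume "b \<in> carrier B"
    then show "\<exists>y\<in>carrier B. y \<oplus>\<^bsub>T\<^esub> b = \<zero>\<^bsub>T\<^esub>" using neg by (intro bexI[of _ "\<ominus>\<^bsub>T\<^esub> b"]) (auto simp: B_closed T.l_neg)
  qed (simp_all add: zero add B_closed T.a_ac)
qed

lemma bimodule_B: "bimodule C B R"
  unfolding bimodule_iff
  by (intro conjI left_moduleI right_moduleI ring_R ring_C abelian_group_B ballI additiveI)
    (simp_all add: B_simps(2-5) B_closed B_act_closed B_R_closed C_D R_closed C_add_apply C_mult_apply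
      C_one_apply additive_add[OF T_right(4)] additive_add[OF T_right(5)] R_simps(2-5) T_assoc)

lemma bimodule_eval: "bimodule C (eval_bimodule T) M"
proof -
  have "abelian_group (eval_bimodule T)"
    by (rule abelian_group_cong[OF T_left(2)]) (simp_all add: eval_simps)
  then show ?thesis
    unfolding bimodule_iff
    by (intro conjI left_moduleI right_moduleI ring_M ring_C ballI additiveI)
      (simp_all add: eval_simps C_D C_add_apply C_mult_apply T_right(3)
        C_one_apply additive_add[OF T_right(4)] additive_add[OF T_right(5)] T_assoc)
qed

text \<open>Composite of \<open>ev \<alpha>\<close> with the map m |-> b m from \<open>M\<close> to
  \<open>T\<close>. It is written as a restricted lift, in the literal form of map 1, so that
  unfolding it yields the statement.\<close>

definition "pairing b \<alpha> = (\<lambda>u\<in>carrier T. tensor_lift T (\<lambda>m m'. b \<bullet>\<^bsub>T\<^esub> (\<alpha> m \<otimes>\<^bsub>M\<^esub> m')) u)"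

lemma pairing_apply:
  assumes "b \<in> carrier T" "\<alpha> \<in> carrier A" "t \<in> carrier T"
  shows "pairing b \<alpha> t = b \<bullet>\<^bsub>T\<^esub> ev \<alpha> t"
proof -
  have bal: "balanced X N Y T (\<lambda>m m'. b \<bullet>\<^bsub>T\<^esub> (\<alpha> m \<otimes>\<^bsub>M\<^esub> m'))"
    by (rule balancedI)
      (use assms in \<open>simp_all add: ring_bimodule_simps A_D M.l_distr M.r_distr M.m_assoc \<phi>_closed
        T_right(3) additive_add[OF T_right(5)]\<close>)
  have "tensor_lift T (\<lambda>m m'. b \<bullet>\<^bsub>T\<^esub> (\<alpha> m \<otimes>\<^bsub>M\<^esub> m')) t = b \<bullet>\<^bsub>T\<^esub> ev \<alpha> t"
  proof (rule T_eqI[OF _ additive_comp[OF additive_ev T_right(5)] _ assms(3)])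
    show "additive T T (tensor_lift T (\<lambda>m m'. b \<bullet>\<^bsub>T\<^esub> (\<alpha> m \<otimes>\<^bsub>M\<^esub> m')))"
      using tensor_product.additive_lift[OF tensor_X_Y T_left(2) bal] by (simp flip: T_tensor)
    show "tensor_lift T (\<lambda>m m'. b \<bullet>\<^bsub>T\<^esub> (\<alpha> m \<otimes>\<^bsub>M\<^esub> m')) (mt x y) = b \<bullet>\<^bsub>T\<^esub> ev \<alpha> (mt x y)"
      if "x \<in> carrier M" "y \<in> carrier M" for x y
      using tensor_product.lift_pure[OF tensor_X_Y T_left(2) bal, of x y] that assms
      by (simp add: ring_bimodule_simps ev_mt flip: mt_pure)
  qed (use assms in auto)
  then show ?thesis using assms by (simp add: pairing_def)
qed

text \<open>Left \<open>N\<close>-linearity is where invariance of b is used: b (\<phi>(n) m) = (b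
  \<phi>(n)) m = n (b m).\<close>

lemma pairing_closed:
  assumes "b \<in> carrier B" "\<alpha> \<in> carrier A"
  shows "pairing b \<alpha> \<in> carrier C"
proof -
  have "restrict (\<lambda>t. b \<bullet>\<^bsub>T\<^esub> ev \<alpha> t) (carrier T) \<in> carrier C"
  proof (rule C_I[OF additive_comp[OF additive_ev T_right(5)]])
    show "b \<bullet>\<^bsub>T\<^esub> ev \<alpha> (n \<odot>\<^bsub>T\<^esub> t) = n \<odot>\<^bsub>T\<^esub> (b \<bullet>\<^bsub>T\<^esub> ev \<alpha> t)" if "n \<in> carrier N" "t \<in> carrier T" for n t
      using that assms by (simp add: ev_left T_assoc(2) ev_closed B_closed T_assoc(1)[symmetric] \<phi>_closed)
        (simp add: B_simps)
    show "b \<bullet>\<^bsub>T\<^esub> ev \<alpha> (t \<bullet>\<^bsub>T\<^esub> m) = (b \<bullet>\<^bsub>T\<^esub> ev \<alpha> t) \<bullet>\<^bsub>T\<^esub> m" if "m \<in> carrier M" "t \<in> carrier T" for m t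
      using that assms by (simp add: ev_right T_assoc ev_closed B_closed)
  qed (use assms B_closed in auto)
  moreover have "pairing b \<alpha> = restrict (\<lambda>t. b \<bullet>\<^bsub>T\<^esub> ev \<alpha> t) (carrier T)"
    using assms by (intro extensionalityI[of _ "carrier T"]) (simp_all add: pairing_apply B_closed, simp add: pairing_def)
  ultimately show ?thesis by simp
qed

text \<open>Move \<phi>(n) inside \<open>ev \<alpha>\<close> from the left, across b by invariance,
  and out again on the right.\<close>

lemma ev_B: "\<alpha> \<in> carrier A \<Longrightarrow> b \<in> carrier B \<Longrightarrow> ev \<alpha> b \<in> carrier R"
  by (simp add: R_simps ev_closed B_closed \<phi>_closed flip: ev_left ev_right) (simp add: B_simps)

text \<open>Both associativity laws only express that \<open>pairing b \<alpha>\<close> multiplies b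
  by the value of \<open>ev \<alpha>\<close>, the second one together with right linearity of
  \<open>ev\<close>.\<close>

lemma morita_pairing: "morita_pairing C R B A pairing ev"
proof (intro morita_pairing.intro morita_pairing_axioms.intro bimodule_B bimodule_A)
  note T_add = abelian_groupE(1)[OF T_left(2)]
  show "balanced B R A C pairing"
    by (rule balancedI; (rule C_eqI)?)
      (simp_all add: pairing_closed pairing_apply B_closed B_simps(2,5) A_closed C_ring C_add_apply
        ev_add ev_smult ev_closed additive_add[OF T_right(4)] additive_add[OF T_right(5)] T_assoc
        B_R_closed R_closed abelian_groupE(1)[OF abelian_group_B, unfolded B_simps(2)] T_add)
  show "balanced A C B R ev"
    by (rule balancedI)
      (simp_all add: ev_B ev_add ev_act B_closed B_simps(2,4) R_simps(4) additive_add[OF additive_ev])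
  show "pairing (c \<odot>\<^bsub>B\<^esub> b) \<alpha> = c \<otimes>\<^bsub>C\<^esub> pairing b \<alpha>"
    if "c \<in> carrier C" "b \<in> carrier B" "\<alpha> \<in> carrier A" for c b \<alpha>
    by (rule C_eqI)
      (use that in \<open>simp_all add: pairing_closed pairing_apply B_closed B_simps(4) B_act_closed C_ring
        C_mult_apply C_D ev_closed\<close>)
  show "pairing b (\<alpha> \<bullet>\<^bsub>A\<^esub> c) = pairing b \<alpha> \<otimes>\<^bsub>C\<^esub> c"
    if "c \<in> carrier C" "b \<in> carrier B" "\<alpha> \<in> carrier A" for c b \<alpha>
    by (rule C_eqI)
      (use that in \<open>simp_all add: pairing_closed pairing_apply B_closed A_closed C_ring
        C_mult_apply C_D ev_act\<close>)
  show "pairing b \<alpha> \<odot>\<^bsub>B\<^esub> b' = b \<bullet>\<^bsub>B\<^esub> ev \<alpha> b'"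
    if "b \<in> carrier B" "\<alpha> \<in> carrier A" "b' \<in> carrier B" for b \<alpha> b'
    using that by (simp add: B_simps(4,5) pairing_apply B_closed)
  show "ev \<alpha> b \<odot>\<^bsub>A\<^esub> \<alpha>' = \<alpha> \<bullet>\<^bsub>A\<^esub> pairing b \<alpha>'"
    if "\<alpha> \<in> carrier A" "b \<in> carrier B" "\<alpha>' \<in> carrier A" for b \<alpha> \<alpha>'
    by (rule A_eqI)
      (use that in \<open>simp_all add: A_closed ev_B pairing_closed act_apply A_smult_apply pairing_apply
        mt_simps B_closed ev_right ev_closed ev_mt A_D\<close>)
qed (simp_all add: ev_smult ev_right B_closed B_simps(5) R_simps(2) R_closed)

lemma dual_bases_R: "dual_bases R C A B ev pairing {0} (\<lambda>_. \<lambda>m\<in>carrier M. m) (\<lambda>_. mt \<one>\<^bsub>M\<^esub> \<one>\<^bsub>M\<^esub>)"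
proof (intro dual_bases.intro dual_bases_axioms.intro morita_pairing.swap[OF morita_pairing])
  have id: "(\<lambda>m\<in>carrier M. m) \<in> carrier A" by (rule A_I) simp_all
  then show "(\<lambda>_. \<lambda>m\<in>carrier M. m) \<in> {0} \<rightarrow> carrier A" by simp
  \<comment> \<open>Invariance of 1 (x) 1: from the left, n gives \<phi>(n) (x) 1, and moving
    \<phi>(n) across the tensor sign gives the right action.\<close>
  have mt: "mt \<one>\<^bsub>M\<^esub> \<one>\<^bsub>M\<^esub> \<in> carrier B"
    using mt_simps(5)[of "\<one>\<^bsub>M\<^esub>"] by (simp add: B_simps mt_simps(1,4) \<phi>_closed)
  then show "(\<lambda>_. mt \<one>\<^bsub>M\<^esub> \<one>\<^bsub>M\<^esub>) \<in> {0} \<rightarrow> carrier B" by simp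
  interpret R: abelian_group R by (rule ring.is_abelian_group[OF ring_R])
  have "ev (\<lambda>m\<in>carrier M. m) (mt \<one>\<^bsub>M\<^esub> \<one>\<^bsub>M\<^esub>) = \<one>\<^bsub>M\<^esub>" using ev_mt[OF id] by simp
  moreover have "\<one>\<^bsub>M\<^esub> \<in> carrier R" using R_ring by simp
  ultimately show "(\<Oplus>\<^bsub>R\<^esub>i\<in>{0}. ev (\<lambda>m\<in>carrier M. m) (mt \<one>\<^bsub>M\<^esub> \<one>\<^bsub>M\<^esub>)) = \<one>\<^bsub>R\<^esub>"
    by (simp add: R_simps(3))
qed simp

text \<open>The instance behind maps 3 and 4: T is the tensor square with \<open>C\<close> acting by
  evaluation, Y is \<open>M\<close>, \<open>k\<close> is \<open>ev\<close> and \<open>b\<close> is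
  the right action of \<open>M\<close> on invariants.\<close>

lemma reconstruct_T:
  assumes "dual_bases C R B A pairing ev I b \<alpha>"
  shows "reconstruction C R B A pairing ev I b \<alpha> (eval_bimodule T) (ring_bimodule M id id) ev (rsmult T)"
proof -
  have M_R: "bimodule R (ring_bimodule M id id) M"
    by (rule bimodule_ring_bimodule[OF ring_M ring_R ring_M _ id_ring_hom])
      (auto simp: ring_hom_def R_simps)
  show ?thesis
  proof (intro reconstruction.intro reconstruction_axioms.intro assms bimodule_left[OF bimodule_eval]
      bimodule_left[OF M_R])
    show "balanced B R (ring_bimodule M id id) (eval_bimodule T) (rsmult T)"
      by (rule balancedI)
        (simp_all add: eval_simps ring_bimodule_simps B_simps(2,5) B_closed T_right(3) T_assoc R_closed
          additive_add[OF T_right(4)] additive_add[OF T_right(5)])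
    show "balanced A C (eval_bimodule T) (ring_bimodule M id id) ev"
      by (rule balancedI)
        (simp_all add: eval_simps ring_bimodule_simps ev_closed ev_add ev_act additive_add[OF additive_ev])
  qed (simp_all add: eval_simps ring_bimodule_simps B_simps(4) C_D B_closed ev_smult pairing_apply ev_right)
qed

text \<open>The coordinates of the inclusion into the power are N-M-maps from \<open>T\<close> to
  \<open>M\<close>, hence of the form \<open>ev \<alpha>\<close>; the retraction restricted to one
  factor is an N-M-map from \<open>M\<close> to \<open>T\<close>, hence m |-> b m with b
  invariant.\<close>

lemma dual_bases_C:
  assumes "left_D2 N M \<phi>"
  obtains I b \<alpha> where "dual_bases C R B A pairing ev I b \<alpha>"
proof -
  from assms obtain n where "iso_to_direct_summand N T (direct_power n Y) M"
    by (auto simp: left_D2_def T_eq)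
  from direct_summand_retraction[OF bimodule_T bimodule_direct_power[OF bimodule_Y] this]
  obtain \<theta> \<rho> where \<theta>: "\<theta> \<in> bimodule_hom N T (direct_power n Y) M"
    and \<rho>: "\<rho> \<in> bimodule_hom N (direct_power n Y) T M"
    and \<rho>\<theta>: "\<And>t. t \<in> carrier T \<Longrightarrow> \<rho> (\<theta> t) = t"
    by blast
  let ?D = "direct_power n Y"
  note D = left_module_simps[OF bimodule_left[OF bimodule_direct_power[OF bimodule_Y, of n]]]
  have \<theta>': "additive T ?D \<theta>"
    "\<And>a t. a \<in> carrier N \<Longrightarrow> t \<in> carrier T \<Longrightarrow> \<theta> (a \<odot>\<^bsub>T\<^esub> t) = a \<odot>\<^bsub>?D\<^esub> \<theta> t"
    "\<And>m t. m \<in> carrier M \<Longrightarrow> t \<in> carrier T \<Longrightarrow> \<theta> (t \<bullet>\<^bsub>T\<^esub> m) = \<theta> t \<bullet>\<^bsub>?D\<^esub> m"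
    using \<theta> by (auto simp: bimodule_hom_iff)
  have \<rho>': "additive ?D T \<rho>"
    "\<And>a t. a \<in> carrier N \<Longrightarrow> t \<in> carrier ?D \<Longrightarrow> \<rho> (a \<odot>\<^bsub>?D\<^esub> t) = a \<odot>\<^bsub>T\<^esub> \<rho> t"
    "\<And>m t. m \<in> carrier M \<Longrightarrow> t \<in> carrier ?D \<Longrightarrow> \<rho> (t \<bullet>\<^bsub>?D\<^esub> m) = \<rho> t \<bullet>\<^bsub>T\<^esub> m"
    using \<rho> by (auto simp: bimodule_hom_iff)
  define coord where "coord i t = \<theta> t i" for i t
  have coord_D: "additive ?D M (\<lambda>x. x i)" if "i < n" for i
    using that by (auto simp: additive_def direct_power_def ring_bimodule_simps)
  have coord: "additive T M (coord i)"
    "\<And>a t. a \<in> carrier N \<Longrightarrow> t \<in> carrier T \<Longrightarrow> coord i (a \<odot>\<^bsub>T\<^esub> t) = \<phi> a \<otimes>\<^bsub>M\<^esub> coord i t"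
    "\<And>m t. m \<in> carrier M \<Longrightarrow> t \<in> carrier T \<Longrightarrow> coord i (t \<bullet>\<^bsub>T\<^esub> m) = coord i t \<otimes>\<^bsub>M\<^esub> m"
    if "i < n" for i
    unfolding coord_def using that additive_comp[OF \<theta>'(1) coord_D[OF that]]
    by (auto simp: \<theta>' direct_power_def ring_bimodule_simps)
  \<comment> \<open>A right \<open>M\<close>-linear map on \<open>T\<close> is determined by its
    values at m (x) 1; \<open>ev_\<alpha>\<close> below recovers all of \<open>coord i\<close> from
    them.\<close>
  define \<alpha> where "\<alpha> i = (\<lambda>m\<in>carrier M. coord i (mt m \<one>\<^bsub>M\<^esub>))" for i
  have \<alpha>: "\<alpha> i \<in> carrier A" if i: "i < n" for i
    unfolding \<alpha>_def
    by (rule A_I)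
      (simp_all add: additive_closed[OF coord(1)[OF i]] additive_add[OF coord(1)[OF i]] mt_simps(1,2,5)
        coord[OF i] \<phi>_closed mt_simps(4)[symmetric])
  have ev_\<alpha>: "ev (\<alpha> i) t = coord i t" if i: "i < n" and t: "t \<in> carrier T" for i t
  proof (rule T_eqI[OF additive_ev[OF \<alpha>[OF i]] coord(1)[OF i] _ t])
    fix x y assume xy: "x \<in> carrier M" "y \<in> carrier M"
    then have "coord i (mt x y) = coord i (mt x \<one>\<^bsub>M\<^esub> \<bullet>\<^bsub>T\<^esub> y)" by (simp add: mt_simps)
    then show "ev (\<alpha> i) (mt x y) = coord i (mt x y)"
      using xy by (simp add: ev_mt \<alpha> i coord(3) mt_simps(1)) (simp add: \<alpha>_def)
  qed
  \<comment> \<open>The image of 1 under the retraction restricted to the i-th factor.\<close>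
  define b where "b i = \<rho> (power_inj n Y i \<one>\<^bsub>M\<^esub>)" for i
  have inj: "power_inj n Y i m \<in> carrier ?D"
    "power_inj n Y i m = power_inj n Y i \<one>\<^bsub>M\<^esub> \<bullet>\<^bsub>?D\<^esub> m"
    "a \<in> carrier N \<Longrightarrow> power_inj n Y i (\<phi> a) = a \<odot>\<^bsub>?D\<^esub> power_inj n Y i \<one>\<^bsub>M\<^esub>"
    if "m \<in> carrier M" for i m a
    using that by (auto simp: power_inj_def direct_power_def ring_bimodule_simps \<phi>_closed intro!: restrict_ext)
  have b: "b i \<in> carrier B" for i
    unfolding B_simps
  proof (intro conjI ballI)
    show "b i \<in> carrier T" unfolding b_def by (rule additive_closed[OF \<rho>'(1) inj(1)]) simp
    fix a assume a: "a \<in> carrier N"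
    \<comment> \<open>Acting with a on the left of the i-th unit vector or with \<phi>(a) on its
      right puts the same entry \<phi>(a) there, and \<open>\<rho>\<close> respects both
      actions.\<close>
    have "a \<odot>\<^bsub>T\<^esub> b i = \<rho> (power_inj n Y i (\<phi> a))"
      unfolding b_def using a by (simp add: \<rho>'(2) inj(1) inj(3)[of "\<one>\<^bsub>M\<^esub>"])
    also have "\<dots> = b i \<bullet>\<^bsub>T\<^esub> \<phi> a"
      unfolding b_def using a by (subst inj(2)) (simp_all add: \<rho>'(3) inj(1) \<phi>_closed)
    finally show "a \<odot>\<^bsub>T\<^esub> b i = b i \<bullet>\<^bsub>T\<^esub> \<phi> a" .
  qed
  have expand: "(\<Oplus>\<^bsub>T\<^esub>i\<in>{..<n}. b i \<bullet>\<^bsub>T\<^esub> ev (\<alpha> i) t) = t" if t: "t \<in> carrier T" for t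
  proof -
    have \<theta>t: "\<theta> t \<in> carrier ?D" by (rule additive_closed[OF \<theta>'(1) t])
    then have \<theta>ti: "\<theta> t i \<in> carrier M" if "i < n" for i
      using that by (auto simp: direct_power_def ring_bimodule_simps)
    \<comment> \<open>Each term is \<open>\<rho>\<close> of the i-th coordinate part of \<theta>(t);
      summed up they give \<rho>(\<theta>(t)), which is t.\<close>
    have "(\<Oplus>\<^bsub>T\<^esub>i\<in>{..<n}. b i \<bullet>\<^bsub>T\<^esub> ev (\<alpha> i) t) = (\<Oplus>\<^bsub>T\<^esub>i\<in>{..<n}. \<rho> (power_inj n Y i (\<theta> t i)))"
    proof (rule abelian_group_finsum_cong[OF T_left(2) refl])
      show "(\<lambda>i. \<rho> (power_inj n Y i (\<theta> t i))) \<in> {..<n} \<rightarrow> carrier T"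
        using \<theta>ti by (simp add: additive_closed[OF \<rho>'(1)] inj(1))
      fix i assume "i \<in> {..<n}"
      then show "b i \<bullet>\<^bsub>T\<^esub> ev (\<alpha> i) t = \<rho> (power_inj n Y i (\<theta> t i))"
        using \<theta>ti t inj(2)[of "\<theta> t i" i] by (simp add: ev_\<alpha> coord_def b_def \<rho>'(3) inj(1))
    qed
    also have "\<dots> = \<rho> (\<Oplus>\<^bsub>?D\<^esub>i\<in>{..<n}. power_inj n Y i (\<theta> t i))"
      by (rule additive_finsum[symmetric, OF D(2) T_left(2) \<rho>'(1)]) (simp_all add: \<theta>ti inj(1))
    also have "\<dots> = t"
      by (simp add: direct_power_expand[OF left_module_simps(2)[OF bimodule_left[OF bimodule_Y]] D(2) \<theta>t] \<rho>\<theta> t)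
    finally show ?thesis .
  qed
  have "(\<Oplus>\<^bsub>C\<^esub>i\<in>{..<n}. pairing (b i) (\<alpha> i)) = \<one>\<^bsub>C\<^esub>"
  proof (rule C_eqI)
    interpret C: ring C by (rule ring_C)
    have cl: "(\<lambda>i. pairing (b i) (\<alpha> i)) \<in> {..<n} \<rightarrow> carrier C" using b \<alpha> by (auto intro: pairing_closed)
    then show "(\<Oplus>\<^bsub>C\<^esub>i\<in>{..<n}. pairing (b i) (\<alpha> i)) \<in> carrier C" by (rule C.finsum_closed)
    fix t assume t: "t \<in> carrier T"
    \<comment> \<open>Evaluation at t is additive on \<open>C\<close>, so the sum of functions
      becomes a sum in \<open>T\<close>.\<close>
    have "(\<Oplus>\<^bsub>C\<^esub>i\<in>{..<n}. pairing (b i) (\<alpha> i)) t = (\<Oplus>\<^bsub>T\<^esub>i\<in>{..<n}. pairing (b i) (\<alpha> i) t)"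
      by (rule additive_finsum[OF C.is_abelian_group T_left(2) _ _ cl, where f = "\<lambda>c. c t"])
        (use t in \<open>auto simp: additive_def C_D C_add_apply\<close>)
    also have "\<dots> = (\<Oplus>\<^bsub>T\<^esub>i\<in>{..<n}. b i \<bullet>\<^bsub>T\<^esub> ev (\<alpha> i) t)"
      by (rule abelian_group_finsum_cong[OF T_left(2) refl])
        (use t b \<alpha> in \<open>auto simp: pairing_apply B_closed T_right(3) ev_closed\<close>)
    finally show "(\<Oplus>\<^bsub>C\<^esub>i\<in>{..<n}. pairing (b i) (\<alpha> i)) t = \<one>\<^bsub>C\<^esub> t"
      by (simp add: expand t C_one_apply)
  qed (rule C_ring)
  then have "dual_bases C R B A pairing ev {..<n} b \<alpha>"
    by (intro dual_bases.intro dual_bases_axioms.intro morita_pairing) (simp_all add: b \<alpha>)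
  then show ?thesis by (rule that)
qed

end

theorem theorem3p10:
  fixes N :: "'n ring" and M :: "'m ring" and \<phi> :: "'n \<Rightarrow> 'm"
  assumes "ring N" and "ring M" and "\<phi> \<in> ring_hom N M"
    and "left_D2 N M \<phi>"
    and R_eq: "R = centralizer_ring N M \<phi>"
    and A_eq: "A = A_bimodule N M \<phi>"
    and B_eq: "B = B_bimodule N M \<phi>"
    and C_eq: "C = C_ring N M \<phi>"
    and T_eq: "T = MM N M \<phi>"
  shows
    "morita_equivalence C R B A TYPE('x) \<and>
     (\<exists>f g. invertible_morita_context C R B A f g) \<and>
     right_progenerator B R TYPE('x \<times> 'y) \<and>
     left_progenerator R A TYPE('x \<times> 'y) \<and>
     \<comment> \<open>1: \<open>\<mu>\<^sub>R\<close>\<close>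
     (\<lambda>t\<in>carrier (tensor B R A).
        tensor_lift C
          (\<lambda>b \<alpha>. \<lambda>u\<in>carrier T. tensor_lift T (\<lambda>m m'. b \<bullet>\<^bsub>T\<^esub> (\<alpha> m \<otimes>\<^bsub>M\<^esub> m')) u) t)
       \<in> bimodule_iso C (tensor B R A) (ring_bimodule C id id) C \<and>
     \<comment> \<open>2: \<open>\<psi>\<close>\<close>
     (\<lambda>b\<in>carrier B. \<lambda>\<alpha>\<in>carrier A. tensor_lift M (\<lambda>m m'. \<alpha> m \<otimes>\<^bsub>M\<^esub> m') b)
       \<in> bimodule_iso C B (left_hom_bimodule R A (ring_bimodule R id id)) R \<and>
     \<comment> \<open>3: \<open>\<tau>\<close>\<close>
     (\<lambda>t\<in>carrier (tensor B R (ring_bimodule M id id)).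
        tensor_lift T (\<lambda>b m. b \<bullet>\<^bsub>T\<^esub> m) t)
       \<in> bimodule_iso C (tensor B R (ring_bimodule M id id)) (eval_bimodule T) M \<and>
     \<comment> \<open>4: \<open>\<iota>\<close>\<close>
     (\<lambda>t\<in>carrier T. \<lambda>\<alpha>\<in>carrier A. tensor_lift M (\<lambda>m m'. \<alpha> m \<otimes>\<^bsub>M\<^esub> m') t)
       \<in> bimodule_iso C (eval_bimodule T)
           (left_hom_bimodule R A (ring_bimodule M id id)) M \<and>
     \<comment> \<open>5\<close>
     (\<lambda>c. \<lambda>b\<in>carrier B. c b) \<in> ring_iso C (end_ring B (right_hom B B R)) \<and>
     \<comment> \<open>6: endomorphisms of the left module act on the right, so their product is reversed\<close>
     (\<lambda>c. \<lambda>\<alpha>\<in>carrier A. \<lambda>m\<in>carrier M. mu_alpha N M \<phi> \<alpha> (c (MM_tensor N M \<phi> m \<one>\<^bsub>M\<^esub>)))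
       \<in> ring_iso C (opposite_ring (end_ring A (left_hom R A A)))"
proof -
  interpret E: ring_extension N M \<phi> R A B C T
    by (rule ring_extension.intro) fact+
  obtain I b \<alpha> where db: "dual_bases C R B A E.pairing E.ev I b \<alpha>"
    by (rule E.dual_bases_C[OF \<open>left_D2 N M \<phi>\<close>])
  \<comment> \<open>The expansion of 1 in \<open>C\<close> comes from depth two, that of 1 in
    \<open>R\<close> from the identity of \<open>M\<close> and 1 (x) 1. The equivalence, the
    progenerators and maps 1, 2, 5 and 6 are read off from this instance.\<close>
  interpret D: morita_dual_bases C R B A E.pairing E.ev I b \<alpha> "{0}" "\<lambda>_. \<lambda>m\<in>carrier M. m"
    "\<lambda>_. MM_tensor N M \<phi> \<one>\<^bsub>M\<^esub> \<one>\<^bsub>M\<^esub>"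
    by (intro morita_dual_bases.intro db E.dual_bases_R)
  interpret r: reconstruction C R B A E.pairing E.ev I b \<alpha> "eval_bimodule T" "ring_bimodule M id id"
    E.ev "rsmult T"
    by (rule E.reconstruct_T[OF db])
  have M_R: "bimodule R (ring_bimodule M id id) M"
    by (rule bimodule_ring_bimodule[OF E.ring_M E.ring_R E.ring_M _ id_ring_hom])
      (auto simp: ring_hom_def E.R_simps)
  \<comment> \<open>Map 3 is a lift into \<open>T\<close>, but the reconstruction works with
    \<open>eval_bimodule T\<close>; the two records have the same addition and right action, so
    balancedness and additivity transfer.\<close>
  have bal: "balanced B R (ring_bimodule M id id) T (rsmult T)"
    using r.b_balanced by (simp add: balanced_def additive_def E.eval_simps)
  have \<tau>: "restrict (tensor_lift T (rsmult T)) (carrier (tensor B R (ring_bimodule M id id)))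
      \<in> bimodule_iso C (tensor B R (ring_bimodule M id id)) (eval_bimodule T) M"
  proof (rule r.tensor_bimodule_iso[OF _ _ E.bimodule_eval M_R])
    show "additive (tensor B R (ring_bimodule M id id)) (eval_bimodule T) (tensor_lift T (rsmult T))"
      using r.P_Y.additive_lift[OF E.T_left(2) bal] by (simp add: additive_def E.eval_simps)
    show "tensor_lift T (rsmult T) (pure_tensor B R (ring_bimodule M id id) x y) = x \<bullet>\<^bsub>T\<^esub> y"
      if "x \<in> carrier B" "y \<in> carrier (ring_bimodule M id id)" for x y
      by (rule r.P_Y.lift_pure[OF E.T_left(2) bal that])
  qed (simp_all add: E.eval_simps ring_bimodule_simps E.T_assoc E.B_closed)
  have \<iota>: "(\<lambda>t\<in>carrier (eval_bimodule T). \<lambda>\<alpha>\<in>carrier A. E.ev \<alpha> t)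
      \<in> bimodule_iso C (eval_bimodule T) (left_hom_bimodule R A (ring_bimodule M id id)) M"
    by (rule r.hom_bimodule_iso[OF E.bimodule_eval])
      (simp add: E.eval_simps ring_bimodule_simps E.ev_right)
  show ?thesis
    \<comment> \<open>The unfoldings replace \<open>pairing\<close> and the abstract actions on
      \<open>B\<close> and \<open>A\<close> by the explicit formulas of the statement.\<close>
    using D.morita_equivalence D.invertible_morita_context D.right_progenerator D.left_progenerator
      D.pairing_iso[unfolded E.pairing_def[abs_def]] D.P_hom_iso \<tau> \<iota>[unfolded E.eval_simps]
      D.right_End_iso[unfolded E.B_simps] D.left_End_iso[unfolded E.A_simps(4)]
    by (intro conjI) blast+
qed

end
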